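(* Let $n\ge 3$ and let $F\in k[x_0,\ldots,x_n]$ be the determinant of the $n\times n$ sub-Hankel matrix $$\begin{pmatrix} x_0&x_1&x_2&\cdots&x_{n-2}&x_{n-1}\\ x_1&x_2&x_3&\cdots&x_{n-1}&x_{n}\\ x_2&x_3&x_4&\cdots&x_{n}&0\\ \vdots&\vdots&\vdots&&\vdots&\vdots\\ x_{n-2}&x_{n-1}&x_{n}&\cdots&0&0\\ x_{n-1}&x_{n}&0&\cdots&0&0 \end{pmatrix}.$$ Let the partial derivatives of $F$ be denoted $F_{x_0},\ldots,F_{x_{n-1}},F_{x_n}$. Then $x_n$ divides $F_{x_i}$ for $0\le i\le n-2$, and for any integer $q\ge 1$ the forms $$\frac{F_{x_0}}{x_n}\,x_n^{q},\ \ldots,\ \frac{F_{x_{n-2}}}{x_n}\,x_n^{q},\quad F_{x_{n-1}}x_n^{q-1}+\frac{F_{x_{n-2}}}{x_n}\,x_{n-1}^{q}$$ belong to $k[x_1,\ldots,x_n]$ and define a codimension $2$ Cohen--Macaulay Cremona map of $\mathbb{P}^{n-1}$.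
   Context: $k$ is an infinite field (taken to be algebraically closed for geometric purposes). In the matrix, whose rows and columns are indexed by $0,\ldots,n-1$, the $(i,j)$ entry is $x_{i+j}$ if $i+j\le n$ and $0$ otherwise. Here $\mathbb{P}^{n-1}$ has homogeneous coordinate ring $k[x_1,\ldots,x_n]$. A Cremona map of $\mathbb{P}^{n-1}$ is a birational map $\mathbb{P}^{n-1}\dashrightarrow\mathbb{P}^{n-1}$ defined by $n$ forms of the same degree; its base ideal is the ideal generated by these forms. It is of codimension $2$ and Cohen--Macaulay if the base ideal has height $2$ and the quotient of $k[x_1,\ldots,x_n]$ by it is Cohen--Macaulay.
   Formalization: The formal statement additionally assumes that k has characteristic 0 or at least n; in smaller characteristic the claim fails (for n=3 in characteristic 2, F_{x_1}=0, so one of the forms vanishes and the map is not Cremona). *)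

theory Defs
  imports
    "HOL-Library.Poly_Mapping"
    "HOL-Library.Extended_Nat"
    "HOL-Algebra.QuotRing"
    "HOL-Algebra.Ring_Divisibility"
    "Jordan_Normal_Form.Determinant"
begin

section \<open>Polynomials in the variables \<open>x\<^sub>0, x\<^sub>1, x\<^sub>2, \<dots>\<close>\<close>

text \<open>
  A monomial is a finitely supported exponent vector.  The polynomial rings in finitely many
  variables are subrings of the type below; as this type is an integral domain, the library
  determinant and \<open>dvd\<close> apply to it directly.
\<close>

type_synonym 'k mpoly = "(nat \<Rightarrow>\<^sub>0 nat) \<Rightarrow>\<^sub>0 'k"

definition Var :: "nat \<Rightarrow> 'k::field mpoly" where
  "Var i = Poly_Mapping.single (Poly_Mapping.single i 1) 1"

definition Const :: "'k::field \<Rightarrow> 'k mpoly" where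
  "Const c = Poly_Mapping.single 0 c"

definition vars :: "'k::field mpoly \<Rightarrow> nat set" where
  "vars p = (\<Union>m\<in>Poly_Mapping.keys p. Poly_Mapping.keys m)"

definition homogeneous :: "nat \<Rightarrow> 'k::field mpoly \<Rightarrow> bool" where
  "homogeneous d p \<longleftrightarrow>
     (\<forall>m\<in>Poly_Mapping.keys p. (\<Sum>i\<in>Poly_Mapping.keys m. Poly_Mapping.lookup m i) = d)"

text \<open>
  The subtraction of exponents truncates at \<open>0\<close>, but then the coefficient is \<open>0\<close>.
\<close>

definition partial_deriv :: "nat \<Rightarrow> 'k::field mpoly \<Rightarrow> 'k mpoly" where
  "partial_deriv i p =
     (\<Sum>m\<in>Poly_Mapping.keys p.
        Poly_Mapping.single (m - Poly_Mapping.single i 1)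
          (of_nat (Poly_Mapping.lookup m i) * Poly_Mapping.lookup p m))"

definition subst :: "(nat \<Rightarrow> 'k::field mpoly) \<Rightarrow> 'k mpoly \<Rightarrow> 'k mpoly" where
  "subst s p =
     (\<Sum>m\<in>Poly_Mapping.keys p.
        Const (Poly_Mapping.lookup p m) *
        (\<Prod>i\<in>Poly_Mapping.keys m. s i ^ Poly_Mapping.lookup m i))"

text \<open>
  The quotient \<open>p / d\<close>; it is meant only for \<open>d \<noteq> 0\<close> dividing \<open>p\<close>, when it is unique.
\<close>

definition exact_quot :: "'k::field mpoly \<Rightarrow> 'k mpoly \<Rightarrow> 'k mpoly" where
  "exact_quot p d = (THE c. p = d * c)"

lemma exact_quot_mult: "d \<noteq> 0 \<Longrightarrow> exact_quot (d * c) d = c"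
  unfolding exact_quot_def by auto

definition poly_ring :: "nat set \<Rightarrow> 'k::field mpoly ring" where
  "poly_ring V =
     \<lparr>carrier = {p. vars p \<subseteq> V}, monoid.mult = (*), one = 1, zero = 0, add = (+)\<rparr>"

lemma cring_poly_ring: "cring (poly_ring V :: 'k::field mpoly ring)"
proof -
  have vars_add: "vars (p + q) \<subseteq> vars p \<union> vars q" for p q :: "'k mpoly"
    using Poly_Mapping.keys_add[of p q] unfolding vars_def by blast
  have vars_uminus: "vars (- p) = vars p" for p :: "'k mpoly"
    unfolding vars_def by simp
  have vars_mult: "vars (p * q) \<subseteq> vars p \<union> vars q" for p q :: "'k mpoly"
  proof
    fix i assume "i \<in> vars (p * q)"
    then obtain a b where "a \<in> Poly_Mapping.keys p" "b \<in> Poly_Mapping.keys q"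
      and "i \<in> Poly_Mapping.keys (a + b)"
      using Poly_Mapping.keys_mult[of p q] unfolding vars_def by blast
    then show "i \<in> vars p \<union> vars q"
      using Poly_Mapping.keys_add[of a b] unfolding vars_def by blast
  qed
  have vars_0_1: "vars (0 :: 'k mpoly) = {}" "vars (1 :: 'k mpoly) = {}"
    unfolding vars_def by auto
  show ?thesis
  proof (rule cringI)
    show "abelian_group (poly_ring V :: 'k mpoly ring)"
    proof (rule abelian_groupI)
      fix p :: "'k mpoly" assume "p \<in> carrier (poly_ring V)"
      then show "\<exists>q\<in>carrier (poly_ring V). q \<oplus>\<^bsub>poly_ring V\<^esub> p = \<zero>\<^bsub>poly_ring V\<^esub>"
        by (intro bexI[of _ "- p"]) (auto simp: poly_ring_def vars_uminus)
    qed (use vars_add vars_0_1 in \<open>auto simp: poly_ring_def ac_simps, blast?\<close>)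
    show "Group.comm_monoid (poly_ring V :: 'k mpoly ring)"
      by (rule comm_monoidI) (use vars_mult vars_0_1 in \<open>auto simp: poly_ring_def ac_simps, blast?\<close>)
  qed (auto simp: poly_ring_def algebra_simps)
qed


section \<open>Height and Cohen--Macaulay rings\<close>

definition prime_height :: "('a, 'b) ring_scheme \<Rightarrow> 'a set \<Rightarrow> enat" where
  "prime_height R P =
     Sup {enat r |r. \<exists>Q :: nat \<Rightarrow> 'a set. (\<forall>i\<le>r. primeideal (Q i) R) \<and>
                       (\<forall>i<r. Q i \<subset> Q (Suc i)) \<and> Q r = P}"

text \<open>The unit ideal gets height \<open>\<infinity>\<close>.\<close>

definition ideal_height :: "('a, 'b) ring_scheme \<Rightarrow> 'a set \<Rightarrow> enat" where
  "ideal_height R I = Inf {prime_height R P |P. primeideal P R \<and> I \<subseteq> P}"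

text \<open>
  \<open>a\<^sub>1, \<dots>, a\<^sub>r\<close> is a regular sequence: \<open>a\<^sub>i\<close> is a nonzerodivisor modulo
  \<open>(a\<^sub>1, \<dots>, a\<^bsub>i-1\<^esub>)\<close>, and \<open>(a\<^sub>1, \<dots>, a\<^sub>r)\<close> is a proper ideal.
\<close>

definition regular_sequence :: "('a, 'b) ring_scheme \<Rightarrow> 'a list \<Rightarrow> bool" where
  "regular_sequence R as \<longleftrightarrow>
     set as \<subseteq> carrier R \<and>
     (\<forall>i<length as. \<forall>b\<in>carrier R.
        as ! i \<otimes>\<^bsub>R\<^esub> b \<in> Idl\<^bsub>R\<^esub> (set (take i as)) \<longrightarrow> b \<in> Idl\<^bsub>R\<^esub> (set (take i as))) \<and>
     Idl\<^bsub>R\<^esub> (set as) \<noteq> carrier R"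

definition depth :: "('a, 'b) ring_scheme \<Rightarrow> 'a set \<Rightarrow> enat" where
  "depth R I = Sup {enat (length as) |as. regular_sequence R as \<and> set as \<subseteq> I}"

text \<open>
  This is the definition of Eisenbud (\<^emph>\<open>Commutative Algebra\<close>, Section 18.2), which does not
  need localizations: the depth of every maximal ideal equals its height.
\<close>

definition cohen_macaulay :: "('a, 'b) ring_scheme \<Rightarrow> bool" where
  "cohen_macaulay R \<longleftrightarrow>
     cring R \<and> noetherian_ring R \<and> (\<forall>M. maximalideal M R \<longrightarrow> depth R M = prime_height R M)"


section \<open>Cremona maps of \<open>\<bbbP>\<^bsup>n-1\<^esup>\<close>\<close>

text \<open>
  The homogeneous coordinates of \<open>\<bbbP>\<^bsup>n-1\<^esup>\<close> are \<open>x\<^sub>1, \<dots>, x\<^sub>n\<close>.  A rational map to itself is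
  represented by a list of \<open>n\<close> forms of the same degree, not all zero; the entry at position
  \<open>i\<close> (counted from \<open>0\<close>) is the coordinate \<open>x\<^bsub>i+1\<^esub>\<close> of the image.
\<close>

definition represents_map :: "nat \<Rightarrow> 'k::field mpoly list \<Rightarrow> bool" where
  "represents_map n fs \<longleftrightarrow>
     length fs = n \<and>
     (\<exists>d. \<forall>f\<in>set fs. f \<in> carrier (poly_ring {1..n}) \<and> homogeneous d f) \<and>
     (\<exists>f\<in>set fs. f \<noteq> 0)"

text \<open>Two representatives give the same rational map iff they are proportional.\<close>

definition same_map :: "'k::field mpoly list \<Rightarrow> 'k mpoly list \<Rightarrow> bool" where
  "same_map fs gs \<longleftrightarrow>
     length fs = length gs \<and>
     (\<forall>i<length fs. \<forall>j<length fs. fs ! i * gs ! j = fs ! j * gs ! i)"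

definition identity_map :: "nat \<Rightarrow> 'k::field mpoly list" where
  "identity_map n = map Var [1..<Suc n]"

text \<open>First \<open>fs\<close>, then \<open>gs\<close>; the composite is defined iff its entries are not all zero.\<close>

definition compose_map :: "'k::field mpoly list \<Rightarrow> 'k mpoly list \<Rightarrow> 'k mpoly list" where
  "compose_map gs fs = map (subst (\<lambda>j. fs ! (j - 1))) gs"

definition cremona_map :: "nat \<Rightarrow> 'k::field mpoly list \<Rightarrow> bool" where
  "cremona_map n fs \<longleftrightarrow>
     represents_map n fs \<and>
     (\<exists>gs. represents_map n gs \<and>
        represents_map n (compose_map gs fs) \<and> same_map (compose_map gs fs) (identity_map n) \<and>
        represents_map n (compose_map fs gs) \<and> same_map (compose_map fs gs) (identity_map n))"

definition base_ideal :: "nat \<Rightarrow> 'k::field mpoly list \<Rightarrow> 'k mpoly set" where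
  "base_ideal n fs = Idl\<^bsub>poly_ring {1..n}\<^esub> (set fs)"

definition codim2_cm_cremona_map :: "nat \<Rightarrow> 'k::field mpoly list \<Rightarrow> bool" where
  "codim2_cm_cremona_map n fs \<longleftrightarrow>
     cremona_map n fs \<and>
     ideal_height (poly_ring {1..n}) (base_ideal n fs) = 2 \<and>
     cohen_macaulay (poly_ring {1..n} Quot base_ideal n fs)"


section \<open>The sub-Hankel determinant\<close>

definition sub_hankel :: "nat \<Rightarrow> 'k::field mpoly mat" where
  "sub_hankel n = mat n n (\<lambda>(i, j). if i + j \<le> n then Var (i + j) else 0)"

definition sub_hankel_det :: "nat \<Rightarrow> 'k::field mpoly" where
  "sub_hankel_det n = Determinant.det (sub_hankel n)"

end

theory Submission
  imports Defs "HOL-Computational_Algebra.Polynomial" "HOL-Computational_Algebra.Formal_Power_Series"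
begin

text \<open>
  Write \<open>z = x\<^sub>n\<close> and \<open>y = x\<^bsub>n-1\<^esub>\<close>.  Everything is governed by the power series
  \<open>A(u) = 1 + \<Sum>\<^bsub>j\<ge>1\<^esub> x\<^bsub>n-j\<^esub> z\<^bsup>j-1\<^esup> u\<^sup>j\<close>, its inverse \<open>E = 1/A\<close> and \<open>G = E\<^sup>2\<close>, with
  coefficients \<open>E\<^sub>m\<close>, \<open>G\<^sub>m\<close>.  A column operation whose coefficients are the \<open>E\<^sub>m\<close>, times powers of
  \<open>z\<close>, clears all but one entry of the first column of the matrix, because \<open>E A = 1\<close>; this gives
  \<open>F = \<plusminus>E\<^sub>n\<close> (\<open>sub_hankel_det_eq\<close>).  Since \<open>dE = - E\<^sup>2 dA\<close>, the partial derivatives are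
  \<open>F\<^bsub>x\<^sub>i\<^esub> = \<plusminus>z\<^bsup>n-1-i\<^esup> G\<^sub>i\<close> for \<open>i < n\<close> (\<open>partial_deriv_sub_hankel_det\<close>).  This shows
  the divisibility by \<open>z\<close>.  As \<open>G\<^sub>i\<close> involves only \<open>x\<^bsub>n-i\<^esub>, \<dots>, x\<^sub>n\<close>, the forms in question lie in
  \<open>k[x\<^sub>1, \<dots>, x\<^sub>n]\<close>: up to a common sign they are \<open>f\<^sub>i = z\<^bsup>n-2-i+q\<^esup> G\<^sub>i\<close> for \<open>i \<le> n - 2\<close>, and
  \<open>f\<^bsub>n-1\<^esub> = z\<^bsup>q-1\<^esup> G\<^bsub>n-1\<^esub> + y\<^sup>q G\<^bsub>n-2\<^esub>\<close>.  The relation \<open>A G' = - 2 A' G\<close> says that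
  \<open>\<Sum>\<^sub>j (i + j) a\<^sub>j G\<^bsub>i-j\<^esub> = 0\<close>, where \<open>a\<^sub>j\<close> are the coefficients of \<open>A\<close> (\<open>G_relation\<close>).  It is used
  in two ways.

  \<^emph>\<open>The map is birational.\<close>  The relation can be solved for \<open>G\<^sub>i\<close>, with factor \<open>i\<close>, but also for
  \<open>a\<^sub>i\<close>, with factor \<open>2 i\<close>.  So the series \<open>G\<close> up to degree \<open>n - 1\<close> determines the \<open>a\<^sub>i\<close>, hence the
  point, by rational formulas.  The forms determine \<open>G\<^sub>i\<close> for \<open>i \<le> n - 2\<close> up to scaling, hence \<open>y\<close>;
  then the last form determines \<open>G\<^bsub>n-1\<^esub>\<close>.  Homogenizing these formulas gives an explicit inverse
  (\<open>cremona_map_forms\<close>).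

  \<^emph>\<open>The base ideal \<open>I\<close>.\<close>  Let \<open>S = k[x\<^sub>1, \<dots>, x\<^bsub>n-2\<^esub>]\<close>.  As a polynomial in \<open>y\<close>, \<open>G\<^sub>i\<close> has degree
  \<open>i\<close> and leading coefficient \<open>\<plusminus>(i + 1)\<close>.  The same relation, multiplied by a suitable power of
  \<open>z\<close>, is a syzygy of the forms.  It shows that \<open>I\<close> is spanned over \<open>S[z]\<close> by the forms and their
  multiples by some powers of \<open>y\<close>, in such a way that there is one generator of each degree \<open>e\<close> in
  \<open>y\<close>, and that its leading coefficient is a unit times a power \<open>z\<^bsup>h(e)\<^esup>\<close>
  (\<open>span_eq_base_ideal\<close>, \<open>basis_coeff\<close>).  Division with remainder then shows that
  \<open>k[x\<^sub>1, \<dots>, x\<^sub>n]/I\<close> is free over \<open>S\<close>, with a basis formed by the monomials \<open>y\<^sup>e z\<^sup>i\<close> with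
  \<open>i < h(e)\<close> (\<open>ex_normal_form\<close>, \<open>span_Int_normal_trivial\<close>), so that regular sequences of \<open>S\<close> remain
  regular on the quotient (\<open>nzd_mod_base_ideal\<close>).

  The first form is a power of \<open>z\<close>, and modulo \<open>z\<close> the last one is a unit times a power of \<open>y\<close>.
  Therefore the primes containing \<open>I\<close> are the primes containing \<open>y\<close> and \<open>z\<close>.  A chain of primes of a
  polynomial ring in \<open>d\<close> variables has at most \<open>d\<close> proper inclusions (\<open>prime_chain_length_le\<close>), so
  \<open>I\<close> has height \<open>2\<close> and the primes of the quotient have height at most \<open>n - 2\<close>.  A maximal ideal of
  the quotient contracts to a maximal ideal of \<open>S\<close>, which contains a regular sequence of length
  \<open>n - 2\<close> (\<open>ex_reg_seq_maximal\<close>, by Nagata's change of variables).  So its depth is at least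
  \<open>n - 2\<close>; and depth never exceeds height (\<open>depth_le_prime_height\<close>).
\<close>

section \<open>Polynomials in many variables\<close>

abbreviation lkp :: "('a \<Rightarrow>\<^sub>0 'b::zero) \<Rightarrow> 'a \<Rightarrow> 'b" where "lkp \<equiv> Poly_Mapping.lookup"
abbreviation keys :: "('a \<Rightarrow>\<^sub>0 'b::zero) \<Rightarrow> 'a set" where "keys \<equiv> Poly_Mapping.keys"
abbreviation sgl :: "'a \<Rightarrow> 'b \<Rightarrow> 'a \<Rightarrow>\<^sub>0 'b::zero" where "sgl \<equiv> Poly_Mapping.single"

lemma sum_of_terms: "p = (\<Sum>m\<in>keys p. sgl m (lkp p m))"
proof (rule poly_mapping_eqI)
  fix k
  have "lkp (\<Sum>m\<in>keys p. sgl m (lkp p m)) k = (\<Sum>m\<in>keys p. if m = k then lkp p m else 0)"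
    by (auto simp: lookup_sum lookup_single when_def intro!: sum.cong)
  also have "\<dots> = lkp p k"
    by (simp add: in_keys_iff)
  finally show "lkp p k = lkp (\<Sum>m\<in>keys p. sgl m (lkp p m)) k" ..
qed

definition polys :: "nat set \<Rightarrow> 'k::field mpoly set" where
  "polys V = {p. vars p \<subseteq> V}"

lemma carrier_poly_ring: "carrier (poly_ring V) = polys V"
  by (simp add: poly_ring_def polys_def)

lemma polys_iff: "p \<in> polys V \<longleftrightarrow> (\<forall>m\<in>keys p. keys m \<subseteq> V)"
  by (auto simp: polys_def vars_def)

lemma polys_mono: "V \<subseteq> W \<Longrightarrow> polys V \<subseteq> polys W"
  by (auto simp: polys_def)

lemma polys_monoD: "p \<in> polys V \<Longrightarrow> V \<subseteq> W \<Longrightarrow> p \<in> polys W"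
  using polys_mono by blast

lemma polys_single: "keys m \<subseteq> V \<Longrightarrow> sgl m c \<in> polys V"
  by (auto simp: polys_iff split: if_splits)

lemma polys_add [intro]: "p \<in> polys V \<Longrightarrow> q \<in> polys V \<Longrightarrow> p + q \<in> polys V"
  using Poly_Mapping.keys_add[of p q] unfolding polys_iff by blast

lemma polys_mult [intro]:
  assumes "p \<in> polys V" "q \<in> polys V" shows "p * q \<in> polys V"
  unfolding polys_iff
proof
  fix m assume "m \<in> keys (p * q)"
  then obtain a b where "a \<in> keys p" "b \<in> keys q" "m = a + b"
    using keys_mult[of p q] by blast
  then show "keys m \<subseteq> V"
    using assms Poly_Mapping.keys_add[of a b] unfolding polys_iff by blast
qed

lemma polys_0 [simp]: "0 \<in> polys V" and polys_1 [simp]: "1 \<in> polys V"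
  by (auto simp: polys_iff)

lemma polys_uminus [intro]: "p \<in> polys V \<Longrightarrow> - p \<in> polys V"
  by (auto simp: polys_iff)

lemma polys_diff [intro]: "p \<in> polys V \<Longrightarrow> q \<in> polys V \<Longrightarrow> p - q \<in> polys V"
  using polys_add[of p V "- q"] by (simp add: polys_uminus)

lemma polys_Const [simp]: "Const c \<in> polys V"
  by (auto simp: polys_iff Const_def split: if_splits)

lemma polys_Var: "i \<in> V \<Longrightarrow> Var i \<in> polys V"
  by (auto simp: polys_iff Var_def)

lemma polys_Var_iff [simp]: "Var i \<in> polys V \<longleftrightarrow> i \<in> V"
  by (auto simp: polys_iff Var_def)

lemma polys_power [intro]: "p \<in> polys V \<Longrightarrow> p ^ e \<in> polys V"
  by (induction e) auto

lemma polys_sum [intro]: "(\<And>x. x \<in> X \<Longrightarrow> f x \<in> polys V) \<Longrightarrow> sum f X \<in> polys V"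
  by (induction X rule: infinite_finite_induct) auto

lemma polys_prod [intro]: "(\<And>x. x \<in> X \<Longrightarrow> f x \<in> polys V) \<Longrightarrow> prod f X \<in> polys V"
  by (induction X rule: infinite_finite_induct) auto

lemma Const_0 [simp]: "Const 0 = 0" and Const_1 [simp]: "Const 1 = 1"
  by (simp_all add: Const_def)

lemma Const_add: "Const (a + b) = Const a + Const b"
  and Const_mult: "Const (a * b) = Const a * Const b"
  by (simp_all add: Const_def single_add mult_single)

lemma Const_eq_0_iff [simp]: "Const c = 0 \<longleftrightarrow> c = 0"
  by (metis Const_0 Const_def lookup_single_eq lookup_zero)

lemma Const_uminus: "Const (- a) = - Const a"
  by (simp add: Const_def single_uminus)

lemma Const_of_nat: "Const (of_nat m) = of_nat m"
  by (simp add: Const_def)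

lemma lookup_Const_mult: "lkp (Const c * p) m = c * lkp p m"
  by (simp add: Const_def when_def map.rep_eq flip: mult_map_scale_conv_mult)

lemma Var_neq_0 [simp]: "Var i \<noteq> 0"
  by (simp add: Var_def single_zero flip: keys_eq_empty)

lemma Var_power: "Var i ^ e = sgl (sgl i e) 1"
  by (induction e) (simp_all add: Var_def mult_single flip: single_add)

lemma single_eq_prod:
  "sgl m c = Const c * (\<Prod>i\<in>keys m. Var i ^ lkp m i)"
proof -
  have prod: "(\<Prod>i\<in>X. sgl (g i) (1::'a)) = sgl (\<Sum>i\<in>X. g i) 1" if "finite X"
    for X and g :: "nat \<Rightarrow> (nat \<Rightarrow>\<^sub>0 nat)"
    using that by induction (simp_all add: mult_single)
  have "(\<Prod>i\<in>keys m. Var i ^ lkp m i) = sgl m (1::'a)"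
    by (simp add: Var_power prod flip: sum_of_terms)
  then show ?thesis
    by (simp add: Const_def mult_single)
qed

text \<open>
  Polynomials are generated by constants and variables as a ring.  All homomorphisms below are
  compared, and closure properties proved, through this rule and \<open>hom_eqI\<close>.
\<close>

lemma polys_induct [consumes 1, case_names Const Var add mult]:
  assumes "p \<in> polys V"
    and "\<And>c. P (Const c)" "\<And>i. i \<in> V \<Longrightarrow> P (Var i)"
    and add: "\<And>p q. p \<in> polys V \<Longrightarrow> q \<in> polys V \<Longrightarrow> P p \<Longrightarrow> P q \<Longrightarrow> P (p + q)"
    and mult: "\<And>p q. p \<in> polys V \<Longrightarrow> q \<in> polys V \<Longrightarrow> P p \<Longrightarrow> P q \<Longrightarrow> P (p * q)"
  shows "P p"
proof -
  let ?Q = "\<lambda>p. p \<in> polys V \<and> P p"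
  have one: "?Q 1" and zero: "?Q 0"
    using assms(2)[of 1] assms(2)[of 0] by auto
  have pow: "?Q (Var i ^ e)" if "i \<in> V" for i e
    using that one assms(3) mult by (induction e) auto
  have prod: "?Q (\<Prod>i\<in>X. Var i ^ f i)" if "finite X" "X \<subseteq> V" for X f
    using that
  proof induction
    case (insert x X)
    then have "?Q (Var x ^ f x)" "?Q (\<Prod>i\<in>X. Var i ^ f i)"
      using pow by auto
    then show ?case
      using insert mult by auto
  qed (use one in auto)
  have single: "?Q (sgl m c)" if "keys m \<subseteq> V" for m c
    unfolding single_eq_prod[of m c] using prod[OF _ that, of "lkp m"] assms(2) mult by auto
  have "?Q (\<Sum>m\<in>X. sgl m (lkp p m))" if "finite X" "X \<subseteq> keys p" for X
    using that
  proof induction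
    case (insert x X)
    then have "?Q (sgl x (lkp p x))" "?Q (\<Sum>m\<in>X. sgl m (lkp p m))"
      using single assms(1) by (auto simp: polys_iff)
    then show ?case
      using insert add by auto
  qed (use zero in auto)
  from this[of "keys p"] show ?thesis
    using sum_of_terms[of p] by auto
qed

text \<open>
  The universal property of the polynomial ring: both substitution and the view as a polynomial
  in one distinguished variable are instances.
\<close>

definition mpoly_eval :: "('k::field \<Rightarrow> 'b::comm_ring_1) \<Rightarrow> (nat \<Rightarrow> 'b) \<Rightarrow> 'k mpoly \<Rightarrow> 'b" where
  "mpoly_eval h s p = (\<Sum>m\<in>keys p. h (lkp p m) * (\<Prod>i\<in>keys m. s i ^ lkp m i))"

lemma comm_ring_hom_mpoly_eval:
  assumes "comm_ring_hom h"
  shows "comm_ring_hom (mpoly_eval h s)"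
proof -
  interpret h: comm_ring_hom h by fact
  define M where "M m = (\<Prod>i\<in>keys m. s i ^ lkp m i)" for m :: "nat \<Rightarrow>\<^sub>0 nat"
  have M_super: "M m = (\<Prod>i\<in>X. s i ^ lkp m i)" if "finite X" "keys m \<subseteq> X" for m X
    unfolding M_def using that
    by (intro prod.mono_neutral_left) (auto simp: in_keys_iff)
  have M_add: "M (a + b) = M a * M b" for a b
    using M_super[of "keys a \<union> keys b" a] M_super[of "keys a \<union> keys b" b]
      M_super[of "keys a \<union> keys b" "a + b"] Poly_Mapping.keys_add[of a b]
    by (simp add: lookup_add power_add prod.distrib)
  have M_0: "M 0 = 1"
    by (simp add: M_def)
  have ev: "mpoly_eval h s p = (\<Sum>m\<in>X. h (lkp p m) * M m)" if "finite X" "keys p \<subseteq> X" for p X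
    unfolding mpoly_eval_def M_def using that
    by (intro sum.mono_neutral_left) (auto simp: in_keys_iff)
  have ev_add: "mpoly_eval h s (p + q) = mpoly_eval h s p + mpoly_eval h s q" for p q
    using ev[of "keys p \<union> keys q" p] ev[of "keys p \<union> keys q" q]
      ev[of "keys p \<union> keys q" "p + q"] Poly_Mapping.keys_add[of p q]
    by (simp add: lookup_add h.hom_add distrib_right sum.distrib)
  have ev_0: "mpoly_eval h s 0 = 0"
    by (simp add: mpoly_eval_def)
  have ev_sum: "mpoly_eval h s (sum f X) = (\<Sum>x\<in>X. mpoly_eval h s (f x))" for f :: "(nat \<Rightarrow>\<^sub>0 nat) \<Rightarrow> _" and X
    by (induction X rule: infinite_finite_induct) (simp_all add: ev_0 ev_add)
  have ev_single: "mpoly_eval h s (sgl m c) = h c * M m" for m c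
    using ev[of "{m}" "sgl m c"] by simp
  have ev_mult: "mpoly_eval h s (p * q) = mpoly_eval h s p * mpoly_eval h s q" for p q
  proof -
    have "p * q = (\<Sum>a\<in>keys p. sgl a (lkp p a)) * (\<Sum>b\<in>keys q. sgl b (lkp q b))"
      using sum_of_terms[of p] sum_of_terms[of q] by metis
    also have "\<dots> = (\<Sum>a\<in>keys p. \<Sum>b\<in>keys q. sgl (a + b) (lkp p a * lkp q b))"
      by (simp add: sum_product mult_single)
    finally have "mpoly_eval h s (p * q)
        = (\<Sum>a\<in>keys p. \<Sum>b\<in>keys q. (h (lkp p a) * M a) * (h (lkp q b) * M b))"
      by (simp add: ev_sum ev_single M_add h.hom_mult mult_ac)
    also have "\<dots> = mpoly_eval h s p * mpoly_eval h s q"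
      using ev[of "keys p" p] ev[of "keys q" q] by (simp add: sum_product)
    finally show ?thesis .
  qed
  show ?thesis
    by unfold_locales (use ev_add ev_mult ev_0 ev_single[of 0 1] M_0 in \<open>simp_all add: flip: single_one\<close>)
qed

lemma mpoly_eval_Const: "comm_ring_hom h \<Longrightarrow> mpoly_eval h s (Const c) = h c"
  using zero_hom.hom_zero[of h]
  by (cases "c = 0") (auto simp: mpoly_eval_def Const_def comm_ring_hom_def ring_hom_def semiring_hom_def
      comm_monoid_add_hom_def monoid_add_hom_def)

lemma mpoly_eval_Var: "comm_ring_hom h \<Longrightarrow> mpoly_eval h s (Var i) = s i"
  using one_hom.hom_one[of h]
  by (auto simp: mpoly_eval_def Var_def comm_ring_hom_def ring_hom_def semiring_hom_def
      monoid_mult_hom_def)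

lemma comm_ring_hom_Const: "comm_ring_hom Const"
  by unfold_locales (simp_all add: Const_add Const_mult)

lemma subst_eq_mpoly_eval: "subst s = mpoly_eval Const s"
  by (rule ext) (simp add: subst_def mpoly_eval_def)

interpretation subst: comm_ring_hom "subst s" for s :: "nat \<Rightarrow> 'k::field mpoly"
  unfolding subst_eq_mpoly_eval by (intro comm_ring_hom_mpoly_eval comm_ring_hom_Const)

lemma subst_Const [simp]: "subst s (Const c) = Const c"
  and subst_Var [simp]: "subst s (Var i) = s i"
  unfolding subst_eq_mpoly_eval
  by (simp_all add: mpoly_eval_Const mpoly_eval_Var comm_ring_hom_Const)

lemma subst_in_polys:
  assumes "p \<in> polys V" "\<And>i. i \<in> V \<Longrightarrow> s i \<in> polys W"
  shows "subst s p \<in> polys W"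
  using assms by (induction rule: polys_induct) (auto simp: subst.hom_add subst.hom_mult)

lemma hom_eqI:
  assumes "comm_ring_hom f" "comm_ring_hom g" "p \<in> polys V"
    "\<And>c. f (Const c) = g (Const c)" "\<And>i. i \<in> V \<Longrightarrow> f (Var i) = g (Var i)"
  shows "f p = g p"
proof -
  interpret f: comm_ring_hom f by fact
  interpret g: comm_ring_hom g by fact
  show ?thesis
    using assms(3-) by (induction rule: polys_induct) (simp_all add: f.hom_add g.hom_add f.hom_mult g.hom_mult)
qed

lemma comm_ring_hom_comp: "comm_ring_hom f \<Longrightarrow> comm_ring_hom g \<Longrightarrow> comm_ring_hom (\<lambda>x. f (g x))"
proof -
  assume f: "comm_ring_hom f" and g: "comm_ring_hom g"
  interpret f: comm_ring_hom f by fact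
  interpret g: comm_ring_hom g by fact
  show ?thesis
    by unfold_locales (simp_all add: f.hom_add g.hom_add f.hom_mult g.hom_mult)
qed

lemma comm_ring_hom_id: "comm_ring_hom (\<lambda>x. x)"
  by unfold_locales simp_all

lemma subst_cong: "p \<in> polys V \<Longrightarrow> (\<And>i. i \<in> V \<Longrightarrow> s i = t i) \<Longrightarrow> subst s p = subst t p"
  by (rule hom_eqI[OF subst.comm_ring_hom_axioms subst.comm_ring_hom_axioms]) simp_all

lemma subst_subst:
  "subst s (subst t p) = subst (\<lambda>i. subst s (t i)) p"
  by (rule hom_eqI[OF comm_ring_hom_comp[OF subst.comm_ring_hom_axioms subst.comm_ring_hom_axioms]
        subst.comm_ring_hom_axioms, of _ UNIV]) (simp_all add: polys_def)

section \<open>Homogeneity\<close>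

lemma homogeneous_alt:
  "homogeneous d p \<longleftrightarrow> (\<forall>m\<in>keys p. sum (lkp m) (keys m) = d)"
  by (simp add: homogeneous_def)

lemma total_degree_add:
  "sum (lkp (a + b)) (keys (a + b)) = sum (lkp a) (keys a) + sum (lkp b) (keys (b::nat \<Rightarrow>\<^sub>0 nat))"
proof -
  have *: "sum (lkp m) (keys m) = sum (lkp m) X" if "finite X" "keys m \<subseteq> X" for X and m :: "nat \<Rightarrow>\<^sub>0 nat"
    using that by (intro sum.mono_neutral_left) (auto simp: in_keys_iff)
  show ?thesis
    using *[of "keys a \<union> keys b" a] *[of "keys a \<union> keys b" b] *[of "keys a \<union> keys b" "a + b"]
      Poly_Mapping.keys_add[of a b] by (simp add: lookup_add sum.distrib)
qed

lemma homogeneous_0 [simp]: "homogeneous d 0"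
  by (simp add: homogeneous_def)

lemma homogeneous_Const [simp]: "homogeneous 0 (Const c)"
  by (simp add: homogeneous_def Const_def)

lemma homogeneous_1 [simp]: "homogeneous 0 1"
  by (simp add: homogeneous_def)

lemma homogeneous_Var [simp]: "homogeneous (Suc 0) (Var i)"
  by (simp add: homogeneous_def Var_def)

lemma homogeneous_add: "homogeneous d p \<Longrightarrow> homogeneous d q \<Longrightarrow> homogeneous d (p + q)"
  using Poly_Mapping.keys_add[of p q] unfolding homogeneous_def by blast

lemma homogeneous_uminus: "homogeneous d p \<Longrightarrow> homogeneous d (- p)"
  by (simp add: homogeneous_def)

lemma homogeneous_diff: "homogeneous d p \<Longrightarrow> homogeneous d q \<Longrightarrow> homogeneous d (p - q)"
  using homogeneous_add[of d p "- q"] by (simp add: homogeneous_uminus)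

lemma homogeneous_mult:
  "homogeneous d p \<Longrightarrow> homogeneous e q \<Longrightarrow> homogeneous (d + e) (p * q)"
  using keys_mult[of p q] unfolding homogeneous_alt
  by (smt (verit, best) mem_Collect_eq subsetD total_degree_add)

lemma homogeneous_mult': "homogeneous d p \<Longrightarrow> homogeneous e q \<Longrightarrow> r = d + e \<Longrightarrow> homogeneous r (p * q)"
  using homogeneous_mult by blast

lemma homogeneous_power: "homogeneous d p \<Longrightarrow> homogeneous (e * d) (p ^ e)"
  by (induction e) (auto intro!: homogeneous_mult')

lemma homogeneous_sum: "(\<And>x. x \<in> X \<Longrightarrow> homogeneous d (f x)) \<Longrightarrow> homogeneous d (sum f X)"
  by (induction X rule: infinite_finite_induct) (auto intro: homogeneous_add)

lemma homogeneous_Const_mult: "homogeneous d p \<Longrightarrow> homogeneous d (Const c * p)"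
  using homogeneous_mult[of 0 "Const c" d p] by simp

lemma homogeneous_of_nat_mult: "homogeneous d p \<Longrightarrow> homogeneous d (of_nat c * p)"
  using homogeneous_Const_mult[of d p "of_nat c"] by (simp add: Const_of_nat)

lemma homogeneous_subst:
  assumes p: "homogeneous d p" "p \<in> polys V" and s: "\<And>i. i \<in> V \<Longrightarrow> homogeneous e (s i)"
  shows "homogeneous (d * e) (subst s p)"
  unfolding subst_def
proof (intro homogeneous_sum homogeneous_Const_mult)
  fix m assume m: "m \<in> keys p"
  have prod: "homogeneous ((\<Sum>i\<in>X. lkp m i) * e) (\<Prod>i\<in>X. s i ^ lkp m i)" if "finite X" "X \<subseteq> V" for X
    using that
    by (induction) (auto simp: distrib_right intro!: homogeneous_mult homogeneous_power s)
  from prod[of "keys m"] show "homogeneous (d * e) (\<Prod>i\<in>keys m. s i ^ lkp m i)"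
    using m p unfolding homogeneous_alt polys_iff by auto
qed

section \<open>Polynomials as polynomials in one variable\<close>

definition to_poly :: "nat \<Rightarrow> 'k::field mpoly \<Rightarrow> 'k mpoly poly" where
  "to_poly v = mpoly_eval (\<lambda>c. [:Const c:]) (\<lambda>i. if i = v then [:0, 1:] else [:Var i:])"

lemma comm_ring_hom_CConst: "comm_ring_hom (\<lambda>c. [:Const c:])"
  by unfold_locales (simp_all add: Const_add Const_mult)

interpretation to_poly: comm_ring_hom "to_poly v" for v
  unfolding to_poly_def by (intro comm_ring_hom_mpoly_eval comm_ring_hom_CConst)

lemma to_poly_Const [simp]: "to_poly v (Const c) = [:Const c:]"
  and to_poly_Var: "to_poly v (Var i) = (if i = v then [:0, 1:] else [:Var i:])"
  unfolding to_poly_def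
  by (simp_all add: mpoly_eval_Const mpoly_eval_Var comm_ring_hom_CConst)

lemma to_poly_Var_same [simp]: "to_poly v (Var v) = [:0, 1:]"
  by (simp add: to_poly_Var)

lemma comm_ring_hom_poly: "comm_ring_hom (\<lambda>p. poly p x)"
  by unfold_locales simp_all

lemma comm_ring_hom_pCons_0: "comm_ring_hom (\<lambda>p::'a::comm_ring_1. [:p:])"
  by unfold_locales simp_all

lemma poly_to_poly [simp]: "poly (to_poly v p) (Var v) = p"
  by (rule hom_eqI[OF comm_ring_hom_comp[OF comm_ring_hom_poly to_poly.comm_ring_hom_axioms]
        comm_ring_hom_id, of _ UNIV]) (simp_all add: polys_def to_poly_Var)

lemma to_poly_eq_iff [simp]: "to_poly v p = to_poly v q \<longleftrightarrow> p = q"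
  by (metis poly_to_poly)

lemma to_poly_eq_0_iff [simp]: "to_poly v p = 0 \<longleftrightarrow> p = 0"
  using to_poly_eq_iff[of v p 0] by simp

lemma to_poly_const: "c \<in> polys V \<Longrightarrow> v \<notin> V \<Longrightarrow> to_poly v c = [:c:]"
  by (rule hom_eqI[OF to_poly.comm_ring_hom_axioms comm_ring_hom_pCons_0, of _ V])
    (auto simp: to_poly_Var)

lemma coeff_to_poly_in_polys:
  assumes "p \<in> polys V" shows "coeff (to_poly v p) e \<in> polys (V - {v})"
  using assms
proof (induction arbitrary: e rule: polys_induct)
  case (mult p q)
  then show ?case by (auto simp: to_poly.hom_mult coeff_mult)
qed (auto simp: to_poly.hom_add to_poly_Var coeff_pCons split: nat.splits)

text \<open>
  A polynomial in \<open>x\<^sub>v\<close> with coefficients free of \<open>x\<^sub>v\<close> is determined by its value, so this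
  identifies \<open>k[V \<union> {v}]\<close> with \<open>k[V][x\<^sub>v]\<close>.
\<close>

lemma to_poly_poly:
  assumes "\<And>e. coeff q e \<in> polys V" "v \<notin> V"
  shows "to_poly v (poly q (Var v)) = q"
  using assms(1)
proof (induction q)
  case (pCons a q)
  have "coeff q e \<in> polys V" for e
    using pCons.prems[of "Suc e"] by simp
  moreover have "to_poly v a = [:a:]"
    using pCons.prems[of 0] assms(2) by (simp add: to_poly_const)
  ultimately show ?case
    using pCons.IH by (simp add: to_poly.hom_add to_poly.hom_mult)
qed simp

lemma poly_in_polys:
  assumes "\<And>e. coeff q e \<in> polys V" "x \<in> polys V"
  shows "poly q x \<in> polys V"
  unfolding poly_altdef using assms by auto

lemma expand_in_var: "p = (\<Sum>e\<le>degree (to_poly v p). coeff (to_poly v p) e * Var v ^ e)"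
  using poly_to_poly[of v p] unfolding poly_altdef by simp

lemma to_poly_single: "to_poly v (sgl a c) = monom (sgl (a - sgl v (lkp a v)) c) (lkp a v)"
proof -
  have split: "a = sgl v (lkp a v) + (a - sgl v (lkp a v))"
    by (rule poly_mapping_eqI) (auto simp: lookup_add lookup_minus lookup_single when_def)
  have "sgl a c = Var v ^ lkp a v * sgl (a - sgl v (lkp a v)) c"
    using split by (simp add: Var_power mult_single)
  moreover have "sgl (a - sgl v (lkp a v)) c \<in> polys (UNIV - {v})"
    by (intro polys_single) (auto simp: in_keys_iff lookup_minus)
  then have "to_poly v (sgl (a - sgl v (lkp a v)) c) = [:sgl (a - sgl v (lkp a v)) c:]"
    by (rule to_poly_const) simp
  ultimately show ?thesis
    by (simp add: to_poly.hom_mult to_poly.hom_power monom_altdef mult.commute)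
qed

lemma lookup_coeff_to_poly:
  "lkp (coeff (to_poly v p) e) m = (if lkp m v = 0 then lkp p (m + sgl v e) else 0)"
proof -
  have "to_poly v p = (\<Sum>a\<in>keys p. monom (sgl (a - sgl v (lkp a v)) (lkp p a)) (lkp a v))"
    by (subst sum_of_terms) (simp add: to_poly.hom_sum to_poly_single)
  then have "lkp (coeff (to_poly v p) e) m =
      (\<Sum>a\<in>keys p. if lkp a v = e \<and> a - sgl v (lkp a v) = m then lkp p a else 0)"
    by (auto simp: coeff_sum lookup_sum lookup_single when_def intro!: sum.cong)
  also have "\<dots> = (\<Sum>a\<in>keys p. if a = m + sgl v e \<and> lkp m v = 0 then lkp p a else 0)"
  proof (intro sum.cong refl if_cong)
    fix a
    show "(lkp a v = e \<and> a - sgl v (lkp a v) = m) = (a = m + sgl v e \<and> lkp m v = 0)"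
      by (auto simp: poly_mapping_eq_iff fun_eq_iff lookup_add lookup_minus lookup_single when_def)
  qed
  also have "\<dots> = (if lkp m v = 0 then lkp p (m + sgl v e) else 0)"
    by (auto simp: in_keys_iff)
  finally show ?thesis .
qed

section \<open>Prime ideals, depth and height in general rings\<close>

lemma (in cring) ex_primeideal_avoiding:
  assumes J: "ideal J R"
    and D: "D \<subseteq> carrier R" "\<one> \<in> D" "\<And>a b. a \<in> D \<Longrightarrow> b \<in> D \<Longrightarrow> a \<otimes> b \<in> D"
    and disj: "J \<inter> D = {}"
  shows "\<exists>P. primeideal P R \<and> J \<subseteq> P \<and> P \<inter> D = {}"
proof -
  define A where "A = {I. ideal I R \<and> J \<subseteq> I \<and> I \<inter> D = {}}"
  have "\<exists>M\<in>A. \<forall>X\<in>A. M \<subseteq> X \<longrightarrow> X = M"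
  proof (rule subset_Zorn_nonempty)
    show "A \<noteq> {}" using J disj by (auto simp: A_def)
    fix C assume C: "C \<noteq> {}" "subset.chain A C"
    then have "subset.chain {I. ideal I R} C"
      by (auto simp: subset.chain_def A_def)
    from chain_Union_is_ideal[OF this] have "ideal (\<Union>C) R"
      using C(1) by simp
    then show "\<Union>C \<in> A"
      using C by (auto simp: A_def subset.chain_def)
  qed
  then obtain M where M: "ideal M R" "J \<subseteq> M" "M \<inter> D = {}"
    and max: "\<And>X. ideal X R \<Longrightarrow> J \<subseteq> X \<Longrightarrow> X \<inter> D = {} \<Longrightarrow> M \<subseteq> X \<Longrightarrow> X = M"
    by (auto simp: A_def)
  interpret M: ideal M R by (rule M)
  have meet: "\<exists>m\<in>M. \<exists>r\<in>carrier R. m \<oplus> r \<otimes> a \<in> D" if a: "a \<in> carrier R" "a \<notin> M" for a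
  proof -
    have S: "ideal (M <+> PIdl a) R"
      using M a by (intro add_ideals cgenideal_ideal)
    have sub: "M \<subseteq> M <+> PIdl a"
    proof
      fix m assume "m \<in> M"
      then have "m \<oplus> \<zero> \<in> M <+> PIdl a"
        using additive_subgroup.zero_closed[OF ideal.axioms(1)[OF cgenideal_ideal[OF a(1)]]]
        unfolding set_add_def' by blast
      then show "m \<in> M <+> PIdl a"
        using \<open>m \<in> M\<close> M.Icarr by simp
    qed
    have "\<zero> \<oplus> a \<in> M <+> PIdl a"
      using cgenideal_self[OF a(1)] M.zero_closed unfolding set_add_def' by blast
    then have "a \<in> M <+> PIdl a"
      using a by simp
    then have "M <+> PIdl a \<noteq> M" using a by blast
    then have "(M <+> PIdl a) \<inter> D \<noteq> {}"
      using max[OF S] sub M by blast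
    then show ?thesis
      by (auto simp: set_add_def' cgenideal_def)
  qed
  have "primeideal M R"
  proof (rule primeidealI)
    show "carrier R \<noteq> M" using D M by blast
  next
    fix a b assume ab: "a \<in> carrier R" "b \<in> carrier R" "a \<otimes> b \<in> M"
    show "a \<in> M \<or> b \<in> M"
    proof (rule ccontr)
      assume "\<not> (a \<in> M \<or> b \<in> M)"
      then obtain m r m' r' where mr: "m \<in> M" "r \<in> carrier R" "m \<oplus> r \<otimes> a \<in> D"
        "m' \<in> M" "r' \<in> carrier R" "m' \<oplus> r' \<otimes> b \<in> D"
        using meet ab by meson
      have carr: "m \<in> carrier R" "m' \<in> carrier R" using mr M.Icarr by auto
      have "(m \<oplus> r \<otimes> a) \<otimes> (m' \<oplus> r' \<otimes> b)
        = m \<otimes> (m' \<oplus> r' \<otimes> b) \<oplus> (m' \<otimes> (r \<otimes> a) \<oplus> (r \<otimes> r') \<otimes> (a \<otimes> b))"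
        using mr carr ab by algebra
      also have "\<dots> \<in> M"
      proof (intro M.a_closed)
        show "m \<otimes> (m' \<oplus> r' \<otimes> b) \<in> M" "m' \<otimes> (r \<otimes> a) \<in> M"
          using mr carr ab by (auto intro!: M.I_r_closed)
        show "(r \<otimes> r') \<otimes> (a \<otimes> b) \<in> M"
          using mr ab by (auto intro!: M.I_l_closed)
      qed
      finally show False
        using D(3)[OF mr(3) mr(6)] M by blast
    qed
  qed (use M is_cring in auto)
  then show ?thesis using M by blast
qed

text \<open>
  A nonzerodivisor \<open>a\<close> modulo \<open>J\<close> that lies in \<open>Q\<close> can be avoided by a smaller prime: the set of
  the products \<open>s a\<^sup>k\<close> with \<open>s \<notin> Q\<close> is multiplicatively closed, and it does not meet \<open>J \<subseteq> Q\<close>, as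
  the powers of \<open>a\<close> can be cancelled modulo \<open>J\<close>.
\<close>

lemma (in cring) ex_smaller_prime:
  assumes Q: "primeideal Q R" and J: "ideal J R" "J \<subseteq> Q"
    and a: "a \<in> Q" and nzd: "\<And>b. b \<in> carrier R \<Longrightarrow> a \<otimes> b \<in> J \<Longrightarrow> b \<in> J"
  shows "\<exists>P. primeideal P R \<and> J \<subseteq> P \<and> P \<subset> Q"
proof -
  interpret Q: primeideal Q R by (rule Q)
  have ac: "a \<in> carrier R" using a Q.Icarr by blast
  define D where "D = {s \<otimes> a [^] (k::nat) |s k. s \<in> carrier R - Q}"
  have one: "\<one> \<in> carrier R - Q"
    using Q.I_notcarr Q.one_imp_carrier by auto
  have nzd_pow: "b \<in> J" if "b \<in> carrier R" "b \<otimes> a [^] (k::nat) \<in> J" for b k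
    using that
  proof (induction k)
    case (Suc k)
    have "b \<otimes> a [^] Suc k = a \<otimes> (b \<otimes> a [^] k)"
      using Suc.prems ac by (simp add: m_ac)
    then show ?case
      using Suc nzd[of "b \<otimes> a [^] k"] ac by auto
  qed simp
  have "\<exists>P. primeideal P R \<and> J \<subseteq> P \<and> P \<inter> D = {}"
  proof (rule ex_primeideal_avoiding[OF J(1)])
    show "D \<subseteq> carrier R" using ac by (auto simp: D_def)
    show "\<one> \<in> D" using one by (auto simp: D_def intro!: exI[of _ \<one>] exI[of _ "0::nat"])
    show "x \<otimes> y \<in> D" if xy: "x \<in> D" "y \<in> D" for x y
    proof -
      obtain s k where sk: "s \<in> carrier R - Q" "x = s \<otimes> a [^] (k::nat)"
        using xy(1) unfolding D_def by blast
      obtain t l where tl: "t \<in> carrier R - Q" "y = t \<otimes> a [^] (l::nat)"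
        using xy(2) unfolding D_def by blast
      note st = sk(1) tl(1) sk(2) tl(2)
      have ac_pow: "a [^] k \<in> carrier R" "a [^] l \<in> carrier R"
        using ac by auto
      have "x \<otimes> y = (s \<otimes> t) \<otimes> (a [^] k \<otimes> a [^] l)"
        unfolding st(3,4) using st(1,2) ac_pow by (simp add: m_ac)
      also have "a [^] k \<otimes> a [^] l = a [^] (k + l)"
        using ac by (rule nat_pow_mult)
      finally have "x \<otimes> y = (s \<otimes> t) \<otimes> a [^] (k + l)" .
      moreover have "s \<otimes> t \<in> carrier R - Q"
        using st(1,2) Q.I_prime by auto
      ultimately show ?thesis
        unfolding D_def mem_Collect_eq by (intro exI[of _ "s \<otimes> t"] exI[of _ "k + l"] conjI)
    qed
    show "J \<inter> D = {}"
    proof (rule ccontr)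
      assume "J \<inter> D \<noteq> {}"
      then obtain s k where "s \<in> carrier R" "s \<notin> Q" "s \<otimes> a [^] (k::nat) \<in> J"
        unfolding D_def by auto
      then show False using nzd_pow J(2) by blast
    qed
  qed
  then obtain P where P: "primeideal P R" "J \<subseteq> P" "P \<inter> D = {}" by blast
  interpret P: primeideal P R by (rule P)
  have "P \<subseteq> Q"
  proof
    fix x assume x: "x \<in> P"
    show "x \<in> Q"
    proof (rule ccontr)
      assume "x \<notin> Q"
      moreover have "x \<in> carrier R" using x P.Icarr by blast
      ultimately have "x \<in> D" by (auto simp: D_def intro!: exI[of _ x] exI[of _ "0::nat"])
      then show False using x P by blast
    qed
  qed
  moreover have "a \<in> D"
    using one ac by (auto simp: D_def intro!: exI[of _ \<one>] exI[of _ "1::nat"])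
  then have "a \<notin> P" using P by blast
  ultimately show ?thesis using P a by blast
qed

text \<open>
  From the end of a regular sequence to its beginning, each element allows a step down to a smaller
  prime, which still contains the ideal of the elements before it.
\<close>

lemma (in cring) depth_le_prime_height:
  assumes M: "primeideal M R"
  shows "depth R M \<le> prime_height R M"
  unfolding depth_def
proof (rule Sup_least, clarify)
  fix as assume reg: "regular_sequence R as" and asM: "set as \<subseteq> M"
  interpret M: primeideal M R by (rule M)
  let ?r = "length as"
  have asC: "set as \<subseteq> carrier R" using asM M.Icarr by blast
  have "\<exists>Q. (\<forall>i\<le>k. primeideal (Q i) R) \<and> (\<forall>i<k. Q i \<subset> Q (Suc i)) \<and> Q k = M
    \<and> Idl (set (take (?r - k) as)) \<subseteq> Q 0" if "k \<le> ?r" for k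
    using that
  proof (induction k)
    case 0
    have "Idl (set as) \<subseteq> M"
      by (rule genideal_minimal[OF M.is_ideal asM])
    then show ?case
      using M by (intro exI[of _ "\<lambda>_. M"]) auto
  next
    case (Suc k)
    then obtain Q where Q: "\<And>i. i \<le> k \<Longrightarrow> primeideal (Q i) R" "\<And>i. i < k \<Longrightarrow> Q i \<subset> Q (Suc i)" "Q k = M"
      and sub: "Idl (set (take (?r - k) as)) \<subseteq> Q 0"
      by auto
    define j where "j = ?r - Suc k"
    have j: "j < ?r" "?r - k = Suc j" using Suc.prems by (auto simp: j_def)
    have tk: "set (take i as) \<subseteq> carrier R" for i
      by (rule order_trans[OF set_take_subset asC])
    have aj: "as ! j \<in> Q 0"
      using sub genideal_self[OF tk, of "Suc j"] j by (auto simp: take_Suc_conv_app_nth)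
    have "set (take j as) \<subseteq> Idl (set (take (Suc j) as))"
      using genideal_self[OF tk, of "Suc j"] set_take_subset_set_take[of j "Suc j" as] by simp
    then have "Idl (set (take j as)) \<subseteq> Idl (set (take (Suc j) as))"
      by (rule genideal_minimal[OF genideal_ideal[OF tk]])
    then have J: "Idl (set (take j as)) \<subseteq> Q 0" using sub j by auto
    obtain P where P: "primeideal P R" "Idl (set (take j as)) \<subseteq> P" "P \<subset> Q 0"
      using ex_smaller_prime[OF Q(1) genideal_ideal[OF tk] J aj] reg j
      unfolding regular_sequence_def by auto
    show ?case
    proof (intro exI[of _ "\<lambda>i. case i of 0 \<Rightarrow> P | Suc i \<Rightarrow> Q i"] conjI allI impI)
      fix i assume "i \<le> Suc k"
      then show "primeideal (case i of 0 \<Rightarrow> P | Suc i \<Rightarrow> Q i) R"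
        using P Q by (cases i) auto
    next
      fix i assume "i < Suc k"
      then show "(case i of 0 \<Rightarrow> P | Suc i \<Rightarrow> Q i) \<subset> (case Suc i of 0 \<Rightarrow> P | Suc i \<Rightarrow> Q i)"
        using P Q by (cases i) auto
    qed (use P Q in \<open>auto simp: j_def\<close>)
  qed
  from this[of ?r] show "enat ?r \<le> prime_height R M"
    unfolding prime_height_def by (intro Sup_upper) auto
qed

lemma prime_height_ge:
  "(\<And>i. i \<le> r \<Longrightarrow> primeideal (Q i) R) \<Longrightarrow> (\<And>i. i < r \<Longrightarrow> Q i \<subset> Q (Suc i)) \<Longrightarrow> Q r = P \<Longrightarrow>
    enat r \<le> prime_height R P"
  unfolding prime_height_def by (intro Sup_upper) auto

lemma prime_height_le:
  assumes "\<And>Q r. (\<And>i. i \<le> r \<Longrightarrow> primeideal (Q i) R) \<Longrightarrow> (\<And>i. i < r \<Longrightarrow> Q i \<subset> Q (Suc i)) \<Longrightarrow> Q r = P \<Longrightarrow> r \<le> d"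
  shows "prime_height R P \<le> enat d"
  unfolding prime_height_def
proof (rule Sup_least, clarify)
  fix r Q assume "\<forall>i\<le>r. primeideal (Q i) R" "\<forall>i<r. Q i \<subset> Q (Suc i)" "P = Q r"
  then show "enat r \<le> enat d"
    using assms[of r Q] by simp
qed

lemma (in ring) noetherian_ring_Quot:
  assumes "noetherian_ring R" and I: "ideal I R"
  shows "noetherian_ring (R Quot I)"
proof -
  interpret Q: ring "R Quot I" by (rule ideal.quotient_is_ring[OF I])
  interpret h: ring_hom_ring R "R Quot I" "(+>) I" by (rule ideal.rcos_ring_hom_ring[OF I])
  show ?thesis
  proof (rule Q.noetherian_ringI)
    fix J assume J: "ideal J (R Quot I)"
    have JC: "J \<subseteq> carrier (R Quot I)"
      using J by (meson additive_subgroup.a_subset ideal.axioms(1))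
    obtain A where A: "A \<subseteq> carrier R" "finite A" "\<Union>J = Idl A"
      using noetherian_ring.finetely_gen[OF assms(1) quot_ideal_imp_ring_ideal[OF I J]] by blast
    let ?B = "(+>) I ` A"
    have B: "?B \<subseteq> carrier (R Quot I)" using A(1) h.hom_closed by blast
    have "A \<subseteq> \<Union>J" using A genideal_self by blast
    then have "?B \<subseteq> J"
      using canonical_proj_vimage_mem_iff[OF I JC] A(1) by blast
    then have 1: "Idl\<^bsub>R Quot I\<^esub> ?B \<subseteq> J"
      by (rule Q.genideal_minimal[OF J])
    have "ideal {r \<in> carrier R. I +> r \<in> Idl\<^bsub>R Quot I\<^esub> ?B} R"
      by (rule h.ideal_vimage[OF Q.genideal_ideal[OF B]])
    moreover have "A \<subseteq> {r \<in> carrier R. I +> r \<in> Idl\<^bsub>R Quot I\<^esub> ?B}"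
      using A(1) Q.genideal_self[OF B] by blast
    ultimately have 2: "\<Union>J \<subseteq> {r \<in> carrier R. I +> r \<in> Idl\<^bsub>R Quot I\<^esub> ?B}"
      unfolding A(3) by (rule genideal_minimal)
    have "J \<subseteq> Idl\<^bsub>R Quot I\<^esub> ?B"
    proof
      fix x assume x: "x \<in> J"
      then obtain r where r: "r \<in> carrier R" "x = I +> r"
        using JC unfolding FactRing_def A_RCOSETS_def' by auto
      then have "r \<in> \<Union>J"
        using canonical_proj_vimage_mem_iff[OF I JC r(1)] x by simp
      then show "x \<in> Idl\<^bsub>R Quot I\<^esub> ?B" using 2 r by blast
    qed
    then show "\<exists>A\<subseteq>carrier (R Quot I). finite A \<and> J = Idl\<^bsub>R Quot I\<^esub> A"
      using 1 A(2) B by (intro exI[of _ ?B]) auto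
  qed
qed

section \<open>Ideals of polynomial rings\<close>

lemma poly_ring_simps [simp]:
  "carrier (poly_ring V) = polys V" "mult (poly_ring V) = (*)" "one (poly_ring V) = 1"
  "zero (poly_ring V) = 0" "add (poly_ring V) = (+)"
  by (simp_all add: poly_ring_def polys_def)

lemma a_inv_poly_ring:
  fixes p :: "'k::field mpoly"
  assumes p: "p \<in> polys V" shows "a_inv (poly_ring V) p = - p"
proof -
  interpret cring "poly_ring V :: 'k mpoly ring" by (rule cring_poly_ring)
  show ?thesis
    by (rule minus_equality) (use p in auto)
qed

lemma ideal_poly_ring_iff:
  "ideal I (poly_ring V) \<longleftrightarrow> I \<subseteq> polys V \<and> 0 \<in> I \<and> (\<forall>a\<in>I. \<forall>b\<in>I. a + b \<in> I) \<and>
    (\<forall>a\<in>polys V. \<forall>b\<in>I. a * b \<in> (I :: 'k::field mpoly set))" (is "?L \<longleftrightarrow> ?R")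
proof
  assume ?L
  interpret ideal I "poly_ring V" by fact
  show ?R
    using a_subset additive_subgroup.zero_closed[OF is_additive_subgroup]
      additive_subgroup.a_closed[OF is_additive_subgroup] I_l_closed by auto
next
  assume R: ?R
  interpret cring "poly_ring V :: 'k mpoly ring" by (rule cring_poly_ring)
  show ?L
  proof (rule idealI)
    show "ring (poly_ring V :: 'k mpoly ring)" by unfold_locales
    show "subgroup I (add_monoid (poly_ring V))"
    proof (rule add.subgroupI)
      fix a assume a: "a \<in> I"
      then have "(- 1) * a \<in> I" using R polys_uminus[OF polys_1] by blast
      then show "a_inv (poly_ring V) a \<in> I"
        using a R a_inv_poly_ring[of a V] by auto
    qed (use R in auto)
  next
    fix a x :: "'k mpoly" assume "a \<in> I" "x \<in> carrier (poly_ring V)"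
    then have "x * a \<in> I" using R by simp
    then show "x \<otimes>\<^bsub>poly_ring V\<^esub> a \<in> I" "a \<otimes>\<^bsub>poly_ring V\<^esub> x \<in> I"
      by (simp_all add: mult.commute)
  qed
qed

lemma primeideal_poly_ring_iff:
  "primeideal I (poly_ring V) \<longleftrightarrow> ideal I (poly_ring V) \<and> 1 \<notin> I \<and>
    (\<forall>a\<in>polys V. \<forall>b\<in>polys V. a * b \<in> I \<longrightarrow> a \<in> I \<or> b \<in> (I :: 'k::field mpoly set))" (is "?L \<longleftrightarrow> ?R")
proof
  assume ?L
  interpret primeideal I "poly_ring V" by fact
  show ?R
    using is_ideal I_notcarr one_imp_carrier I_prime by auto
next
  assume ?R
  then show ?L
    by (intro primeidealI cring_poly_ring) auto
qed

text \<open>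
  The concrete form of the ideal generated by a list, as the set of linear combinations;
  \<open>ideal_gen_eq_Idl\<close> relates it to the abstract one.
\<close>

definition ideal_gen :: "nat set \<Rightarrow> 'k::field mpoly list \<Rightarrow> 'k mpoly set" where
  "ideal_gen V as = {(\<Sum>i<length as. b i * as ! i) |b. \<forall>i<length as. b i \<in> polys V}"

lemma ideal_ideal_gen:
  fixes as :: "'k::field mpoly list"
  assumes "set as \<subseteq> polys V" shows "ideal (ideal_gen V as) (poly_ring V)"
proof -
  have as: "as ! i \<in> polys V" if "i < length as" for i
    using assms that by (auto simp: set_conv_nth)
  show ?thesis
    unfolding ideal_poly_ring_iff
  proof (intro conjI ballI)
    show "ideal_gen V as \<subseteq> polys V"
      using as by (auto simp: ideal_gen_def)
    show "0 \<in> ideal_gen V as"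
      by (auto simp: ideal_gen_def intro!: exI[of _ "\<lambda>_. 0"])
  next
    fix a b :: "'k mpoly" assume "a \<in> ideal_gen V as" "b \<in> ideal_gen V as"
    then obtain f g where "a = (\<Sum>i<length as. f i * as ! i)" "b = (\<Sum>i<length as. g i * as ! i)"
      "\<forall>i<length as. f i \<in> polys V" "\<forall>i<length as. g i \<in> polys V"
      by (auto simp: ideal_gen_def)
    then show "a + b \<in> ideal_gen V as"
      by (auto simp: ideal_gen_def distrib_right sum.distrib intro!: exI[of _ "\<lambda>i. f i + g i"])
  next
    fix a b :: "'k mpoly" assume a: "a \<in> polys V" and "b \<in> ideal_gen V as"
    then obtain g where "b = (\<Sum>i<length as. g i * as ! i)" "\<forall>i<length as. g i \<in> polys V"
      by (auto simp: ideal_gen_def)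
    then show "a * b \<in> ideal_gen V as"
      using a by (auto simp: ideal_gen_def sum_distrib_left mult.assoc intro!: exI[of _ "\<lambda>i. a * g i"])
  qed
qed

lemma ideal_sum_closed:
  assumes "ideal I (poly_ring V)" "\<And>x. x \<in> X \<Longrightarrow> f x \<in> I"
  shows "sum f X \<in> I"
  using assms(2)
  by (induction X rule: infinite_finite_induct) (use assms(1) in \<open>auto simp: ideal_poly_ring_iff\<close>)

lemma ideal_diff_closed:
  assumes I: "ideal I (poly_ring V)" and ab: "a \<in> I" "b \<in> I"
  shows "a - b \<in> I"
proof -
  have "(- 1) * b \<in> I"
    using I ab polys_uminus[OF polys_1] unfolding ideal_poly_ring_iff by blast
  then have "a + (- 1) * b \<in> I"
    using I ab unfolding ideal_poly_ring_iff by blast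
  then show ?thesis by simp
qed

lemma ideal_gen_eq_Idl:
  assumes as: "set as \<subseteq> polys V" shows "Idl\<^bsub>poly_ring V\<^esub> (set as) = ideal_gen V as"
proof -
  interpret cring "poly_ring V :: 'a mpoly ring" by (rule cring_poly_ring)
  show ?thesis
  proof
    have "as ! i \<in> ideal_gen V as" if "i < length as" for i
    proof -
      have "(\<Sum>j<length as. (if j = i then 1 else 0) * as ! j) = as ! i"
        using that by (simp add: if_distrib[of "\<lambda>x. x * _"] cong: if_cong)
      then show ?thesis
        unfolding ideal_gen_def by (auto intro!: exI[of _ "\<lambda>j. if j = i then 1 else 0"])
    qed
    then have "set as \<subseteq> ideal_gen V as" by (auto simp: set_conv_nth)
    then show "Idl\<^bsub>poly_ring V\<^esub> (set as) \<subseteq> ideal_gen V as"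
      using as by (intro genideal_minimal ideal_ideal_gen)
    have I: "ideal (Idl\<^bsub>poly_ring V\<^esub> (set as)) (poly_ring V)"
      using as by (intro genideal_ideal) simp
    have "as ! i \<in> Idl\<^bsub>poly_ring V\<^esub> (set as)" if "i < length as" for i
      using genideal_self[of "set as"] as that by auto
    then show "ideal_gen V as \<subseteq> Idl\<^bsub>poly_ring V\<^esub> (set as)"
      using I by (auto simp: ideal_gen_def ideal_poly_ring_iff intro!: ideal_sum_closed[OF I])
  qed
qed

lemma ideal_gen_self: "a \<in> set as \<Longrightarrow> set as \<subseteq> polys V \<Longrightarrow> a \<in> ideal_gen V as"
proof -
  assume a: "a \<in> set as" and as: "set as \<subseteq> polys V"
  interpret cring "poly_ring V :: 'a mpoly ring" by (rule cring_poly_ring)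
  show ?thesis
    using genideal_self[of "set as"] as a by (auto simp: ideal_gen_eq_Idl)
qed

lemma primeideal_kernel:
  fixes h :: "'k::field mpoly \<Rightarrow> 'b::idom"
  assumes "comm_ring_hom h"
  shows "primeideal {p \<in> polys V. h p = 0} (poly_ring V)"
proof -
  interpret h: comm_ring_hom h by fact
  show ?thesis
    unfolding primeideal_poly_ring_iff ideal_poly_ring_iff
    by (auto simp: h.hom_add h.hom_mult)
qed

section \<open>Chains of prime ideals in a polynomial ring\<close>

lemma linear_dependence:
  fixes v :: "'x \<Rightarrow> 'y \<Rightarrow> 'a::field"
  assumes "finite Y" "finite X" "card Y < card X"
  shows "\<exists>c. (\<exists>x\<in>X. c x \<noteq> 0) \<and> (\<forall>y\<in>Y. (\<Sum>x\<in>X. c x * v x y) = 0)"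
  using assms
proof (induction Y arbitrary: X v rule: finite_induct)
  case empty
  then have "X \<noteq> {}" by auto
  then show ?case by (auto intro!: exI[of _ "\<lambda>_. 1"])
next
  case (insert y Y)
  show ?case
  proof (cases "\<forall>x\<in>X. v x y = 0")
    case True
    have "card Y < card X" using insert by simp
    from insert.IH[OF insert.prems(1) this, of v] show ?thesis
      using True by (auto intro!: sum.neutral)
  next
    case False
    then obtain x0 where x0: "x0 \<in> X" "v x0 y \<noteq> 0" by blast
    define w where "w x z = v x z - v x y / v x0 y * v x0 z" for x z
    have "card Y < card (X - {x0})" using insert x0 by simp
    from insert.IH[OF _ this, of w] obtain c where c: "\<exists>x\<in>X - {x0}. c x \<noteq> 0"
      "\<And>z. z \<in> Y \<Longrightarrow> (\<Sum>x\<in>X - {x0}. c x * w x z) = 0"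
      using insert.prems by auto
    define c' where "c' x = (if x = x0 then - (\<Sum>x\<in>X - {x0}. c x * v x y) / v x0 y else c x)" for x
    have "(\<Sum>x\<in>X. c' x * v x z) = (\<Sum>x\<in>X - {x0}. c x * w x z)" for z
    proof -
      have "(\<Sum>x\<in>X. c' x * v x z) = c' x0 * v x0 z + (\<Sum>x\<in>X - {x0}. c x * v x z)"
        using x0 insert.prems by (subst sum.remove[of X x0]) (auto simp: c'_def)
      also have "c' x0 * v x0 z = (\<Sum>x\<in>X - {x0}. - (c x * v x y / v x0 y * v x0 z))"
        by (simp add: c'_def sum_divide_distrib sum_distrib_right sum_negf)
      also have "\<dots> + (\<Sum>x\<in>X - {x0}. c x * v x z) = (\<Sum>x\<in>X - {x0}. c x * w x z)"
        by (simp add: w_def algebra_simps flip: sum.distrib)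
      finally show ?thesis .
    qed
    moreover have "w x y = 0" for x using x0 by (simp add: w_def)
    ultimately have "\<forall>z\<in>insert y Y. (\<Sum>x\<in>X. c' x * v x z) = 0"
      using c by auto
    moreover have "\<exists>x\<in>X. c' x \<noteq> 0" using c by (auto simp: c'_def)
    ultimately show ?thesis by blast
  qed
qed

definition box :: "nat set \<Rightarrow> nat \<Rightarrow> (nat \<Rightarrow>\<^sub>0 nat) set" where
  "box A N = {m. keys m \<subseteq> A \<and> (\<forall>i. lkp m i < N)}"

lemma bij_betw_box:
  assumes A: "finite A" and N: "N > 0"
  shows "bij_betw (\<lambda>m. restrict (lkp m) A) (box A N) (A \<rightarrow>\<^sub>E {..<N})"
proof (rule bij_betw_byWitness[where f' = "\<lambda>f. \<Sum>i\<in>A. sgl i (f i)"])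
  have lk: "lkp (\<Sum>i\<in>A. sgl i (f i)) j = (if j \<in> A then f j else 0)" for f :: "nat \<Rightarrow> nat" and j
    using A by (simp add: lookup_sum lookup_single when_def)
  show "\<forall>m\<in>box A N. (\<Sum>i\<in>A. sgl i (restrict (lkp m) A i)) = m"
    by (auto simp: box_def lk in_keys_iff intro!: poly_mapping_eqI)
  show "\<forall>f\<in>A \<rightarrow>\<^sub>E {..<N}. restrict (lkp (\<Sum>i\<in>A. sgl i (f i))) A = f"
    by (auto simp: lk restrict_def PiE_def extensional_def fun_eq_iff)
  show "(\<lambda>m. restrict (lkp m) A) ` box A N \<subseteq> A \<rightarrow>\<^sub>E {..<N}"
    by (auto simp: box_def)
  show "(\<lambda>f. \<Sum>i\<in>A. sgl i (f i)) ` (A \<rightarrow>\<^sub>E {..<N}) \<subseteq> box A N"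
    using N by (auto simp: box_def in_keys_iff lk PiE_iff split: if_splits)
qed

lemma finite_box: "finite A \<Longrightarrow> N > 0 \<Longrightarrow> finite (box A N)"
  and card_box: "finite A \<Longrightarrow> N > 0 \<Longrightarrow> card (box A N) = N ^ card A"
  using bij_betw_finite[OF bij_betw_box[of A N]] bij_betw_same_card[OF bij_betw_box[of A N]]
  by (auto simp: card_PiE intro!: finite_PiE)

definition exps_le :: "nat \<Rightarrow> 'k::field mpoly \<Rightarrow> bool" where
  "exps_le e p \<longleftrightarrow> (\<forall>m\<in>keys p. \<forall>j. lkp m j \<le> e)"

lemma exps_le_mult: "exps_le d p \<Longrightarrow> exps_le e q \<Longrightarrow> exps_le (d + e) (p * q)"
  unfolding exps_le_def
proof (intro ballI allI)
  fix m j assume a: "\<forall>m\<in>keys p. \<forall>j. lkp m j \<le> d" "\<forall>m\<in>keys q. \<forall>j. lkp m j \<le> e" "m \<in> keys (p * q)"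
  then obtain a b where "a \<in> keys p" "b \<in> keys q" "m = a + b" using keys_mult[of p q] by blast
  then show "lkp m j \<le> d + e" using a by (auto simp: lookup_add intro!: add_mono)
qed

lemma exps_le_mono: "exps_le d p \<Longrightarrow> d \<le> e \<Longrightarrow> exps_le e p"
  unfolding exps_le_def using order_trans by blast

lemma exps_le_1: "exps_le d 1"
  by (simp add: exps_le_def)

lemma exps_le_power: "exps_le d p \<Longrightarrow> exps_le (k * d) (p ^ k)"
  by (induction k) (auto simp: exps_le_1 exps_le_mult)

lemma exps_le_prod: "(\<And>i. i \<in> I \<Longrightarrow> exps_le (e i) (f i)) \<Longrightarrow> exps_le (sum e I) (prod f I)"
  by (induction I rule: infinite_finite_induct) (auto simp: exps_le_1 exps_le_mult)

lemma ex_exps_le: "\<exists>e. exps_le e p"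
proof -
  let ?S = "(\<lambda>(m, j). lkp m j) ` (SIGMA m:keys p. keys m)"
  have fin: "finite ?S" by (intro finite_imageI finite_SigmaI) auto
  have "lkp m j \<le> Max (insert 0 ?S)" if "m \<in> keys p" for m j
  proof (cases "j \<in> keys m")
    case True
    then have "lkp m j \<in> ?S" using that by (force simp: image_iff)
    then show ?thesis using fin by (intro Max_ge) auto
  qed (auto simp: in_keys_iff)
  then show ?thesis unfolding exps_le_def by blast
qed

lemma subst_single: "subst s (sgl m c) = Const c * (\<Prod>i\<in>keys m. s i ^ lkp m i)"
  by (subst single_eq_prod) (simp add: subst.hom_mult subst.hom_prod subst.hom_power)

text \<open>
  Any \<open>d + 1\<close> polynomials \<open>t\<^sub>0, \<dots>, t\<^sub>d\<close> in \<open>d\<close> variables are algebraically dependent, by counting.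
  There are \<open>N\<^bsup>d+1\<^esup>\<close> monomials in the \<open>t\<^sub>i\<close> with exponents below \<open>N\<close>.  They lie in a space of
  dimension at most \<open>(K N)\<^sup>d\<close>, where \<open>K\<close> depends only on the \<open>t\<^sub>i\<close>, and \<open>K\<^sup>d N\<^sup>d < N\<^bsup>d+1\<^esup>\<close> for
  large \<open>N\<close>.
\<close>

lemma ex_algebraic_relation:
  fixes t :: "nat \<Rightarrow> 'k::field mpoly"
  assumes V: "finite V" and t: "\<And>i. i \<le> card V \<Longrightarrow> t i \<in> polys V"
  shows "\<exists>p. p \<noteq> 0 \<and> p \<in> polys {..card V} \<and> subst t p = 0"
proof -
  define d where "d = card V"
  have "\<forall>i. \<exists>e. exps_le e (t i)" using ex_exps_le by blast
  then obtain e where e: "\<And>i. exps_le (e i) (t i)" by metis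
  \<comment> \<open>a common bound for the exponents in all the \<open>t\<^sub>i\<close>\<close>
  define D where "D = (\<Sum>i\<le>d. e i)"
  have D: "exps_le D (t i)" if "i \<le> d" for i
    using that by (intro exps_le_mono[OF e]) (auto simp: D_def intro: member_le_sum)
  define K where "K = (d + 1) * D + 1"
  define N where "N = K ^ d + 1"
  define X where "X = box {..d} N"
  define Y where "Y = box V (K * N)"
  define T where "T m = (\<Prod>i\<in>keys m. t i ^ lkp m i)" for m :: "nat \<Rightarrow>\<^sub>0 nat"
  have N: "N > 0" "K * N > 0" by (auto simp: N_def K_def)
  have "card Y = K ^ d * N ^ d"
    using card_box[OF V N(2)] by (simp add: Y_def d_def power_mult_distrib)
  also have "\<dots> < N * N ^ d" using N by (simp add: N_def)
  also have "\<dots> = card X" using card_box[of "{..d}" N] N by (simp add: X_def)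
  finally have card: "card Y < card X" .
  have fin: "finite X" "finite Y" using finite_box V N by (auto simp: X_def Y_def)
  obtain c where c: "\<exists>m\<in>X. c m \<noteq> 0" "\<And>k. k \<in> Y \<Longrightarrow> (\<Sum>m\<in>X. c m * lkp (T m) k) = 0"
    using linear_dependence[OF fin(2,1) card, of "\<lambda>m. lkp (T m)"] by blast
  have keysT: "keys (T m) \<subseteq> Y" if m: "m \<in> X" for m
  proof
    fix k assume k: "k \<in> keys (T m)"
    have mk: "keys m \<subseteq> {..d}" "\<And>i. lkp m i < N" using m by (auto simp: X_def box_def)
    have "T m \<in> polys V" using t mk unfolding T_def d_def by auto
    then have "keys k \<subseteq> V" using k by (auto simp: polys_iff)
    have "exps_le (\<Sum>i\<in>keys m. lkp m i * D) (T m)"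
      unfolding T_def using mk by (intro exps_le_prod exps_le_power D) auto
    moreover have "(\<Sum>i\<in>keys m. lkp m i * D) \<le> (\<Sum>i\<in>keys m. N * D)"
      using mk by (intro sum_mono mult_right_mono) (auto intro: less_imp_le)
    moreover have "\<dots> \<le> (d + 1) * (N * D)"
      using card_mono[OF _ mk(1)] mult_right_mono[of "card (keys m)" "d + 1" "N * D"] by simp
    ultimately have "exps_le ((d + 1) * (N * D)) (T m)"
      using exps_le_mono order_trans by blast
    then have "lkp k j \<le> (d + 1) * (N * D)" for j using k by (auto simp: exps_le_def)
    moreover have "(d + 1) * (N * D) < K * N"
      using N by (simp add: K_def algebra_simps)
    ultimately show "k \<in> Y" using \<open>keys k \<subseteq> V\<close> by (auto simp: Y_def box_def intro: le_less_trans)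
  qed
  define p where "p = (\<Sum>m\<in>X. sgl m (c m))"
  have lkp_p: "lkp p m = (if m \<in> X then c m else 0)" for m
    using fin by (simp add: p_def lookup_sum lookup_single when_def)
  have "p \<noteq> 0" using c(1) lkp_p by (metis lookup_zero)
  moreover have "p \<in> polys {..d}" unfolding p_def by (intro polys_sum polys_single) (auto simp: X_def box_def)
  moreover have "subst t p = 0"
  proof (rule poly_mapping_eqI)
    fix k
    have "lkp (subst t p) k = (\<Sum>m\<in>X. c m * lkp (T m) k)"
      by (simp add: p_def subst.hom_sum subst_single lookup_sum lookup_Const_mult T_def)
    also have "\<dots> = 0"
    proof (cases "k \<in> Y")
      case False
      then have "lkp (T m) k = 0" if "m \<in> X" for m using keysT[OF that] by (auto simp: in_keys_iff)
      then show ?thesis by simp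
    qed (rule c(2))
    finally show "lkp (subst t p) k = lkp 0 k" by simp
  qed
  ultimately show ?thesis unfolding d_def by blast
qed

text \<open>
  The power of \<open>x\<^sub>v\<close> that divides \<open>p\<close> is split off, so that the part of the cofactor without \<open>x\<^sub>v\<close> is
  nonzero.
\<close>

lemma drop_lowest_power:
  assumes "p \<noteq> 0" "p \<in> polys V"
  shows "\<exists>e g h. p = Var v ^ e * (g + Var v * h) \<and> g \<noteq> 0 \<and> g \<in> polys (V - {v}) \<and> h \<in> polys (insert v V)"
  using assms
proof (induction "degree (to_poly v p)" arbitrary: p rule: less_induct)
  case less
  obtain a r where r: "to_poly v p = pCons a r" by (cases "to_poly v p")
  define h where "h = poly r (Var v)"
  have p: "p = a + Var v * h"
    using poly_to_poly[of v p] r by (simp add: h_def)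
  have a: "a \<in> polys (V - {v})"
    using coeff_to_poly_in_polys[OF less.prems(2), of v 0] r by simp
  have co: "coeff r e \<in> polys (V - {v})" for e
    using coeff_to_poly_in_polys[OF less.prems(2), of v "Suc e"] r by simp
  then have h: "h \<in> polys (insert v V)"
    unfolding h_def by (intro poly_in_polys polys_monoD[OF co]) auto
  show ?case
  proof (cases "a = 0")
    case False
    then show ?thesis
      using p a h by (intro exI[of _ 0] exI[of _ a] exI[of _ h]) auto
  next
    case True
    have hr: "to_poly v h = r" unfolding h_def by (rule to_poly_poly[OF co]) simp
    have "h \<noteq> 0" using p True less.prems by auto
    then have "r \<noteq> 0" using hr by auto
    then have deg: "degree (to_poly v h) < degree (to_poly v p)" using r hr by simp
    show ?thesis
    proof (cases "v \<in> V")
      case True': True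
      then have "h \<in> polys V" using h by (simp add: insert_absorb)
      from less.hyps[OF deg \<open>h \<noteq> 0\<close> this] obtain e g h' where
        "h = Var v ^ e * (g + Var v * h')" "g \<noteq> 0" "g \<in> polys (V - {v})" "h' \<in> polys (insert v V)"
        by blast
      then show ?thesis
        using p True by (intro exI[of _ "Suc e"] exI[of _ g] exI[of _ h']) (auto simp: mult.assoc)
    next
      case False
      then have "to_poly v p = [:p:]" using less.prems to_poly_const by blast
      then have "r = 0" using r by simp
      then show ?thesis using \<open>r \<noteq> 0\<close> by simp
    qed
  qed
qed

lemma polys_empty: "p \<in> polys {} \<Longrightarrow> \<exists>c. p = Const c"
proof -
  assume p: "p \<in> polys {}"
  then have "keys p \<subseteq> {0}" by (auto simp: polys_iff)
  then have "p = Const (lkp p 0)"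
    by (intro poly_mapping_eqI) (auto simp: Const_def lookup_single when_def in_keys_iff)
  then show ?thesis ..
qed

text \<open>
  In a chain of \<open>d + 1\<close> proper inclusions choose \<open>t\<^sub>i \<in> Q\<^bsub>i+1\<^esub> - Q\<^sub>i\<close>.  An algebraic relation
  between \<open>t\<^sub>i, \<dots>, t\<^sub>d\<close> that holds modulo \<open>Q\<^sub>i\<close> can be divided by a power of \<open>t\<^sub>i\<close>, because
  \<open>t\<^sub>i \<notin> Q\<^sub>i\<close>, until its part without \<open>t\<^sub>i\<close> is nonzero.  As \<open>t\<^sub>i \<in> Q\<^bsub>i+1\<^esub>\<close>, that part is a
  relation between the later elements modulo \<open>Q\<^bsub>i+1\<^esub>\<close>.  In the end a nonzero constant lies in
  \<open>Q\<^bsub>d+1\<^esub>\<close>.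
\<close>

theorem prime_chain_length_le:
  fixes Q :: "nat \<Rightarrow> 'k::field mpoly set"
  assumes V: "finite V" and Q: "\<And>i. i \<le> r \<Longrightarrow> primeideal (Q i) (poly_ring V)"
    and strict: "\<And>i. i < r \<Longrightarrow> Q i \<subset> Q (Suc i)"
  shows "r \<le> card V"
proof (rule ccontr)
  define d where "d = card V"
  assume "\<not> r \<le> card V"
  then have r: "Suc d \<le> r" by (simp add: d_def)
  have "\<forall>i. \<exists>x. i \<le> d \<longrightarrow> x \<in> Q (Suc i) - Q i"
    using strict r by (meson DiffI Suc_le_lessD le_trans not_less_eq_eq psubsetE subsetI)
  then obtain t where t: "\<And>i. i \<le> d \<Longrightarrow> t i \<in> Q (Suc i) - Q i" by metis
  have Qs: "Q i \<subseteq> polys V" if "i \<le> r" for i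
    using Q[OF that] by (auto simp: primeideal_poly_ring_iff ideal_poly_ring_iff)
  have tV: "t i \<in> polys V" if "i \<le> d" for i
    using t[OF that] Qs[of "Suc i"] that r by auto
  obtain p where p: "p \<noteq> 0" "p \<in> polys {..d}" "subst t p = 0"
    using ex_algebraic_relation[OF V, of t] tV by (auto simp: d_def)
  \<comment> \<open>The induction runs down the chain, from the constants modulo \<open>Q\<^bsub>d+1\<^esub>\<close> to all of \<open>t\<^sub>0, \<dots>, t\<^sub>d\<close> modulo \<open>Q\<^sub>0\<close>.\<close>
  have claim: "subst t p \<notin> Q (Suc d - k)" if "k \<le> Suc d" "p \<noteq> 0" "p \<in> polys {Suc d - k..d}" for k p
    using that
  proof (induction k arbitrary: p)
    case 0
    then obtain a where a: "p = Const a" using polys_empty by force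
    with 0 have "a \<noteq> 0" by auto
    show ?case
    proof
      assume "subst t p \<in> Q (Suc d - 0)"
      then have "Const (inverse a) * Const a \<in> Q (Suc d)"
        using Q[OF r] a by (auto simp: primeideal_poly_ring_iff ideal_poly_ring_iff)
      then show False
        using Q[OF r] \<open>a \<noteq> 0\<close> by (simp add: primeideal_poly_ring_iff flip: Const_mult)
    qed
  next
    case (Suc k)
    define i where "i = d - k"
    have i: "Suc d - Suc k = i" "Suc d - k = Suc i" "i \<le> d" "i \<le> r" using Suc.prems r by (auto simp: i_def)
    obtain e g h where gh: "p = Var i ^ e * (g + Var i * h)" "g \<noteq> 0" "g \<in> polys ({i..d} - {i})"
      "h \<in> polys (insert i {i..d})"
      using drop_lowest_power[of p "{i..d}" i] Suc.prems i by auto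
    have g: "g \<in> polys {Suc i..d}" using gh(3) by (rule polys_monoD) auto
    have h: "h \<in> polys {i..d}" using gh(4) i by (simp add: insert_absorb)
    have sV: "subst t f \<in> polys V" if "f \<in> polys {..d}" for f
      using that by (rule subst_in_polys) (use tV in auto)
    have gV: "subst t g \<in> polys V" "subst t h \<in> polys V"
      using polys_monoD[OF g, of "{..d}"] polys_monoD[OF h, of "{..d}"] sV by auto
    have ti: "t i \<notin> Q i" "t i \<in> Q (Suc i)" "t i \<in> polys V" using t i tV by auto
    have Qi: "primeideal (Q i) (poly_ring V)" "primeideal (Q (Suc i)) (poly_ring V)" using Q i r by auto
    show ?case
    proof
      assume "subst t p \<in> Q (Suc d - Suc k)"
      then have "t i ^ e * (subst t g + t i * subst t h) \<in> Q i"
        unfolding gh(1) i by (simp add: subst.hom_mult subst.hom_add subst.hom_power)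
      moreover have "t i ^ e \<notin> Q i"
        using Qi(1) ti by (induction e) (auto simp: primeideal_poly_ring_iff)
      ultimately have "subst t g + t i * subst t h \<in> Q i"
        using Qi(1) gV ti by (auto simp: primeideal_poly_ring_iff)
      then have "subst t g + t i * subst t h \<in> Q (Suc i)"
        using strict[of i] i r by auto
      moreover have "t i * subst t h \<in> Q (Suc i)"
        using Qi(2) gV ti by (auto simp: primeideal_poly_ring_iff ideal_poly_ring_iff mult.commute)
      ultimately have "(subst t g + t i * subst t h) - t i * subst t h \<in> Q (Suc i)"
        using Qi(2) by (intro ideal_diff_closed) (auto simp: primeideal_poly_ring_iff)
      then show False
        using Suc.IH[of g] gh(2) g i Suc.prems by simp
    qed
  qed
  have "subst t p \<notin> Q (Suc d - Suc d)"
    using p(1,2) by (intro claim) (auto simp: atMost_atLeast0)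
  moreover have "0 \<in> Q 0" using Q[of 0] by (auto simp: primeideal_poly_ring_iff ideal_poly_ring_iff)
  ultimately show False using p(3) by simp
qed

section \<open>Polynomial rings are noetherian\<close>

lemma nat_seq_monotone_subseq:
  fixes f :: "nat \<Rightarrow> nat"
  shows "\<exists>s :: nat \<Rightarrow> nat. strict_mono s \<and> (\<forall>i j. i \<le> j \<longrightarrow> f (s i) \<le> f (s j))"
proof -
  obtain s where s: "strict_mono s" "monoseq (\<lambda>i. f (s i))"
    using seq_monosub[of f] by blast
  show ?thesis
  proof (cases "\<forall>i j. i \<le> j \<longrightarrow> f (s i) \<le> f (s j)")
    case True
    then show ?thesis using s(1) by blast
  next
    case False
    then have dec: "i \<le> j \<Longrightarrow> f (s j) \<le> f (s i)" for i j
      using s(2) by (auto simp: monoseq_def)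
    define k where "k = (ARG_MIN (\<lambda>i. f (s i)) i. True)"
    have k: "f (s k) \<le> f (s i)" for i
      unfolding k_def by (rule arg_min_nat_le) simp
    have eq: "f (s (k + i)) = f (s k)" for i
      using k[of "k + i"] dec[of k "k + i"] by simp
    have "strict_mono (\<lambda>i. s (k + i))"
      using s(1) by (simp add: strict_mono_def)
    then show ?thesis
      by (intro exI[of _ "\<lambda>i. s (k + i)"]) (simp add: eq)
  qed
qed

lemma dickson_subseq:
  fixes m :: "nat \<Rightarrow> (nat \<Rightarrow>\<^sub>0 nat)"
  assumes "finite V"
  shows "\<exists>s :: nat \<Rightarrow> nat. strict_mono s \<and> (\<forall>v\<in>V. \<forall>i j. i \<le> j \<longrightarrow> lkp (m (s i)) v \<le> lkp (m (s j)) v)"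
  using assms
proof (induction V rule: finite_induct)
  case empty
  show ?case by (auto intro!: exI[of _ id] simp: strict_mono_def)
next
  case (insert v V)
  then obtain s :: "nat \<Rightarrow> nat" where s: "strict_mono s" "\<forall>w\<in>V. \<forall>i j. i \<le> j \<longrightarrow> lkp (m (s i)) w \<le> lkp (m (s j)) w"
    by (elim exE conjE)
  obtain r :: "nat \<Rightarrow> nat" where r: "strict_mono r" "\<forall>i j. i \<le> j \<longrightarrow> lkp (m (s (r i))) v \<le> lkp (m (s (r j))) v"
    using nat_seq_monotone_subseq[of "\<lambda>i. lkp (m (s i)) v"] by (elim exE conjE)
  have "strict_mono (\<lambda>i. s (r i))"
    using s(1) r(1) by (simp add: strict_mono_def)
  moreover have "lkp (m (s (r i))) w \<le> lkp (m (s (r j))) w" if "w \<in> insert v V" "i \<le> j" for w and i j :: nat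
  proof (cases "w = v")
    case True
    then show ?thesis using r(2) that by simp
  next
    case False
    moreover have "r i \<le> r j"
      using r(1) that by (simp add: strict_mono_less_eq)
    ultimately show ?thesis using s(2) that by blast
  qed
  ultimately show ?case
    by (intro exI[of _ "\<lambda>i. s (r i)"] conjI ballI allI impI)
qed

text \<open>
  Dickson's lemma: in a sequence of monomials some monomial divides a later one.
\<close>

lemma dickson:
  fixes m :: "nat \<Rightarrow> (nat \<Rightarrow>\<^sub>0 nat)"
  assumes "finite V" "\<And>i. keys (m i) \<subseteq> V"
  shows "\<exists>i j. i < j \<and> (\<exists>a. keys a \<subseteq> V \<and> m j = a + m i)"
proof -
  obtain s :: "nat \<Rightarrow> nat" where s: "strict_mono s" "\<forall>v\<in>V. \<forall>i j. i \<le> j \<longrightarrow> lkp (m (s i)) v \<le> lkp (m (s j)) v"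
    using dickson_subseq[OF assms(1), of m] by (elim exE conjE)
  have le: "lkp (m (s 0)) v \<le> lkp (m (s 1)) v" for v
  proof (cases "v \<in> V")
    case True
    then show ?thesis using s(2) by auto
  next
    case False
    then have "v \<notin> keys (m (s 0))" using assms(2)[of "s 0"] by blast
    then show ?thesis by (simp add: in_keys_iff)
  qed
  have "m (s 1) = (m (s 1) - m (s 0)) + m (s 0)"
    by (rule poly_mapping_eqI) (simp add: lookup_add lookup_minus le del: One_nat_def)
  moreover have "keys (m (s 1) - m (s 0)) \<subseteq> V"
    using assms(2)[of "s 1"] by (auto simp: in_keys_iff lookup_minus)
  moreover have "s 0 < s 1" using s(1) by (simp add: strict_mono_def)
  ultimately show ?thesis by blast
qed

lemma monomial_ge_0: "0 \<le> (a :: nat \<Rightarrow>\<^sub>0 nat)"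
proof (rule ccontr)
  assume "\<not> 0 \<le> a"
  then have "a < 0" by simp
  then show False
    by (auto simp: less_poly_mapping.rep_eq less_fun_def)
qed

text \<open>
  The order of the type of monomials is the lexicographic one for the order of the variables.  It
  is compatible with products, and by Dickson's lemma it is well-founded for finitely many variables.
\<close>

lemma wf_monomials:
  assumes "finite V"
  shows "wf {(a, b). keys a \<subseteq> V \<and> keys b \<subseteq> V \<and> a < (b :: nat \<Rightarrow>\<^sub>0 nat)}"
  unfolding wf_iff_no_infinite_down_chain
proof
  assume "\<exists>f. \<forall>i. (f (Suc i), f i) \<in> {(a, b). keys a \<subseteq> V \<and> keys b \<subseteq> V \<and> a < (b :: nat \<Rightarrow>\<^sub>0 nat)}"
  then obtain f where f: "\<And>i. keys (f i) \<subseteq> V" "\<And>i. f (Suc i) < (f i :: nat \<Rightarrow>\<^sub>0 nat)"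
    by blast
  obtain i j a where ij: "i < j" "f j = a + f i"
    using dickson[OF assms f(1)] by blast
  have "f j < f i"
    using ij(1)
  proof (induction j)
    case (Suc j)
    then show ?case using f(2)[of j] by (cases "i = j") (auto intro: less_trans)
  qed simp
  moreover have "f i \<le> f j"
    using add_right_mono[OF monomial_ge_0[of a], of "f i"] ij by simp
  ultimately show False by simp
qed

definition lead :: "'k::field mpoly \<Rightarrow> (nat \<Rightarrow>\<^sub>0 nat)" where
  "lead p = Max (keys p)"

lemma lead_in_keys: "p \<noteq> 0 \<Longrightarrow> lead p \<in> keys p"
  unfolding lead_def by (intro Max_in) auto

lemma keys_lead: "p \<noteq> 0 \<Longrightarrow> p \<in> polys V \<Longrightarrow> keys (lead p) \<subseteq> V"
  using lead_in_keys unfolding polys_iff by blast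

lemma le_lead: "m \<in> keys p \<Longrightarrow> m \<le> lead p"
  unfolding lead_def by (intro Max_ge) auto

lemma lookup_monomial_mult:
  fixes p :: "'k::field mpoly"
  shows "lkp (sgl a c * p) (a + m) = c * lkp p m"
proof -
  have "lkp (sgl a c * p) (a + m) = (\<Sum>b\<in>keys p. lkp (sgl (a + b) (c * lkp p b)) (a + m))"
    by (subst sum_of_terms[of p]) (simp add: sum_distrib_left mult_single lookup_sum)
  also have "\<dots> = (\<Sum>b\<in>keys p. if b = m then c * lkp p b else 0)"
    by (intro sum.cong refl) (auto simp: lookup_single when_def)
  also have "\<dots> = c * lkp p m" by (simp add: in_keys_iff)
  finally show ?thesis .
qed

text \<open>
  The leading monomials of finitely many elements of an ideal divide the leading monomials of all its
  elements: otherwise choosing new elements forever would contradict Dickson's lemma.  Such elements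
  generate the ideal, by well-founded induction on the leading monomial.
\<close>

theorem noetherian_poly_ring:
  assumes V: "finite V"
  shows "noetherian_ring (poly_ring V :: 'k::field mpoly ring)"
proof -
  interpret cring "poly_ring V :: 'k mpoly ring" by (rule cring_poly_ring)
  show ?thesis
  proof (rule noetherian_ringI)
    fix I :: "'k mpoly set" assume I: "ideal I (poly_ring V)"
    have I_closed: "0 \<in> I" "a \<in> I \<Longrightarrow> b \<in> I \<Longrightarrow> a + b \<in> I" "c \<in> polys V \<Longrightarrow> b \<in> I \<Longrightarrow> c * b \<in> I"
      and I_sub: "I \<subseteq> polys V" for a b c
      using I by (auto simp: ideal_poly_ring_iff)
    define mdiv where "mdiv a m \<longleftrightarrow> (\<exists>d. keys d \<subseteq> V \<and> m = d + a)" for a m :: "nat \<Rightarrow>\<^sub>0 nat"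
    have "\<exists>F. finite F \<and> F \<subseteq> I - {0} \<and> (\<forall>p\<in>I - {0}. \<exists>b\<in>F. mdiv (lead b) (lead p))"
    proof (rule ccontr)
      assume no: "\<not> ?thesis"
      define next_poly where
        "next_poly F = (SOME p. p \<in> I - {0} \<and> (\<forall>b\<in>F. \<not> mdiv (lead b) (lead p)))" for F :: "'k mpoly set"
      have next_poly: "next_poly F \<in> I - {0} \<and> (\<forall>b\<in>F. \<not> mdiv (lead b) (lead (next_poly F)))"
        if "finite F" "F \<subseteq> I - {0}" for F
      proof -
        have "\<not> (\<forall>p\<in>I - {0}. \<exists>b\<in>F. mdiv (lead b) (lead p))"
          using no that by simp
        then have "\<exists>p. p \<in> I - {0} \<and> (\<forall>b\<in>F. \<not> mdiv (lead b) (lead p))" by blast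
        then show ?thesis unfolding next_poly_def by (rule someI_ex)
      qed
      define F where "F = rec_nat {} (\<lambda>_ S. insert (next_poly S) S)"
      have F: "F 0 = {}" "F (Suc i) = insert (next_poly (F i)) (F i)" for i
        by (simp_all add: F_def)
      have F_ok: "finite (F i) \<and> F i \<subseteq> I - {0}" for i
        by (induction i) (use F next_poly in auto)
      define f where "f i = next_poly (F i)" for i
      have f: "f i \<in> I - {0}" "\<forall>b\<in>F i. \<not> mdiv (lead b) (lead (f i))" for i
        using next_poly[of "F i"] F_ok[of i] unfolding f_def by simp_all
      have f_in: "i < j \<Longrightarrow> f i \<in> F j" for i j
        by (induction j) (auto simp: F f_def less_Suc_eq)
      have "keys (lead (f i)) \<subseteq> V" for i
        using f(1)[of i] I_sub by (intro keys_lead) auto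
      from dickson[OF V this, of "\<lambda>i. i"] obtain i j where "i < j" "mdiv (lead (f i)) (lead (f j))"
        unfolding mdiv_def by blast
      then show False using f(2)[of j] f_in[of i j] by blast
    qed
    then obtain F where F: "finite F" "F \<subseteq> I - {0}"
      and lead: "\<And>p. p \<in> I \<Longrightarrow> p \<noteq> 0 \<Longrightarrow> \<exists>b\<in>F. mdiv (lead b) (lead p)" by blast
    have FV: "F \<subseteq> carrier (poly_ring V)" using F I_sub by auto
    have J: "ideal (Idl\<^bsub>poly_ring V\<^esub> F) (poly_ring V)" by (rule genideal_ideal[OF FV])
    have "p \<in> Idl\<^bsub>poly_ring V\<^esub> F" if "p \<in> I" for p
    proof -
      have "\<forall>p. p \<in> I \<and> lead p = m \<longrightarrow> p \<in> Idl\<^bsub>poly_ring V\<^esub> F" if "keys m \<subseteq> V" for m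
        using that
      proof (induction m rule: wf_induct_rule[OF wf_monomials[OF V]])
        case (1 m)
        show ?case
        proof (intro allI impI, elim conjE)
          fix p assume p: "p \<in> I" "lead p = m"
          show "p \<in> Idl\<^bsub>poly_ring V\<^esub> F"
          proof (cases "p = 0")
            case True
            then show ?thesis using J by (simp add: ideal_poly_ring_iff)
          next
            case False
            then obtain b d where bd: "b \<in> F" "keys d \<subseteq> V" "m = d + lead b"
              using lead[OF p(1)] p(2) by (auto simp: mdiv_def)
            have b: "b \<noteq> 0" "b \<in> I" using bd F by auto
            have lcb: "lkp b (lead b) \<noteq> 0" using lead_in_keys[OF b(1)] by (simp add: in_keys_iff)
            define u where "u = sgl d (lkp p m / lkp b (lead b)) * b"
            have uF: "u \<in> Idl\<^bsub>poly_ring V\<^esub> F"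
              using J genideal_self[OF FV] bd polys_single[OF bd(2)]
              unfolding u_def ideal_poly_ring_iff by blast
            have uI: "u \<in> I" unfolding u_def using b bd by (intro I_closed polys_single)
            have um: "lkp u m = lkp p m" unfolding u_def bd(3) lookup_monomial_mult using lcb by simp
            have u_le: "k \<le> m" if ku: "k \<in> keys u" for k
            proof -
              obtain x a where xa: "x \<in> keys (sgl d (lkp p m / lkp b (lead b)))" "a \<in> keys b" "k = x + a"
                using ku keys_mult[of "sgl d (lkp p m / lkp b (lead b))" b] unfolding u_def by blast
              have "x = d" using xa(1) by (simp split: if_splits)
              with xa show ?thesis using le_lead[of a b] bd(3) by (simp add: add_left_mono)
            qed
            define p' where "p' = p - u"
            have p'I: "p' \<in> I" unfolding p'_def using ideal_diff_closed[OF I p(1) uI] .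
            have "p' \<in> Idl\<^bsub>poly_ring V\<^esub> F"
            proof (cases "p' = 0")
              case True
              then show ?thesis using J by (simp add: ideal_poly_ring_iff)
            next
              case False
              have "lead p' \<in> keys p'" using lead_in_keys[OF False] .
              moreover have "m \<notin> keys p'" using um by (simp add: p'_def in_keys_iff lookup_minus)
              moreover have "lead p' \<le> m"
              proof -
                have "lead p' \<in> keys p \<union> keys u"
                  using \<open>lead p' \<in> keys p'\<close> keys_diff[of p u] unfolding p'_def by blast
                then show ?thesis using u_le le_lead[of _ p] p(2) by auto
              qed
              ultimately have lt: "lead p' < m" by (metis order_less_le)
              have "keys (lead p') \<subseteq> V"
                using False p'I I_sub by (intro keys_lead) auto
              then show ?thesis using 1 lt p'I by blast
            qed
            then have "p' + u \<in> Idl\<^bsub>poly_ring V\<^esub> F"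
              using uF J by (auto simp: ideal_poly_ring_iff)
            then show ?thesis by (simp add: p'_def)
          qed
        qed
      qed
      moreover have "keys (lead p) \<subseteq> V" if "p \<noteq> 0"
        using that \<open>p \<in> I\<close> I_sub by (intro keys_lead) auto
      moreover have "0 \<in> Idl\<^bsub>poly_ring V\<^esub> F" using J by (simp add: ideal_poly_ring_iff)
      ultimately show ?thesis using that by (cases "p = 0") auto
    qed
    moreover have "Idl\<^bsub>poly_ring V\<^esub> F \<subseteq> I"
      using F by (intro genideal_minimal I) auto
    ultimately show "\<exists>A\<subseteq>carrier (poly_ring V). finite A \<and> I = Idl\<^bsub>poly_ring V\<^esub> A"
      using F FV by (intro exI[of _ F]) auto
  qed
qed

section \<open>Regular sequences in polynomial rings\<close>

text \<open>
  The condition that the generated ideal is proper is left out.  It holds as soon as the sequence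
  lies in a proper ideal, and the remaining condition transfers to extensions of the ring.
\<close>

definition reg_seq :: "nat set \<Rightarrow> 'k::field mpoly list \<Rightarrow> bool" where
  "reg_seq V as \<longleftrightarrow> set as \<subseteq> polys V \<and>
    (\<forall>i<length as. \<forall>b\<in>polys V. as ! i * b \<in> ideal_gen V (take i as) \<longrightarrow> b \<in> ideal_gen V (take i as))"

text \<open>
  Maximality, in the form that the residue classes outside \<open>m\<close> are invertible.
\<close>

definition maximal_in :: "nat set \<Rightarrow> 'k::field mpoly set \<Rightarrow> bool" where
  "maximal_in V m \<longleftrightarrow> ideal m (poly_ring V) \<and> 1 \<notin> m \<and>
    (\<forall>s\<in>polys V. s \<notin> m \<longrightarrow> (\<exists>t\<in>polys V. t * s - 1 \<in> m))"

lemma ideal_mult_closed: "ideal I (poly_ring V) \<Longrightarrow> a \<in> polys V \<Longrightarrow> b \<in> I \<Longrightarrow> a * b \<in> I"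
  and ideal_add_closed: "ideal I (poly_ring V) \<Longrightarrow> a \<in> I \<Longrightarrow> b \<in> I \<Longrightarrow> a + b \<in> I"
  and ideal_0: "ideal I (poly_ring V) \<Longrightarrow> 0 \<in> I"
  and ideal_sub_polys: "ideal I (poly_ring V) \<Longrightarrow> I \<subseteq> polys V"
  by (auto simp: ideal_poly_ring_iff)

lemma ideal_uminus_closed: "ideal I (poly_ring V) \<Longrightarrow> a \<in> I \<Longrightarrow> - a \<in> I"
  using ideal_diff_closed[of I V 0 a] ideal_0[of I V] by simp

text \<open>
  The bounds \<open>d\<close> and \<open>e\<close> need not be the degrees, so that leading coefficients which may vanish
  are covered as well.
\<close>

lemma coeff_mult_degree_le:
  fixes p q :: "'a::comm_ring_1 poly"
  assumes "degree p \<le> d" "degree q \<le> e"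
  shows "coeff (p * q) (d + e) = coeff p d * coeff q e"
proof -
  have "coeff (p * q) (d + e) = (\<Sum>i\<le>d + e. coeff p i * coeff q (d + e - i))"
    by (rule coeff_mult)
  also have "\<dots> = (\<Sum>i\<le>d + e. if i = d then coeff p d * coeff q e else 0)"
    by (intro sum.cong refl) (use assms in \<open>auto simp: coeff_eq_0 not_le intro: le_less_trans
      elim!: linorder_neqE_nat\<close>)
  finally show ?thesis by simp
qed

lemma expand_in_var_le:
  assumes "degree (to_poly v p) \<le> N"
  shows "p = (\<Sum>e\<le>N. coeff (to_poly v p) e * Var v ^ e)"
proof -
  have "(\<Sum>e\<le>degree (to_poly v p). coeff (to_poly v p) e * Var v ^ e) = (\<Sum>e\<le>N. coeff (to_poly v p) e * Var v ^ e)"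
    using assms by (intro sum.mono_neutral_left) (auto simp: coeff_eq_0)
  then show ?thesis
    using expand_in_var[of p v] by simp
qed

lemma ideal_gen_mono:
  assumes "p \<in> ideal_gen V bs" "V \<subseteq> U" shows "p \<in> ideal_gen U bs"
  using assms(1) polys_mono[OF assms(2)] unfolding ideal_gen_def by blast

text \<open>
  The extension of an ideal to the polynomial ring in one more variable can be tested on
  coefficients.  Therefore nonzerodivisors and regular sequences stay such after adjoining a variable
  (\<open>nzd_insert\<close>, \<open>reg_seq_insert\<close>), and a monic polynomial is a nonzerodivisor modulo such an ideal
  (\<open>nzd_monic\<close>).
\<close>

lemma mem_ideal_gen_insert_iff:
  assumes v: "v \<notin> V" and bs: "set bs \<subseteq> polys V" and p: "p \<in> polys (insert v V)"
  shows "p \<in> ideal_gen (insert v V) bs \<longleftrightarrow> (\<forall>e. coeff (to_poly v p) e \<in> ideal_gen V bs)"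
proof
  assume "p \<in> ideal_gen (insert v V) bs"
  then obtain b where b: "p = (\<Sum>i<length bs. b i * bs ! i)" "\<forall>i<length bs. b i \<in> polys (insert v V)"
    by (auto simp: ideal_gen_def)
  show "\<forall>e. coeff (to_poly v p) e \<in> ideal_gen V bs"
  proof
    fix e
    have "coeff (to_poly v p) e = (\<Sum>i<length bs. coeff (to_poly v (b i) * to_poly v (bs ! i)) e)"
      by (simp add: b(1) to_poly.hom_sum to_poly.hom_mult coeff_sum)
    also have "\<dots> = (\<Sum>i<length bs. coeff (to_poly v (b i)) e * bs ! i)"
    proof (intro sum.cong refl)
      fix i assume "i \<in> {..<length bs}"
      then have "bs ! i \<in> polys V" using bs by auto
      then have "to_poly v (bs ! i) = [:bs ! i:]" using v by (rule to_poly_const)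
      then show "coeff (to_poly v (b i) * to_poly v (bs ! i)) e = coeff (to_poly v (b i)) e * bs ! i"
        by (simp add: mult.commute)
    qed
    finally have eq: "coeff (to_poly v p) e = (\<Sum>i<length bs. coeff (to_poly v (b i)) e * bs ! i)" .
    have "coeff (to_poly v (b i)) e \<in> polys V" if "i < length bs" for i
      using coeff_to_poly_in_polys[of "b i" "insert v V" v e] b(2) that v by auto
    then show "coeff (to_poly v p) e \<in> ideal_gen V bs"
      unfolding eq ideal_gen_def mem_Collect_eq
      by (intro exI[of _ "\<lambda>i. coeff (to_poly v (b i)) e"]) auto
  qed
next
  assume c: "\<forall>e. coeff (to_poly v p) e \<in> ideal_gen V bs"
  have I: "ideal (ideal_gen (insert v V) bs) (poly_ring (insert v V))"
    using bs polys_mono[of V "insert v V"] by (intro ideal_ideal_gen) auto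
  have "(\<Sum>e\<le>degree (to_poly v p). Var v ^ e * coeff (to_poly v p) e) \<in> ideal_gen (insert v V) bs"
    using c by (intro ideal_sum_closed[OF I] ideal_mult_closed[OF I]) (auto intro: ideal_gen_mono)
  then show "p \<in> ideal_gen (insert v V) bs"
    using expand_in_var[of p v] by (simp add: mult.commute)
qed

lemma coeff_const_mult:
  "a \<in> polys V \<Longrightarrow> v \<notin> V \<Longrightarrow> coeff (to_poly v (a * b)) e = a * coeff (to_poly v b) e"
  by (simp add: to_poly.hom_mult to_poly_const)

lemma coeff_in_polys_insert:
  "p \<in> polys (insert v V) \<Longrightarrow> v \<notin> V \<Longrightarrow> coeff (to_poly v p) e \<in> polys V"
  using coeff_to_poly_in_polys[of p "insert v V" v e] by simp

lemma nzd_insert: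
  assumes v: "v \<notin> V" and bs: "set bs \<subseteq> polys V" and a: "a \<in> polys V"
    and nzd: "\<And>b. b \<in> polys V \<Longrightarrow> a * b \<in> ideal_gen V bs \<Longrightarrow> b \<in> ideal_gen V bs"
    and b: "b \<in> polys (insert v V)" "a * b \<in> ideal_gen (insert v V) bs"
  shows "b \<in> ideal_gen (insert v V) bs"
proof -
  have "a * b \<in> polys (insert v V)"
    using a b polys_mono[of V "insert v V"] by (intro polys_mult) auto
  then have "a * coeff (to_poly v b) e \<in> ideal_gen V bs" for e
    using b(2) mem_ideal_gen_insert_iff[OF v bs, of "a * b"] coeff_const_mult[OF a v, of b] by simp
  then have "coeff (to_poly v b) e \<in> ideal_gen V bs" for e
    using nzd[OF coeff_in_polys_insert[OF b(1) v]] by blast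
  then show ?thesis
    using mem_ideal_gen_insert_iff[OF v bs b(1)] by blast
qed

lemma reg_seq_insert:
  assumes "reg_seq V as" "v \<notin> V" shows "reg_seq (insert v V) as"
  unfolding reg_seq_def
proof (intro conjI allI impI ballI)
  show "set as \<subseteq> polys (insert v V)"
    using assms(1) polys_mono[of V "insert v V"] unfolding reg_seq_def by auto
next
  fix i b assume i: "i < length as" and b: "b \<in> polys (insert v V)" "as ! i * b \<in> ideal_gen (insert v V) (take i as)"
  have as: "set as \<subseteq> polys V" using assms(1) by (simp add: reg_seq_def)
  then have "set (take i as) \<subseteq> polys V" "as ! i \<in> polys V" using i set_take_subset[of i as] by auto
  then show "b \<in> ideal_gen (insert v V) (take i as)"
    using assms i unfolding reg_seq_def by (intro nzd_insert[OF assms(2) _ _ _ b]) auto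
qed

lemma nzd_monic:
  assumes v: "v \<notin> V" and bs: "set bs \<subseteq> polys V" and f: "f \<in> polys (insert v V)"
    and deg: "degree (to_poly v f) \<le> N" and lc: "coeff (to_poly v f) N = 1"
    and b: "b \<in> polys (insert v V)" "f * b \<in> ideal_gen (insert v V) bs"
  shows "b \<in> ideal_gen (insert v V) bs"
proof -
  let ?F = "to_poly v f" and ?B = "to_poly v b"
  have J: "ideal (ideal_gen V bs) (poly_ring V)" by (rule ideal_ideal_gen[OF bs])
  have FB: "coeff (?F * ?B) e \<in> ideal_gen V bs" for e
    using b f mem_ideal_gen_insert_iff[OF v bs, of "f * b"] by (auto simp: to_poly.hom_mult)
  have "coeff ?B e \<in> ideal_gen V bs" for e
  proof (rule ccontr)
    assume e: "coeff ?B e \<notin> ideal_gen V bs"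
    define S where "S = {e. coeff ?B e \<notin> ideal_gen V bs}"
    have "S \<subseteq> {..degree ?B}"
      using ideal_0[OF J] by (auto simp: S_def intro!: le_degree)
    then have fin: "finite S" by (rule finite_subset) simp
    define d where "d = Max S"
    have d: "d \<in> S" unfolding d_def using fin e by (intro Max_in) (auto simp: S_def)
    have above: "coeff ?B j \<in> ideal_gen V bs" if "j > d" for j
      using Max_ge[OF fin, of j] that by (force simp: S_def d_def)
    \<comment> \<open>Modulo the ideal, \<open>b\<close> has its leading coefficient at \<open>d\<close>; as \<open>f\<close> is monic, the product has the same one.\<close>
    have "coeff (?F * ?B) (N + d) = (\<Sum>i\<le>N + d. coeff ?F i * coeff ?B (N + d - i))"
      by (rule coeff_mult)
    also have "\<dots> = coeff ?F N * coeff ?B (N + d - N) + (\<Sum>i\<in>{..N + d} - {N}. coeff ?F i * coeff ?B (N + d - i))"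
      by (rule sum.remove) auto
    finally have eq: "coeff ?B d = coeff (?F * ?B) (N + d) - (\<Sum>i\<in>{..N + d} - {N}. coeff ?F i * coeff ?B (N + d - i))"
      by (simp add: lc)
    have "coeff ?F i * coeff ?B (N + d - i) \<in> ideal_gen V bs" if i: "i \<in> {..N + d} - {N}" for i
    proof (cases "i < N")
      case True
      then have "N + d - i > d" by simp
      then show ?thesis
        using f v by (intro ideal_mult_closed[OF J] above coeff_in_polys_insert) auto
    next
      case False
      then have "coeff ?F i = 0" using i deg by (intro coeff_eq_0) auto
      then show ?thesis using ideal_0[OF J] by simp
    qed
    then have "coeff ?B d \<in> ideal_gen V bs"
      unfolding eq by (intro ideal_diff_closed[OF J] FB ideal_sum_closed[OF J])
    then show False using d by (simp add: S_def)
  qed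
  then show ?thesis using mem_ideal_gen_insert_iff[OF v bs b(1)] by blast
qed

lemma ideal_gen_hom:
  assumes "comm_ring_hom h" "\<And>p. p \<in> polys V \<Longrightarrow> h p \<in> polys U" "p \<in> ideal_gen V bs"
  shows "h p \<in> ideal_gen U (map h bs)"
proof -
  interpret h: comm_ring_hom h by fact
  obtain b where b: "p = (\<Sum>i<length bs. b i * bs ! i)" "\<forall>i<length bs. b i \<in> polys V"
    using assms(3) by (auto simp: ideal_gen_def)
  have "h p = (\<Sum>i<length (map h bs). h (b i) * map h bs ! i)"
    by (simp add: b(1) h.hom_sum h.hom_mult)
  then show ?thesis
    unfolding ideal_gen_def using b(2) assms(2) by (auto intro!: exI[of _ "\<lambda>i. h (b i)"])
qed

lemma reg_seq_iso:
  assumes h: "comm_ring_hom h" "\<And>p. p \<in> polys U \<Longrightarrow> h p \<in> polys U"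
    and g: "comm_ring_hom g" "\<And>p. p \<in> polys U \<Longrightarrow> g p \<in> polys U"
    and inv: "\<And>p. p \<in> polys U \<Longrightarrow> h (g p) = p" "\<And>p. p \<in> polys U \<Longrightarrow> g (h p) = p"
    and as: "reg_seq U as"
  shows "reg_seq U (map h as)"
  unfolding reg_seq_def
proof (intro conjI allI impI ballI)
  interpret h: comm_ring_hom h by fact
  interpret g: comm_ring_hom g by fact
  have asU: "set as \<subseteq> polys U" using as by (simp add: reg_seq_def)
  then show "set (map h as) \<subseteq> polys U" using h(2) by auto
  fix i b assume i: "i < length (map h as)" and b: "b \<in> polys U" "map h as ! i * b \<in> ideal_gen U (take i (map h as))"
  have ai: "as ! i \<in> polys U" using asU i by auto
  have tk: "map g (take i (map h as)) = take i as"
    using asU inv(2) by (intro nth_equalityI) (auto simp: take_map in_set_conv_nth subset_iff)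
  have "g (map h as ! i * b) \<in> ideal_gen U (map g (take i (map h as)))"
    by (rule ideal_gen_hom[OF g b(2)])
  then have "as ! i * g b \<in> ideal_gen U (take i as)"
    using tk ai inv(2) i by (simp add: g.hom_mult)
  then have "g b \<in> ideal_gen U (take i as)"
    using as i g(2)[OF b(1)] by (simp add: reg_seq_def)
  from ideal_gen_hom[OF h this] have "h (g b) \<in> ideal_gen U (map h (take i as))" .
  then show "b \<in> ideal_gen U (take i (map h as))"
    using inv(1)[OF b(1)] by (simp add: take_map)
qed

section \<open>Nagata's change of variables\<close>

text \<open>
  For \<open>v \<notin> V\<close> this is the automorphism \<open>x\<^sub>i \<mapsto> x\<^sub>i + c x\<^sub>v\<^bsup>w(i)\<^esup>\<close>, \<open>i \<in> V\<close>, with the one for \<open>- c\<close> as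
  inverse.
\<close>

definition shear :: "'k::field \<Rightarrow> nat set \<Rightarrow> nat \<Rightarrow> (nat \<Rightarrow> nat) \<Rightarrow> 'k mpoly \<Rightarrow> 'k mpoly" where
  "shear c V v w = subst (\<lambda>i. if i \<in> V then Var i + Const c * Var v ^ w i else Var i)"

lemma comm_ring_hom_shear: "comm_ring_hom (shear c V v w)"
  unfolding shear_def by (rule subst.comm_ring_hom_axioms)

lemma shear_in_polys: "p \<in> polys (insert v V) \<Longrightarrow> shear c V v w p \<in> polys (insert v V)"
  unfolding shear_def by (rule subst_in_polys) (auto intro!: polys_add polys_mult polys_power)

lemma shear_inverse:
  assumes v: "v \<notin> V" and cd: "c + d = 0"
  shows "shear c V v w (shear d V v w p) = p"
proof -
  interpret h: comm_ring_hom "shear c V v w" by (rule comm_ring_hom_shear)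
  have V: "shear c V v w (Var i) = (if i \<in> V then Var i + Const c * Var v ^ w i else Var i)" for i
    by (simp add: shear_def)
  have "shear c V v w (Const d) = Const d" by (simp add: shear_def)
  then have "shear c V v w (if i \<in> V then Var i + Const d * Var v ^ w i else Var i) = Var i" for i
    using v cd by (auto simp: h.hom_add h.hom_mult h.hom_power V algebra_simps simp flip: distrib_left distrib_right Const_add)
  then show ?thesis
    unfolding shear_def[of d] 
    by (intro hom_eqI[OF comm_ring_hom_comp[OF comm_ring_hom_shear subst.comm_ring_hom_axioms] comm_ring_hom_id, of p UNIV])
      (simp_all add: polys_def, simp add: shear_def)
qed

lemma monic_prod:
  fixes f :: "'i \<Rightarrow> 'a::comm_ring_1 poly"
  assumes "finite I" "\<And>i. i \<in> I \<Longrightarrow> degree (f i) \<le> d i \<and> coeff (f i) (d i) = 1"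
  shows "degree (prod f I) \<le> sum d I \<and> coeff (prod f I) (sum d I) = 1"
  using assms
proof (induction I rule: finite_induct)
  case (insert x I)
  then have IH: "degree (f x) \<le> d x" "coeff (f x) (d x) = 1"
    "degree (prod f I) \<le> sum d I" "coeff (prod f I) (sum d I) = 1" by auto
  have "degree (f x * prod f I) \<le> d x + sum d I"
    using degree_mult_le[of "f x" "prod f I"] IH by linarith
  then show ?case
    using insert IH coeff_mult_degree_le[of "f x" "d x" "prod f I" "sum d I"] by simp
qed simp

lemma monic_power:
  fixes f :: "'a::comm_ring_1 poly"
  assumes "degree f \<le> d" "coeff f d = 1"
  shows "degree (f ^ k) \<le> k * d \<and> coeff (f ^ k) (k * d) = 1"
  using monic_prod[of "{..<k}" "\<lambda>_. f" "\<lambda>_. d"] assms by simp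

text \<open>
  The exponents \<open>w(i)\<close> are distinct, so \<open>\<Sum>\<^sub>i m\<^sub>i r\<^bsup>w(i)\<^esup>\<close> is a polynomial in \<open>r\<close> that determines the
  monomial \<open>m\<close>.  For two different monomials, the values agree for finitely many \<open>r\<close> only.
\<close>

lemma ex_separating_base:
  fixes K :: "(nat \<Rightarrow>\<^sub>0 nat) set"
  assumes K: "finite K" and w: "inj w"
  shows "\<exists>r\<ge>1. inj_on (\<lambda>m. \<Sum>i\<in>keys m. lkp m i * r ^ w i) K"
proof -
  define pm where "pm m = (\<Sum>i\<in>keys m. monom (int (lkp m i)) (w i))" for m :: "nat \<Rightarrow>\<^sub>0 nat"
  have cf: "coeff (pm m) (w i) = int (lkp m i)" for m i
  proof -
    have "coeff (pm m) (w i) = (\<Sum>j\<in>keys m. if j = i then int (lkp m j) else 0)"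
      using w by (auto simp: pm_def coeff_sum inj_eq intro!: sum.cong)
    then show ?thesis by (simp add: in_keys_iff)
  qed
  define R where "R = (\<Union>m\<in>K. \<Union>m'\<in>K - {m}. {x. poly (pm m - pm m') x = 0})"
  have "pm m - pm m' \<noteq> 0" if "m \<noteq> m'" for m m'
  proof
    assume "pm m - pm m' = 0"
    then have "lkp m i = lkp m' i" for i using cf[of m i] cf[of m' i] by simp
    then show False using that by (auto intro: poly_mapping_eqI)
  qed
  then have "finite R"
    unfolding R_def using K by (intro finite_UN_I poly_roots_finite) auto
  then have "finite (int -` R)" by (rule finite_vimageI) simp
  then have "\<exists>r. r \<notin> insert 0 (int -` R)"
    by (intro ex_new_if_finite) auto
  then obtain r where r: "r \<ge> 1" "int r \<notin> R" by (auto simp: Suc_le_eq)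
  have ev: "poly (pm m) (int r) = int (\<Sum>i\<in>keys m. lkp m i * r ^ w i)" for m
    by (simp add: pm_def poly_sum poly_monom)
  have "inj_on (\<lambda>m. \<Sum>i\<in>keys m. lkp m i * r ^ w i) K"
  proof (rule inj_onI, rule ccontr)
    fix m m' assume m: "m \<in> K" "m' \<in> K" "(\<Sum>i\<in>keys m. lkp m i * r ^ w i) = (\<Sum>i\<in>keys m'. lkp m' i * r ^ w i)" "m \<noteq> m'"
    then have "poly (pm m - pm m') (int r) = 0" by (simp add: ev)
    then show False using m r by (auto simp: R_def)
  qed
  then show ?thesis using r by blast
qed

text \<open>
  For weights that separate the monomials of \<open>f\<close>, the shear takes the monomial \<open>m\<close> to a polynomial
  that is monic in \<open>x\<^sub>v\<close> of degree the weight of \<open>m\<close>.  So the leading term of the image of \<open>f\<close> comes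
  from one monomial only.
\<close>

lemma ex_shear_monic:
  fixes f :: "'k::field mpoly"
  assumes v: "v \<notin> V" and f: "f \<in> polys (insert v V)" "f \<noteq> 0"
  shows "\<exists>w N c. c \<noteq> 0 \<and> degree (to_poly v (shear 1 V v w f)) \<le> N \<and>
    coeff (to_poly v (shear 1 V v w f)) N = Const c"
proof -
  \<comment> \<open>The variable \<open>x\<^sub>v\<close> itself must get weight \<open>r\<^sup>0 = 1\<close>.\<close>
  define e where "e i = (if i = v then 0 else Suc i)" for i :: nat
  have "inj e" by (auto simp: e_def inj_def)
  then obtain r where r: "r \<ge> 1" "inj_on (\<lambda>m. \<Sum>i\<in>keys m. lkp m i * r ^ e i) (keys f)"
    using ex_separating_base[of "keys f" e] by auto
  define w where "w i = r ^ e i" for i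
  define W where "W m = (\<Sum>i\<in>keys m. lkp m i * w i)" for m :: "nat \<Rightarrow>\<^sub>0 nat"
  have w1: "w i \<ge> 1" for i using r(1) by (simp add: w_def)
  have wv: "w v = 1" by (simp add: w_def e_def)
  interpret h: comm_ring_hom "shear 1 V v w" by (rule comm_ring_hom_shear)
  define s where "s i = (if i \<in> V then Var i + Const 1 * Var v ^ w i else Var i :: 'k mpoly)" for i
  define T where "T m = to_poly v (\<Prod>i\<in>keys m. s i ^ lkp m i)" for m :: "nat \<Rightarrow>\<^sub>0 nat"
  have s_monic: "degree (to_poly v (s i)) \<le> w i \<and> coeff (to_poly v (s i)) (w i) = 1" if "i \<in> insert v V" for i
  proof (cases "i = v")
    case True
    then show ?thesis using v wv by (simp add: s_def)
  next
    case False
    then have "to_poly v (s i) = [:Var i:] + monom 1 (w i)"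
      using that v by (simp add: s_def to_poly.hom_add to_poly.hom_power to_poly_Var monom_altdef)
    moreover have "degree ([:Var i:] + monom 1 (w i)) \<le> w i"
      by (intro degree_add_le degree_monom_le) simp
    ultimately show ?thesis using w1[of i] by (cases "w i") (auto simp: coeff_pCons)
  qed
  have T_monic: "degree (T m) \<le> W m \<and> coeff (T m) (W m) = 1" if "m \<in> keys f" for m
  proof -
    have "keys m \<subseteq> insert v V" using f(1) that by (auto simp: polys_iff)
    then have "degree (to_poly v (s i) ^ lkp m i) \<le> lkp m i * w i \<and> coeff (to_poly v (s i) ^ lkp m i) (lkp m i * w i) = 1"
      if "i \<in> keys m" for i
      using s_monic[of i] that by (intro monic_power) auto
    then show ?thesis
      unfolding T_def W_def to_poly.hom_prod to_poly.hom_power by (intro monic_prod) auto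
  qed
  have expand: "to_poly v (shear 1 V v w f) = (\<Sum>m\<in>keys f. smult (Const (lkp f m)) (T m))"
    unfolding shear_def s_def[symmetric] T_def
    by (subst sum_of_terms) (simp add: subst.hom_sum subst_single to_poly.hom_sum to_poly.hom_mult)
  obtain m where m: "m \<in> keys f" "\<And>m'. m' \<in> keys f \<Longrightarrow> W m' \<le> W m"
  proof -
    have "Max (W ` keys f) \<in> W ` keys f" using f(2) by (intro Max_in) auto
    then obtain m where "m \<in> keys f" "Max (W ` keys f) = W m" by auto
    then show ?thesis using that Max_ge[of "W ` keys f"] by (metis finite_imageI finite_keys imageI)
  qed
  have lt: "W m' < W m" if "m' \<in> keys f" "m' \<noteq> m" for m'
    using m(2)[OF that(1)] r(2) that m(1) by (force simp: W_def w_def inj_on_def order_less_le)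
  have "degree (to_poly v (shear 1 V v w f)) \<le> W m"
    unfolding expand
    using T_monic m(2) by (intro degree_sum_le order_trans[OF degree_smult_le]) (auto intro: order_trans)
  moreover have "coeff (to_poly v (shear 1 V v w f)) (W m) = (\<Sum>m'\<in>keys f. if m' = m then Const (lkp f m) else 0)"
    unfolding expand coeff_sum
  proof (intro sum.cong refl)
    fix m' assume m': "m' \<in> keys f"
    show "coeff (smult (Const (lkp f m')) (T m')) (W m) = (if m' = m then Const (lkp f m) else 0)"
      using T_monic[OF m'] lt[OF m'] by (auto simp: coeff_eq_0)
  qed
  moreover have "lkp f m \<noteq> 0" using m(1) by (simp add: in_keys_iff)
  ultimately show ?thesis using m(1) by (intro exI[of _ w] exI[of _ "W m"] exI[of _ "lkp f m"]) auto
qed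

section \<open>Regular sequences in maximal ideals\<close>

lemma det_in_polys:
  assumes "A \<in> carrier_mat n n" "\<And>i j. i < n \<Longrightarrow> j < n \<Longrightarrow> A $$ (i, j) \<in> polys V"
  shows "Determinant.det A \<in> polys V"
  unfolding det_def'[OF assms(1)]
proof (intro polys_sum polys_mult polys_prod)
  fix p i assume "p \<in> {p. p permutes {0..<n}}" "i \<in> {0..<n}"
  then show "A $$ (i, p i) \<in> polys V" using assms(2) by (auto simp: permutes_in_image)
qed (auto simp: sign_def intro: polys_uminus)

lemma det_cong_mod_ideal:
  assumes J: "ideal J (poly_ring V)" and A: "A \<in> carrier_mat n n" and B: "B \<in> carrier_mat n n"
    and AV: "\<And>i j. i < n \<Longrightarrow> j < n \<Longrightarrow> A $$ (i, j) \<in> polys V"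
    and BV: "\<And>i j. i < n \<Longrightarrow> j < n \<Longrightarrow> B $$ (i, j) \<in> polys V"
    and AB: "\<And>i j. i < n \<Longrightarrow> j < n \<Longrightarrow> A $$ (i, j) - B $$ (i, j) \<in> J"
  shows "Determinant.det A - Determinant.det B \<in> J"
proof -
  have prod: "(\<Prod>i\<in>X. f i) - (\<Prod>i\<in>X. g i) \<in> J" if "finite X" "\<And>i. i \<in> X \<Longrightarrow> f i \<in> polys V"
    "\<And>i. i \<in> X \<Longrightarrow> g i \<in> polys V" "\<And>i. i \<in> X \<Longrightarrow> f i - g i \<in> J" for X :: "nat set" and f g
    using that
  proof (induction X rule: finite_induct)
    case (insert x X)
    have "(\<Prod>i\<in>insert x X. f i) - (\<Prod>i\<in>insert x X. g i)
      = f x * ((\<Prod>i\<in>X. f i) - (\<Prod>i\<in>X. g i)) + (\<Prod>i\<in>X. g i) * (f x - g x)"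
      using insert by (simp add: algebra_simps)
    also have "\<dots> \<in> J"
      using insert by (intro ideal_add_closed[OF J] ideal_mult_closed[OF J] polys_prod) auto
    finally show ?case .
  qed (use ideal_0[OF J] in simp)
  show ?thesis
    unfolding det_def'[OF A] det_def'[OF B] sum_subtractf[symmetric] right_diff_distrib[symmetric]
  proof (intro ideal_sum_closed[OF J] ideal_mult_closed[OF J] prod)
    fix p i assume "p \<in> {p. p permutes {0..<n}}" "i \<in> {0..<n}"
    then have "i < n" "p i < n" using permutes_in_image[of p "{0..<n}" i] by auto
    then show "A $$ (i, p i) \<in> polys V" "B $$ (i, p i) \<in> polys V" "A $$ (i, p i) - B $$ (i, p i) \<in> J"
      using AV BV AB by auto
  qed (auto simp: sign_def intro: polys_uminus)
qed

text \<open>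
  Modulo an element that is monic in \<open>x\<^sub>v\<close> of degree \<open>N\<close>, the powers of \<open>x\<^sub>v\<close> below \<open>N\<close> span the ring
  over \<open>k[V]\<close>.
\<close>

lemma reduce_mod_monic:
  assumes v: "v \<notin> V" and m: "ideal m (poly_ring (insert v V))"
    and f: "f \<in> m" and deg: "degree (to_poly v f) \<le> N" and lc: "coeff (to_poly v f) N = 1"
    and p: "p \<in> polys (insert v V)"
  shows "\<exists>c. (\<forall>j. c j \<in> polys V) \<and> p - (\<Sum>j<N. c j * Var v ^ j) \<in> m"
proof -
  let ?U = "insert v V"
  have VU: "a \<in> polys V \<Longrightarrow> a \<in> polys ?U" for a using polys_mono[of V ?U] by auto
  define S where "S = {p. \<exists>c. (\<forall>j. c j \<in> polys V) \<and> p - (\<Sum>j<N. c j * Var v ^ j) \<in> m}"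
  have fU: "f \<in> polys ?U" using f ideal_sub_polys[OF m] by auto
  have S_add: "a + b \<in> S" if ab: "a \<in> S" "b \<in> S" for a b
  proof -
    obtain c d where cd: "\<forall>j. c j \<in> polys V" "a - (\<Sum>j<N. c j * Var v ^ j) \<in> m"
      "\<forall>j. d j \<in> polys V" "b - (\<Sum>j<N. d j * Var v ^ j) \<in> m"
      using ab by (auto simp: S_def)
    have "(a - (\<Sum>j<N. c j * Var v ^ j)) + (b - (\<Sum>j<N. d j * Var v ^ j)) \<in> m"
      using cd by (intro ideal_add_closed[OF m])
    then have "a + b - (\<Sum>j<N. (c j + d j) * Var v ^ j) \<in> m"
      by (simp add: algebra_simps sum.distrib)
    then show ?thesis unfolding S_def using cd by (auto intro!: exI[of _ "\<lambda>j. c j + d j"])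
  qed
  have S_mult: "a * b \<in> S" if ab: "a \<in> polys V" "b \<in> S" for a b
  proof -
    obtain d where d: "\<forall>j. d j \<in> polys V" "b - (\<Sum>j<N. d j * Var v ^ j) \<in> m"
      using ab by (auto simp: S_def)
    have "a * (b - (\<Sum>j<N. d j * Var v ^ j)) \<in> m"
      using d VU[OF ab(1)] by (intro ideal_mult_closed[OF m])
    then have "a * b - (\<Sum>j<N. (a * d j) * Var v ^ j) \<in> m"
      by (simp add: algebra_simps sum_distrib_left)
    then show ?thesis unfolding S_def using d ab by (auto intro!: exI[of _ "\<lambda>j. a * d j"])
  qed
  have S_m: "a \<in> S" if "a \<in> m" for a
    using that by (auto simp: S_def intro!: exI[of _ "\<lambda>_. 0"])
  have S_low: "Var v ^ e \<in> S" if "e < N" for e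
  proof -
    have "(\<Sum>j<N. (if j = e then 1 else 0) * Var v ^ j) = (\<Sum>j<N. if j = e then Var v ^ e else (0 :: 'a mpoly))"
      by (intro sum.cong) auto
    also have "\<dots> = Var v ^ e" using that by simp
    finally show ?thesis
      unfolding S_def using ideal_0[OF m] by (auto intro!: exI[of _ "\<lambda>j. if j = e then 1 else 0"])
  qed
  have S_sum: "sum g X \<in> S" if "\<And>x. x \<in> X \<Longrightarrow> g x \<in> S" for g and X :: "nat set"
    using that by (induction X rule: infinite_finite_induct) (auto intro: S_add S_m ideal_0[OF m])
  have S_N: "Var v ^ N \<in> S"
  proof -
    have "f = (\<Sum>e\<le>N. coeff (to_poly v f) e * Var v ^ e)"
      using deg by (rule expand_in_var_le)
    then have "f = (\<Sum>e<N. coeff (to_poly v f) e * Var v ^ e) + Var v ^ N"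
      using lc by (simp add: lessThan_Suc_atMost[symmetric])
    then have "f - (\<Sum>e<N. coeff (to_poly v f) e * Var v ^ e) = Var v ^ N"
      by (metis add_diff_cancel_left')
    then have "Var v ^ N = f + (\<Sum>e<N. (- coeff (to_poly v f) e) * Var v ^ e)"
      by (simp add: sum_negf)
    moreover have "(\<Sum>e<N. (- coeff (to_poly v f) e) * Var v ^ e) \<in> S"
      using fU v by (intro S_sum S_mult S_low polys_uminus coeff_in_polys_insert) auto
    ultimately show ?thesis using S_add[OF S_m[OF f]] by simp
  qed
  have S_Var: "Var v * a \<in> S" if a: "a \<in> S" for a
  proof -
    obtain d where d: "\<forall>j. d j \<in> polys V" "a - (\<Sum>j<N. d j * Var v ^ j) \<in> m"
      using a by (auto simp: S_def)
    have "Var v * (a - (\<Sum>j<N. d j * Var v ^ j)) \<in> m"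
      using d by (intro ideal_mult_closed[OF m]) auto
    moreover have "(\<Sum>j<N. d j * Var v ^ Suc j) \<in> S"
    proof (intro S_sum S_mult)
      fix j assume "j \<in> {..<N}"
      then show "Var v ^ Suc j \<in> S" using S_low[of "Suc j"] S_N by (cases "Suc j = N") auto
    qed (use d in auto)
    ultimately have "Var v * (a - (\<Sum>j<N. d j * Var v ^ j)) + (\<Sum>j<N. d j * Var v ^ Suc j) \<in> S"
      by (intro S_add[OF S_m])
    then show ?thesis by (simp add: algebra_simps sum_distrib_left)
  qed
  have S_pow: "Var v ^ e \<in> S" for e
  proof (induction e)
    case 0
    show ?case
      using S_low[of 0] S_N by (cases "N = 0") auto
  next
    case (Suc e)
    then show ?case using S_Var by simp
  qed
  have "(\<Sum>e\<le>degree (to_poly v p). coeff (to_poly v p) e * Var v ^ e) \<in> S"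
    using p v by (intro S_sum S_mult S_pow coeff_in_polys_insert) auto
  then have "p \<in> S" using expand_in_var[of p v] by simp
  then show ?thesis by (simp add: S_def)
qed

text \<open>
  The extension of rings \<open>k[V]/(m \<inter> k[V]) \<subseteq> k[V \<union> {v}]/m\<close> is integral, so with the larger ring also
  the smaller one is a field.  In elementary terms: let \<open>t\<close> be an inverse of \<open>s\<close> modulo \<open>m\<close>, and let
  \<open>T\<close> be the matrix of the multiplication by \<open>t\<close> with respect to the powers of \<open>x\<^sub>v\<close>.  The matrix
  \<open>C = 1 - s T\<close> annihilates the vector of these powers modulo \<open>m\<close>, and so does its determinant, which
  is therefore in \<open>m\<close>.  But the determinant is \<open>1\<close> modulo \<open>s\<close>, which yields an inverse of \<open>s\<close>.
\<close>

lemma maximal_in_contract: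
  fixes m :: "'k::field mpoly set"
  assumes v: "v \<notin> V" and m: "maximal_in (insert v V) m"
    and f: "f \<in> m" and deg: "degree (to_poly v f) \<le> N" and lc: "coeff (to_poly v f) N = 1"
  shows "maximal_in V (m \<inter> polys V)"
proof -
  let ?U = "insert v V"
  have I: "ideal m (poly_ring ?U)" and one: "1 \<notin> m" using m by (auto simp: maximal_in_def)
  have VU: "a \<in> polys V \<Longrightarrow> a \<in> polys ?U" for a using polys_mono[of V ?U] by auto
  have I': "ideal (m \<inter> polys V) (poly_ring V)"
    unfolding ideal_poly_ring_iff
    using ideal_0[OF I] ideal_add_closed[OF I] ideal_mult_closed[OF I VU] by auto
  have N: "N > 0"
  proof (rule ccontr)
    assume "\<not> N > 0"
    then have "to_poly v f = [:1:]" using deg lc by (metis degree_0_id gr0I le_zero_eq)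
    then have "f = 1" using poly_to_poly[of v f] by simp
    then show False using f one by simp
  qed
  have "\<exists>t'\<in>polys V. t' * s - 1 \<in> m \<inter> polys V" if s: "s \<in> polys V" "s \<notin> m" for s
  proof -
    obtain t where t: "t \<in> polys ?U" "t * s - 1 \<in> m"
      using m s VU by (auto simp: maximal_in_def)
    have "\<exists>c. (\<forall>j. c j \<in> polys V) \<and> t * Var v ^ i - (\<Sum>j<N. c j * Var v ^ j) \<in> m" for i
      using t by (intro reduce_mod_monic[OF v I f deg lc] polys_mult polys_power) auto
    then obtain T where T: "\<And>i j. T i j \<in> polys V" "\<And>i. t * Var v ^ i - (\<Sum>j<N. T i j * Var v ^ j) \<in> m"
      by metis
    define C where "C = mat N N (\<lambda>(i, j). (if i = j then 1 else 0) - s * T i j)"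
    have C: "C \<in> carrier_mat N N" by (simp add: C_def)
    have CV: "C $$ (i, j) \<in> polys V" if "i < N" "j < N" for i j
      using that s T by (auto simp: C_def intro!: polys_diff polys_mult)
    have row: "(\<Sum>j<N. C $$ (i, j) * Var v ^ j) \<in> m" if i: "i < N" for i
    proof -
      have "(\<Sum>j<N. C $$ (i, j) * Var v ^ j) = (\<Sum>j<N. (if j = i then Var v ^ i else 0) - s * (T i j * Var v ^ j))"
        using i by (intro sum.cong) (auto simp: C_def algebra_simps)
      also have "\<dots> = Var v ^ i - s * (\<Sum>j<N. T i j * Var v ^ j)"
        using i by (simp add: sum_subtractf sum_distrib_left)
      also have "\<dots> = s * (t * Var v ^ i - (\<Sum>j<N. T i j * Var v ^ j)) - Var v ^ i * (t * s - 1)"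
        by (simp add: algebra_simps)
      also have "\<dots> \<in> m"
        by (rule ideal_diff_closed[OF I ideal_mult_closed[OF I VU[OF s(1)] T(2)] ideal_mult_closed[OF I _ t(2)]])
          (intro polys_power polys_Var, simp)
      finally show ?thesis .
    qed
    define A where "A = adj_mat C"
    have A: "A \<in> carrier_mat N N" "A * C = Determinant.det C \<cdot>\<^sub>m 1\<^sub>m N"
      using adj_mat[OF C] by (auto simp: A_def)
    have AV: "A $$ (0, i) \<in> polys V" if "i < N" for i
    proof -
      have "A $$ (0, i) = cofactor C i 0" using that C N by (simp add: A_def adj_mat_def)
      moreover have "Determinant.det (mat_delete C i 0) \<in> polys V"
        using C that N by (intro det_in_polys[of _ "N - 1"])
          (auto simp: mat_delete_def intro!: CV)
      ultimately show ?thesis by (auto simp: cofactor_def intro!: polys_mult polys_power polys_uminus)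
    qed
    have AC: "(\<Sum>i<N. A $$ (0, i) * C $$ (i, j)) = (if j = 0 then Determinant.det C else 0)" if "j < N" for j
    proof -
      have "(\<Sum>i<N. A $$ (0, i) * C $$ (i, j)) = (A * C) $$ (0, j)"
        using that N A(1) C by (simp add: scalar_prod_def atLeast0LessThan)
      then show ?thesis using that N by (auto simp: A(2))
    qed
    \<comment> \<open>The first row of \<open>adj C\<close> combines the rows of \<open>C\<close> to the vector \<open>(det C, 0, \<dots>, 0)\<close>.\<close>
    have "Determinant.det C = (\<Sum>j<N. (if j = 0 then Determinant.det C else 0) * Var v ^ j)"
    proof -
      have "(\<Sum>j<N. (if j = 0 then Determinant.det C else 0) * Var v ^ j) = (\<Sum>j<N. if j = 0 then Determinant.det C else 0)"
        by (intro sum.cong) auto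
      then show ?thesis using N by simp
    qed
    also have "\<dots> = (\<Sum>j<N. \<Sum>i<N. A $$ (0, i) * (C $$ (i, j) * Var v ^ j))"
      by (intro sum.cong refl) (simp add: AC[symmetric] sum_distrib_right mult.assoc)
    also have "\<dots> = (\<Sum>i<N. A $$ (0, i) * (\<Sum>j<N. C $$ (i, j) * Var v ^ j))"
      by (subst sum.swap) (simp add: sum_distrib_left)
    also have "\<dots> \<in> m"
    proof (rule ideal_sum_closed[OF I])
      fix i assume "i \<in> {..<N}"
      then show "A $$ (0, i) * (\<Sum>j<N. C $$ (i, j) * Var v ^ j) \<in> m"
        using ideal_mult_closed[OF I VU[OF AV] row] by simp
    qed
    finally have det_m: "Determinant.det C \<in> m" .
    have sV: "set [s] \<subseteq> polys V" using s by simp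
    have "Determinant.det C - Determinant.det (1\<^sub>m N) \<in> ideal_gen V [s]"
    proof (rule det_cong_mod_ideal[OF ideal_ideal_gen[OF sV] C])
      fix i j assume ij: "i < N" "j < N"
      have "C $$ (i, j) - 1\<^sub>m N $$ (i, j) = (- T i j) * s"
        using ij by (simp add: C_def)
      also have "\<dots> \<in> ideal_gen V [s]"
        using T by (intro ideal_mult_closed[OF ideal_ideal_gen[OF sV]] ideal_gen_self sV) (auto intro: polys_uminus)
      finally show "C $$ (i, j) - 1\<^sub>m N $$ (i, j) \<in> ideal_gen V [s]" .
    qed (use CV in auto)
    then obtain u where u: "u \<in> polys V" "Determinant.det C - 1 = u * s"
      by (auto simp: ideal_gen_def)
    have "(- u) * s - 1 = - Determinant.det C" using u(2) by (simp add: algebra_simps)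
    moreover have "- Determinant.det C \<in> m" using ideal_uminus_closed[OF I det_m] .
    moreover have "(- u) * s - 1 \<in> polys V" using u s by (auto intro!: polys_diff polys_mult polys_uminus)
    ultimately show ?thesis using u by (intro bexI[of _ "- u"]) (auto intro: polys_uminus)
  qed
  then show ?thesis
    unfolding maximal_in_def using I' one by auto
qed

text \<open>
  By induction on the number of variables.  After a shear, \<open>m\<close> contains an element that is monic in
  \<open>x\<^sub>v\<close>.  It extends a regular sequence in the contraction of \<open>m\<close>, which is again maximal.
\<close>

theorem ex_reg_seq_maximal:
  fixes m :: "'k::field mpoly set"
  assumes "finite V" "maximal_in V m"
  shows "\<exists>as. length as = card V \<and> set as \<subseteq> m \<and> reg_seq V as"
  using assms
proof (induction V arbitrary: m rule: finite_induct)
  case empty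
  show ?case by (auto simp: reg_seq_def)
next
  case (insert v V)
  let ?U = "insert v V"
  have I: "ideal m (poly_ring ?U)" and one: "1 \<notin> m" using insert.prems by (auto simp: maximal_in_def)
  obtain f where f: "f \<in> m" "f \<noteq> 0"
  proof (cases "Var v \<in> m")
    case True
    then show ?thesis using that by auto
  next
    case False
    moreover have "Var v \<in> polys ?U" by simp
    ultimately obtain t where t: "t * Var v - 1 \<in> m"
      using insert.prems unfolding maximal_in_def by blast
    have "t * Var v - 1 \<noteq> 0"
    proof
      assume "t * Var v - 1 = 0"
      then have "poly (to_poly v (t * Var v - 1)) 0 = 0" by simp
      then show False by (simp add: to_poly.hom_minus to_poly.hom_mult)
    qed
    then show ?thesis using t that by blast
  qed
  have fU: "f \<in> polys ?U" using f ideal_sub_polys[OF I] by auto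
  obtain w N c where c: "c \<noteq> 0" "degree (to_poly v (shear 1 V v w f)) \<le> N"
    "coeff (to_poly v (shear 1 V v w f)) N = Const c"
    using ex_shear_monic[OF insert.hyps(2) fU f(2)] by blast
  define h where "h = shear (1 :: 'k) V v w"
  define g where "g = shear (- 1 :: 'k) V v w"
  have hom: "comm_ring_hom h" "comm_ring_hom g" by (simp_all add: h_def g_def comm_ring_hom_shear)
  interpret h: comm_ring_hom h by (rule hom)
  interpret g: comm_ring_hom g by (rule hom)
  have hU: "p \<in> polys ?U \<Longrightarrow> h p \<in> polys ?U" and gU: "p \<in> polys ?U \<Longrightarrow> g p \<in> polys ?U" for p :: "'k mpoly"
    by (simp_all add: h_def g_def shear_in_polys)
  have hg: "h (g p) = p" and gh: "g (h p) = p" for p :: "'k mpoly"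
    using insert.hyps(2) by (simp_all add: h_def g_def shear_inverse)
  define m1 where "m1 = {p \<in> polys ?U. g p \<in> m}"
  have max1: "maximal_in ?U m1"
    unfolding maximal_in_def
  proof (intro conjI ballI impI)
    show I1: "ideal m1 (poly_ring ?U)"
      unfolding ideal_poly_ring_iff
    proof (intro conjI ballI)
      show "a + b \<in> m1" if "a \<in> m1" "b \<in> m1" for a b
        using that ideal_add_closed[OF I] by (auto simp: m1_def g.hom_add)
      show "a * b \<in> m1" if "a \<in> polys ?U" "b \<in> m1" for a b
        using that ideal_mult_closed[OF I gU] by (auto simp: m1_def g.hom_mult)
    qed (auto simp: m1_def ideal_0[OF I])
    show "1 \<notin> m1" using one by (simp add: m1_def)
    fix s assume s: "s \<in> polys ?U" "s \<notin> m1"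
    then have "g s \<in> polys ?U" "g s \<notin> m" using gU by (auto simp: m1_def)
    then obtain t where t: "t \<in> polys ?U" "t * g s - 1 \<in> m"
      using insert.prems unfolding maximal_in_def by blast
    have "g (h t * s - 1) = t * g s - 1" by (simp add: g.hom_minus g.hom_mult gh)
    then have "h t * s - 1 \<in> m1"
      using t(2) polys_diff[OF polys_mult[OF hU[OF t(1)] s(1)] polys_1] by (simp add: m1_def)
    then show "\<exists>t\<in>polys ?U. t * s - 1 \<in> m1" using hU t by blast
  qed
  have I1: "ideal m1 (poly_ring ?U)" using max1 by (simp add: maximal_in_def)
  define f1 where "f1 = Const (inverse c) * h f"
  have "h f \<in> m1" using f fU hU by (simp add: m1_def gh)
  then have f1: "f1 \<in> m1" unfolding f1_def by (intro ideal_mult_closed[OF I1]) auto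
  have cf: "to_poly v f1 = smult (Const (inverse c)) (to_poly v (h f))"
    by (simp add: f1_def to_poly.hom_mult)
  have deg: "degree (to_poly v f1) \<le> N"
    unfolding cf using c(2) degree_smult_le[of "Const (inverse c)" "to_poly v (h f)"] by (simp add: h_def)
  have lc: "coeff (to_poly v f1) N = 1"
    unfolding cf using c by (simp add: h_def flip: Const_mult)
  have "maximal_in V (m1 \<inter> polys V)"
    by (rule maximal_in_contract[OF insert.hyps(2) max1 f1 deg lc])
  from insert.IH[OF this] obtain as where as: "length as = card V" "set as \<subseteq> m1 \<inter> polys V" "reg_seq V as"
    by blast
  have as': "set as \<subseteq> polys V" using as by auto
  have f1U: "f1 \<in> polys ?U" using f1 ideal_sub_polys[OF I1] by auto
  have "reg_seq ?U (as @ [f1])"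
    unfolding reg_seq_def
  proof (intro conjI allI impI ballI)
    have reg: "reg_seq ?U as" using as(3) insert.hyps(2) by (rule reg_seq_insert)
    then show "set (as @ [f1]) \<subseteq> polys ?U" using f1U by (simp add: reg_seq_def)
    fix i b assume i: "i < length (as @ [f1])" and b: "b \<in> polys ?U" "(as @ [f1]) ! i * b \<in> ideal_gen ?U (take i (as @ [f1]))"
    show "b \<in> ideal_gen ?U (take i (as @ [f1]))"
    proof (cases "i < length as")
      case True
      then show ?thesis using reg b by (simp add: reg_seq_def nth_append)
    next
      case False
      then have "i = length as" using i by simp
      then show ?thesis
        using nzd_monic[OF insert.hyps(2) as' f1U deg lc b(1)] b(2) by simp
    qed
  qed
  then have "reg_seq ?U (map g (as @ [f1]))"
    by (intro reg_seq_iso[where g = h] hom hU gU gh hg)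
  moreover have "set (map g (as @ [f1])) \<subseteq> m" using as f1 by (auto simp: m1_def)
  moreover have "length (map g (as @ [f1])) = card ?U" using as insert.hyps by simp
  ultimately show ?case by blast
qed

section \<open>Partial derivatives\<close>

text \<open>
  With this description the rules for derivatives carry over from univariate polynomials.
\<close>

lemma partial_deriv_eq_pderiv:
  fixes p :: "'a::field mpoly"
  shows "partial_deriv i p = poly (pderiv (to_poly i p)) (Var i)"
proof -
  have "poly (pderiv (to_poly i (sgl m c))) (Var i) = sgl (m - sgl i 1) (of_nat (lkp m i) * c)" for m and c :: 'a
  proof (cases "lkp m i")
    case (Suc l)
    have "m - sgl i (Suc l) + sgl i l = m - sgl i 1"
      by (rule poly_mapping_eqI) (use Suc in \<open>auto simp: lookup_add lookup_minus lookup_single when_def\<close>)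
    moreover have "of_nat r * sgl a b = sgl a (of_nat r * b)" for r and a :: "nat \<Rightarrow>\<^sub>0 nat" and b :: 'a
      by (metis mult_single add_0 single_of_nat)
    ultimately show ?thesis
      using Suc by (simp only: to_poly_single pderiv_monom poly_monom Var_power mult_single diff_Suc_1 mult_1_right)
  qed (simp add: to_poly_single pderiv_monom)
  then have "partial_deriv i p = (\<Sum>m\<in>keys p. poly (pderiv (to_poly i (sgl m (lkp p m)))) (Var i))"
    by (simp add: partial_deriv_def)
  also have "\<dots> = poly (pderiv (to_poly i (\<Sum>m\<in>keys p. sgl m (lkp p m)))) (Var i)"
    by (simp add: to_poly.hom_sum higher_pderiv_sum[of 1, simplified] poly_sum)
  finally show ?thesis
    by (simp flip: sum_of_terms)
qed

lemma partial_deriv_add: "partial_deriv i (p + q) = partial_deriv i p + partial_deriv i q"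
  and partial_deriv_uminus: "partial_deriv i (- p) = - partial_deriv i p"
  and partial_deriv_0 [simp]: "partial_deriv i 0 = 0"
  and partial_deriv_1 [simp]: "partial_deriv i 1 = 0"
  and partial_deriv_Var: "partial_deriv i (Var j) = (if i = j then 1 else 0)"
  and partial_deriv_mult: "partial_deriv i (p * q) = partial_deriv i p * q + p * partial_deriv i q"
  by (simp_all add: partial_deriv_eq_pderiv to_poly.hom_add to_poly.hom_mult to_poly.hom_uminus
      pderiv_add pderiv_mult pderiv_minus to_poly_Var pderiv_pCons algebra_simps)

lemma partial_deriv_sum: "partial_deriv i (sum f X) = (\<Sum>x\<in>X. partial_deriv i (f x))"
  by (induction X rule: infinite_finite_induct) (simp_all add: partial_deriv_add)

lemma partial_deriv_power_other: "i \<noteq> j \<Longrightarrow> partial_deriv i (Var j ^ e) = 0"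
  by (induction e) (simp_all add: partial_deriv_mult partial_deriv_Var)

section \<open>The power series behind the sub-Hankel determinant\<close>

text \<open>
  The coefficients \<open>a\<^sub>j\<close> of the series \<open>A(u)\<close>; it is truncated at \<open>u\<^sup>n\<close>, where the variables end.  The
  powers of \<open>x\<^sub>n\<close> make \<open>a\<^sub>j\<close> homogeneous of degree \<open>j\<close>.
\<close>

definition hcoef :: "nat \<Rightarrow> nat \<Rightarrow> 'k::field mpoly" where
  "hcoef n j = (if j = 0 then 1 else if j \<le> n then Var (n - j) * Var n ^ (j - 1) else 0)"

definition hser :: "nat \<Rightarrow> 'k::field mpoly fps" where
  "hser n = Abs_fps (hcoef n)"

text \<open>
  \<open>1/A\<close>; the polynomial ring is not a field, so the inverse is taken of a series with constant term
  \<open>1\<close>.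
\<close>

definition Eser :: "nat \<Rightarrow> 'k::field mpoly fps" where
  "Eser n = fps_left_inverse (hser n) 1"

abbreviation "E n \<equiv> fps_nth (Eser n)"
abbreviation "G n \<equiv> fps_nth (Eser n ^ 2)"

lemma hser_nth [simp]: "fps_nth (hser n) j = hcoef n j"
  by (simp add: hser_def)

lemma hcoef_0 [simp]: "hcoef n 0 = 1"
  by (simp add: hcoef_def)

lemma Eser_mult_hser: "Eser n * hser n = 1"
  unfolding Eser_def by (rule fps_left_inverse) simp

lemma E_0 [simp]: "E n 0 = 1"
  unfolding Eser_def by simp

lemma E_conv: "(\<Sum>j\<le>m. hcoef n j * E n (m - j)) = (if m = 0 then 1 else 0)" (is "?lhs = _")
proof -
  have "?lhs = fps_nth (Eser n * hser n) m"
    by (subst mult.commute) (simp add: fps_mult_nth atLeast0AtMost)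
  then show ?thesis
    by (simp add: Eser_mult_hser)
qed

lemma E_rec:
  assumes "m > 0"
  shows "E n m = - (\<Sum>j=1..m. hcoef n j * E n (m - j))" (is "_ = - ?S")
proof -
  have "E n m + ?S = 0"
    using E_conv[where m = m and n = n] assms
    by (simp add: sum.atLeast_Suc_atMost flip: atLeast0AtMost)
  then show ?thesis
    by (simp only: eq_neg_iff_add_eq_0)
qed

lemma G_conv: "G n m = (\<Sum>j\<le>m. E n j * E n (m - j))"
  by (simp add: power2_eq_square fps_mult_nth atLeast0AtMost)

lemma G_0 [simp]: "G n 0 = 1"
  by (simp add: G_conv)

text \<open>
  The coefficient of \<open>u\<^sup>i\<close> in \<open>u (A G' + 2 A' G) = 0\<close>, which follows from \<open>A E = 1\<close> and \<open>G = E\<^sup>2\<close>.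
\<close>

lemma G_relation: "(\<Sum>j\<le>i. of_nat (i + j) * (hcoef n j * G n (i - j))) = 0"
proof -
  let ?a = "hser n :: 'a mpoly fps" and ?E = "Eser n :: 'a mpoly fps"
  have "fps_deriv (?E * ?a) = 0"
    by (simp add: Eser_mult_hser)
  then have "?E * fps_deriv ?a + fps_deriv ?E * ?a = 0"
    by simp
  then have "2 * ?E * (?E * fps_deriv ?a + fps_deriv ?E * ?a) = 0"
    by simp
  moreover have "fps_deriv (?E\<^sup>2) = 2 * ?E * fps_deriv ?E"
    by (simp add: power2_eq_square)
  ultimately have "?a * fps_deriv (?E\<^sup>2) + 2 * (fps_deriv ?a * ?E\<^sup>2) = 0"
    by (simp add: power2_eq_square algebra_simps)
  then have "fps_X * (?a * fps_deriv (?E\<^sup>2) + 2 * (fps_deriv ?a * ?E\<^sup>2)) = 0"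
    by simp
  then have eq: "?a * (fps_X * fps_deriv (?E\<^sup>2)) + of_nat 2 * ((fps_X * fps_deriv ?a) * ?E\<^sup>2) = 0"
    by (simp add: algebra_simps)
  have X: "fps_nth (fps_X * fps_deriv f) j = of_nat j * fps_nth f j" for f :: "'a mpoly fps" and j
    by (cases j) simp_all
  have "0 = fps_nth (?a * (fps_X * fps_deriv (?E\<^sup>2)) + of_nat 2 * ((fps_X * fps_deriv ?a) * ?E\<^sup>2)) i"
    unfolding eq by simp
  also have "\<dots> = (\<Sum>j\<le>i. hcoef n j * (of_nat (i - j) * G n (i - j)))
      + of_nat 2 * (\<Sum>j\<le>i. of_nat j * hcoef n j * G n (i - j))"
    by (simp only: fps_add_nth fps_mult_nth[of ?a] fps_mult_nth[of "fps_X * fps_deriv ?a"] X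
        fps_mult_of_nat_nth(1) hser_nth atLeast0AtMost)
  also have "\<dots> = (\<Sum>j\<le>i. of_nat (i + j) * (hcoef n j * G n (i - j)))"
    unfolding sum_distrib_left sum.distrib[symmetric]
  proof (intro sum.cong refl)
    fix j assume "j \<in> {..i}"
    then have "i + j = (i - j) + 2 * j" by simp
    then have "(of_nat (i + j) :: 'a mpoly) = of_nat (i - j) + of_nat 2 * of_nat j"
      by (metis of_nat_add of_nat_mult)
    then have "of_nat (i + j) * (x * y) = x * (of_nat (i - j) * y) + of_nat 2 * (of_nat j * x * y)"
      for x y :: "'a mpoly"
      by (simp only: algebra_simps)
    then show "hcoef n j * (of_nat (i - j) * G n (i - j)) + of_nat 2 * (of_nat j * hcoef n j * G n (i - j))
        = of_nat (i + j) * (hcoef n j * (G n (i - j) :: 'a mpoly))"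
      by (rule sym)
  qed
  finally show ?thesis ..
qed

lemma G_rec:
  "of_nat i * G n i = - (\<Sum>j=1..i. of_nat (i + j) * (hcoef n j * G n (i - j)))" (is "_ = - ?S")
proof -
  have "of_nat i * G n i + ?S = 0"
    using G_relation[where i = i and n = n]
    by (simp add: sum.atLeast_Suc_atMost flip: atLeast0AtMost)
  then show ?thesis
    by (simp only: eq_neg_iff_add_eq_0)
qed

text \<open>
  \<open>\<partial>E = - E\<^sup>2 \<partial>A\<close>, and \<open>\<partial>A/\<partial>x\<^bsub>n-k\<^esub> = x\<^sub>n\<^bsup>k-1\<^esup> u\<^sup>k\<close>.  The case \<open>k = 0\<close> is different, because \<open>x\<^sub>n\<close>
  occurs in all \<open>a\<^sub>j\<close>.
\<close>

lemma partial_deriv_E: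
  assumes "1 \<le> k" "k \<le> n"
  shows "partial_deriv (n - k) (E n m) = (if k \<le> m then - (Var n ^ (k - 1) * G n (m - k)) else 0)"
proof -
  define D where "D f = Abs_fps (\<lambda>m. partial_deriv (n - k) (fps_nth f m))" for f :: "'a mpoly fps"
  let ?a = "hser n :: 'a mpoly fps" and ?E = "Eser n :: 'a mpoly fps"
  have D_mult: "D (f * g) = D f * g + f * D g" for f g
    by (rule fps_ext) (simp add: D_def fps_mult_nth partial_deriv_sum partial_deriv_mult sum.distrib)
  have "D 1 = 0"
    by (rule fps_ext) (simp add: D_def)
  then have "D ?E * ?a + ?E * D ?a = 0"
    using D_mult[of ?E ?a] by (simp add: Eser_mult_hser)
  then have "?E * (D ?E * ?a + ?E * D ?a) = 0"
    by simp
  then have "D ?E * (?E * ?a) + ?E\<^sup>2 * D ?a = 0"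
    by (simp add: power2_eq_square algebra_simps)
  then have DE: "D ?E = - (?E\<^sup>2 * D ?a)"
    by (simp add: Eser_mult_hser eq_neg_iff_add_eq_0)
  have Da: "D ?a = fps_const (Var n ^ (k - 1)) * fps_X ^ k"
    using assms by (intro fps_ext)
      (auto simp: D_def hcoef_def partial_deriv_mult partial_deriv_Var partial_deriv_power_other
        fps_X_power_nth)
  have "partial_deriv (n - k) (E n m) = fps_nth (D ?E) m"
    by (simp add: D_def)
  also have "\<dots> = - fps_nth (fps_const (Var n ^ (k - 1)) * (?E\<^sup>2 * fps_X ^ k)) m"
    unfolding DE Da by (simp add: mult_ac)
  also have "\<dots> = - (Var n ^ (k - 1) * fps_nth (?E\<^sup>2 * fps_X ^ k) m)"
    by (simp only: fps_mult_left_const_nth)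
  also have "fps_nth (?E\<^sup>2 * fps_X ^ k) m = (if m < k then 0 else G n (m - k))"
    by (rule fps_X_power_mult_right_nth)
  finally show ?thesis
    by auto
qed

lemma hcoef_homogeneous: "homogeneous j (hcoef n j)"
  using homogeneous_mult[OF homogeneous_Var homogeneous_power[OF homogeneous_Var, of "j - 1"]]
  by (auto simp: hcoef_def)

lemma hcoef_in_polys: "j \<le> m \<Longrightarrow> m \<le> n \<Longrightarrow> hcoef n j \<in> polys {n - m..n}"
  by (auto simp: hcoef_def intro!: polys_mult polys_power)

lemma E_homogeneous: "homogeneous m (E n m)"
proof (induction m rule: less_induct)
  case (less m)
  show ?case
  proof (cases "m = 0")
    case False
    then have m: "m > 0" by simp
    show ?thesis
      unfolding E_rec[OF m]
      by (intro homogeneous_uminus homogeneous_sum homogeneous_mult'[OF hcoef_homogeneous less.IH]) auto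
  qed simp
qed

lemma E_in_polys: "m \<le> n \<Longrightarrow> (E n m :: 'k::field mpoly) \<in> polys {n - m..n}"
proof (induction m rule: less_induct)
  case (less m)
  show ?case
  proof (cases "m = 0")
    case False
    then have m: "m > 0" by simp
    show ?thesis
      unfolding E_rec[OF m]
    proof (intro polys_uminus polys_sum polys_mult)
      fix j assume j: "j \<in> {1..m}"
      then show "(hcoef n j :: 'k mpoly) \<in> polys {n - m..n}"
        using less.prems by (intro hcoef_in_polys) auto
      show "(E n (m - j) :: 'k mpoly) \<in> polys {n - m..n}"
        using j less.prems by (intro polys_monoD[OF less.IH[of "m - j"], of "{n - m..n}"]) auto
    qed
  qed simp
qed

lemma G_homogeneous: "homogeneous m (G n m)"
  unfolding G_conv by (intro homogeneous_sum homogeneous_mult'[OF E_homogeneous E_homogeneous]) auto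

lemma G_in_polys: "m \<le> n \<Longrightarrow> G n m \<in> polys {n - m..n}"
  unfolding G_conv by (intro polys_sum polys_mult polys_monoD[OF E_in_polys]) auto

text \<open>
  In \<open>E\<^sub>m = - (a\<^sub>1 E\<^bsub>m-1\<^esub> + a\<^sub>2 E\<^bsub>m-2\<^esub> + \<dots>)\<close> only \<open>a\<^sub>1 = x\<^bsub>n-1\<^esub>\<close> raises the degree in \<open>x\<^bsub>n-1\<^esub>\<close>.
\<close>

lemma E_degree:
  assumes n: "n \<ge> 2" and "m \<le> n"
  shows "degree (to_poly (n - 1) (E n m :: 'k::field mpoly)) \<le> m \<and>
    coeff (to_poly (n - 1) (E n m :: 'k mpoly)) m = (- 1) ^ m"
  using \<open>m \<le> n\<close>
proof (induction m rule: less_induct)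
  case (less m)
  show ?case
  proof (cases "m = 0")
    case False
    then have m: "m > 0" by simp
    let ?E = "\<lambda>j. to_poly (n - 1) (E n j :: 'k mpoly)"
    have "?E m = - (\<Sum>j=1..m. to_poly (n - 1) (hcoef n j) * ?E (m - j))"
      unfolding E_rec[OF m] by (simp add: to_poly.hom_uminus to_poly.hom_sum to_poly.hom_mult)
    also have "\<dots> = - (to_poly (n - 1) (hcoef n 1) * ?E (m - 1)
        + (\<Sum>j=2..m. to_poly (n - 1) (hcoef n j) * ?E (m - j)))"
      using m by (simp add: sum.atLeast_Suc_atMost numeral_2_eq_2)
    also have "to_poly (n - 1) (hcoef n 1) = [:0, 1:]"
      using n by (simp add: hcoef_def)
    also have "(\<Sum>j=2..m. to_poly (n - 1) (hcoef n j) * ?E (m - j)) = (\<Sum>j=2..m. smult (hcoef n j) (?E (m - j)))"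
    proof (intro sum.cong refl)
      fix j assume "j \<in> {2..m}"
      then have "hcoef n j \<in> polys ({..n} - {n - 1})"
        using less.prems n by (auto simp: hcoef_def intro!: polys_mult polys_power)
      then show "to_poly (n - 1) (hcoef n j) * ?E (m - j) = smult (hcoef n j) (?E (m - j))"
        by (subst to_poly_const) auto
    qed
    finally have eq: "?E m = - (pCons 0 (?E (m - 1)) + (\<Sum>j=2..m. smult (hcoef n j) (?E (m - j))))"
      by simp
    have IH: "degree (?E (m - 1)) \<le> m - 1" "coeff (?E (m - 1)) (m - 1) = (- 1) ^ (m - 1)"
      using less.IH[of "m - 1"] less.prems m by auto
    have "degree (smult (hcoef n j) (?E (m - j))) \<le> m - 1" if "j \<in> {2..m}" for j
      using less.IH[of "m - j"] less.prems that degree_smult_le[of "hcoef n j" "?E (m - j)"] by auto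
    then have d: "degree (\<Sum>j=2..m. smult (hcoef n j) (?E (m - j))) \<le> m - 1"
      by (intro degree_sum_le) auto
    then have c: "coeff (\<Sum>j=2..m. smult (hcoef n j) (?E (m - j))) m = 0"
      using m by (intro coeff_eq_0) auto
    have "degree (pCons 0 (?E (m - 1))) \<le> m"
      using IH m degree_pCons_le[of 0 "?E (m - 1)"] by linarith
    then have "degree (?E m) \<le> m"
      unfolding eq degree_minus using d by (intro degree_add_le) auto
    moreover have "coeff (?E m) m = (- 1) ^ m"
      unfolding eq using c IH m by (cases m) (auto simp: coeff_pCons)
    ultimately show ?thesis by simp
  qed simp
qed

lemma G_degree:
  assumes n: "n \<ge> 2" and "m \<le> n"
  shows "degree (to_poly (n - 1) (G n m :: 'k::field mpoly)) \<le> m"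
    "coeff (to_poly (n - 1) (G n m :: 'k mpoly)) m = of_nat (m + 1) * (- 1) ^ m"
proof -
  have eq: "to_poly (n - 1) (G n m :: 'k mpoly) = (\<Sum>j\<le>m. to_poly (n - 1) (E n j) * to_poly (n - 1) (E n (m - j)))"
    by (simp add: G_conv to_poly.hom_sum to_poly.hom_mult)
  have E: "degree (to_poly (n - 1) (E n j :: 'k mpoly)) \<le> j"
    "coeff (to_poly (n - 1) (E n j :: 'k mpoly)) j = (- 1) ^ j" if "j \<le> m" for j
    using E_degree[OF n, of j] that assms by auto
  show "degree (to_poly (n - 1) (G n m :: 'k mpoly)) \<le> m"
    unfolding eq
  proof (rule degree_sum_le)
    fix j assume "j \<in> {..m}"
    then have "j \<le> m" by simp
    then show "degree (to_poly (n - 1) (E n j :: 'k mpoly) * to_poly (n - 1) (E n (m - j))) \<le> m"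
      using degree_mult_le[of "to_poly (n - 1) (E n j :: 'k mpoly)" "to_poly (n - 1) (E n (m - j))"]
        E(1)[of j] E(1)[of "m - j"] by linarith
  qed simp
  have "coeff (to_poly (n - 1) (G n m :: 'k mpoly)) m = (\<Sum>j\<le>m. (- 1) ^ m)"
    unfolding eq coeff_sum
  proof (intro sum.cong refl)
    fix j assume "j \<in> {..m}"
    then show "coeff (to_poly (n - 1) (E n j :: 'k mpoly) * to_poly (n - 1) (E n (m - j))) m = (- 1) ^ m"
      using coeff_mult_degree_le[OF E(1)[of j] E(1)[of "m - j"]] E(2)[of j] E(2)[of "m - j"]
      by (simp flip: power_add)
  qed
  then show "coeff (to_poly (n - 1) (G n m :: 'k mpoly)) m = of_nat (m + 1) * (- 1) ^ m"
    by simp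
qed

text \<open>
  Setting a variable to \<open>0\<close>, which is reduction modulo that variable.
\<close>

definition drop_var :: "nat \<Rightarrow> 'k::field mpoly \<Rightarrow> 'k mpoly" where
  "drop_var v p = poly (to_poly v p) 0"

interpretation drop_var: comm_ring_hom "drop_var v" for v
  unfolding drop_var_def by (rule comm_ring_hom_comp[OF comm_ring_hom_poly to_poly.comm_ring_hom_axioms])

lemma drop_var_Var: "drop_var v (Var i) = (if i = v then 0 else Var i)"
  by (simp add: drop_var_def to_poly_Var)

lemma drop_var_in_polys: "p \<in> polys V \<Longrightarrow> drop_var v p \<in> polys (V - {v})"
  by (simp add: drop_var_def poly_0_coeff_0 coeff_to_poly_in_polys)

lemma drop_var_ident: "p \<in> polys V \<Longrightarrow> v \<notin> V \<Longrightarrow> drop_var v p = p"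
  by (simp add: drop_var_def to_poly_const)

lemma drop_var_remainder:
  assumes "p \<in> polys V"
  shows "\<exists>r\<in>polys V. p - Var v * r = drop_var v p"
proof -
  obtain a s where s: "to_poly v p = pCons a s" by (cases "to_poly v p")
  have "p = a + Var v * poly s (Var v)" using poly_to_poly[of v p] s by simp
  moreover have "drop_var v p = a" using s by (simp add: drop_var_def)
  ultimately have "p - Var v * poly s (Var v) = drop_var v p"
    by (metis add_diff_cancel_right')
  moreover have "poly s (Var v) \<in> polys V"
  proof (cases "v \<in> V")
    case True
    have "coeff s e \<in> polys V" for e
      using coeff_to_poly_in_polys[OF assms, of v "Suc e"] s polys_mono[of "V - {v}" V] by auto
    then show ?thesis
      using True by (intro poly_in_polys) auto
  next
    case False
    then have "s = 0" using assms s to_poly_const by fastforce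
    then show ?thesis by simp
  qed
  ultimately show ?thesis by blast
qed

text \<open>
  Modulo \<open>x\<^sub>n\<close> the series is \<open>A = 1 + x\<^bsub>n-1\<^esub> u\<close>, so its inverse is a geometric series.
\<close>

lemma drop_var_E:
  assumes n: "n \<ge> 2"
  defines "t \<equiv> - Var (n - 1) :: 'k::field mpoly"
  shows "drop_var n (E n m) = t ^ m"
proof (induction m rule: less_induct)
  case (less m)
  show ?case
  proof (cases "m = 0")
    case False
    then have m: "m > 0" by simp
    have "drop_var n (E n m :: 'k mpoly) = - (\<Sum>j=1..m. drop_var n (hcoef n j) * drop_var n (E n (m - j)))"
      unfolding E_rec[OF m] by (simp add: drop_var.hom_uminus drop_var.hom_sum drop_var.hom_mult)
    also have "\<dots> = - (\<Sum>j=1..m. if j = 1 then - (t * t ^ (m - 1)) else 0)"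
    proof (intro arg_cong[of _ _ uminus] sum.cong refl)
      fix j assume j: "j \<in> {1..m}"
      have "drop_var n (hcoef n j) = (if j = 1 then - t else 0)"
        using j n by (auto simp: hcoef_def drop_var_Var drop_var.hom_mult drop_var.hom_power t_def)
      then show "drop_var n (hcoef n j) * drop_var n (E n (m - j)) = (if j = 1 then - (t * t ^ (m - 1)) else 0)"
        using less.IH[of "m - j"] j by auto
    qed
    also have "\<dots> = t * t ^ (m - 1)"
      using m by simp
    finally show ?thesis
      using m by (simp add: power_eq_if)
  qed simp
qed

lemma drop_var_G:
  assumes n: "n \<ge> 2" shows "drop_var n (G n m :: 'k::field mpoly) = of_nat (m + 1) * (- Var (n - 1)) ^ m"
proof -
  have "drop_var n (G n m :: 'k mpoly) = (\<Sum>j\<le>m. drop_var n (E n j) * drop_var n (E n (m - j)))"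
    by (simp only: G_conv drop_var.hom_sum drop_var.hom_mult)
  also have "\<dots> = (\<Sum>j\<le>m. (- Var (n - 1)) ^ m)"
  proof (rule sum.cong)
    fix j assume "j \<in> {..m}"
    then have "j + (m - j) = m" by simp
    then show "drop_var n (E n j) * drop_var n (E n (m - j)) = (- Var (n - 1) :: 'k mpoly) ^ m"
      unfolding drop_var_E[OF n] by (metis power_add)
  qed (rule refl)
  finally show ?thesis by (simp only: sum_constant card_atMost Suc_eq_plus1)
qed

section \<open>The determinant and its partial derivatives\<close>

text \<open>
  Reversing the columns by a permutation matrix \<open>K\<close> with \<open>K\<^sup>2 = 1\<close> makes the matrix triangular.
\<close>

lemma det_anti_triangular:
  fixes A :: "'a::idom mat"
  assumes A: "A \<in> carrier_mat m m"
    and zero: "\<And>i j. i < m \<Longrightarrow> j < m \<Longrightarrow> i + j \<ge> m \<Longrightarrow> A $$ (i, j) = 0"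
    and diag: "\<And>i j. i < m \<Longrightarrow> j < m \<Longrightarrow> i + j = m - 1 \<Longrightarrow> A $$ (i, j) = z"
  obtains c where "c = 1 \<or> c = - 1" "Determinant.det A = c * z ^ m"
proof -
  define K where "K = mat m m (\<lambda>(i, j). if i + j = m - 1 then 1 else 0 :: 'a)"
  have K: "K \<in> carrier_mat m m" by (simp add: K_def)
  have col: "(\<Sum>k\<in>{0..<m}. f k * K $$ (k, j)) = f (m - 1 - j)" if "j < m" for f :: "nat \<Rightarrow> 'a" and j
  proof -
    have "(\<Sum>k\<in>{0..<m}. f k * K $$ (k, j)) = (\<Sum>k\<in>{0..<m}. if k = m - 1 - j then f k else 0)"
      using that by (intro sum.cong refl) (auto simp: K_def)
    then show ?thesis using that by simp
  qed
  have AK: "(A * K) $$ (i, j) = A $$ (i, m - 1 - j)" if "i < m" "j < m" for i j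
    using that A K by (simp add: scalar_prod_def col)
  have KK: "K * K = 1\<^sub>m m"
  proof (rule eq_matI)
    fix i j assume ij: "i < dim_row (1\<^sub>m m)" "j < dim_col (1\<^sub>m m)"
    have "(K * K) $$ (i, j) = K $$ (i, m - 1 - j)"
      using ij K by (simp add: scalar_prod_def col)
    then show "(K * K) $$ (i, j) = 1\<^sub>m m $$ (i, j)"
      using ij by (auto simp: K_def)
  qed (use K in auto)
  have "Determinant.det K * Determinant.det K = 1"
    using det_mult[OF K K] KK by simp
  then have c: "Determinant.det K = 1 \<or> Determinant.det K = - 1"
    by (metis mult_1 square_eq_iff)
  have tri: "upper_triangular (A * K)"
  proof
    fix i j assume "i < dim_row (A * K)" "j < i"
    then have "i < m" "j < m" "i + (m - 1 - j) \<ge> m" "m - 1 - j < m"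
      using A by auto
    then show "(A * K) $$ (i, j) = 0"
      using AK[of i j] zero[of i "m - 1 - j"] by simp
  qed
  have "Determinant.det (A * K) = prod_list (diag_mat (A * K))"
    using A K by (intro det_upper_triangular[OF tri]) auto
  also have "\<dots> = (\<Prod>i\<in>{0..<m}. (A * K) $$ (i, i))"
    using A by (simp add: prod_list_diag_prod)
  also have "\<dots> = (\<Prod>i\<in>{0..<m}. z)"
  proof (intro prod.cong refl)
    fix i assume "i \<in> {0..<m}"
    then show "(A * K) $$ (i, i) = z"
      using AK[of i i] diag[of i "m - 1 - i"] by simp
  qed
  also have "\<dots> = z ^ m"
    by simp
  finally have "Determinant.det A * Determinant.det K = z ^ m"
    using det_mult[OF A K] by simp
  then have "Determinant.det A = Determinant.det K * z ^ m"
    using \<open>Determinant.det K * Determinant.det K = 1\<close> by (metis mult.commute mult.left_commute mult_1)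
  then show ?thesis using c that by blast
qed

text \<open>
  Multiply the matrix from the right by \<open>C\<close>, the identity matrix with first column replaced by
  \<open>x\<^sub>n\<^bsup>n-1-r\<^esup> E\<^sub>r\<close>.  Up to a power of \<open>x\<^sub>n\<close>, entry \<open>i\<close> of the new first column is the coefficient of
  \<open>u\<^bsup>n-i\<^esup>\<close> in \<open>A E = 1\<close>, and so it vanishes for \<open>i > 0\<close>; for \<open>i = 0\<close> the term \<open>a\<^sub>0 E\<^sub>n\<close> is missing.
  The complementary minor is anti-triangular with entries \<open>x\<^sub>n\<close> on its antidiagonal.
\<close>

lemma sub_hankel_det_eq:
  assumes n: "n \<ge> 1"
  obtains c :: "'k::field mpoly" where "c = 1 \<or> c = - 1" "sub_hankel_det n = c * E n n"
proof -
  let ?z = "Var n :: 'k mpoly"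
  define H :: "'k mpoly mat" where "H = sub_hankel n"
  define C where "C = mat n n (\<lambda>(r, s). if s = 0 then ?z ^ (n - 1 - r) * E n r else if r = s then 1 else 0)"
  have H: "H \<in> carrier_mat n n" and C: "C \<in> carrier_mat n n"
    by (simp_all add: H_def sub_hankel_def C_def)
  have H_nth: "H $$ (i, j) = (if i + j \<le> n then Var (i + j) else 0)" if "i < n" "j < n" for i j
    using that by (simp add: H_def sub_hankel_def)
  have "Determinant.det C = prod_list (diag_mat C)"
    using C by (intro det_lower_triangular[of n]) (auto simp: C_def)
  also have "\<dots> = (\<Prod>i\<in>{0..<n}. C $$ (i, i))"
    using C by (simp add: prod_list_diag_prod)
  also have "\<dots> = (\<Prod>i\<in>{0..<n}. if i = 0 then ?z ^ (n - 1) else 1)"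
    by (intro prod.cong refl) (auto simp: C_def)
  also have "\<dots> = ?z ^ (n - 1)"
    using n by simp
  finally have detC: "Determinant.det C = ?z ^ (n - 1)" .
  have shift: "Var (n - j) * ?z ^ (n - 1 - r) = ?z ^ (n - s) * hcoef n j"
    if "j \<le> s" "s \<le> n" "r = s - j" "r < n" for j s r
  proof (cases "j = 0")
    case True
    then have "n - s = Suc (n - 1 - r)" using that by simp
    then show ?thesis using True by (simp add: hcoef_def)
  next
    case False
    then have "n - 1 - r = (n - s) + (j - 1)" using that by simp
    then show ?thesis using False that by (simp only: hcoef_def power_add) (simp add: mult_ac)
  qed
  have HC0: "(H * C) $$ (i, 0) = (if i = 0 then - E n n else 0)" if i: "i < n" for i
  proof -
    have "(H * C) $$ (i, 0) = (\<Sum>r\<in>{0..<n}. H $$ (i, r) * C $$ (r, 0))"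
      using i n H C by (simp add: scalar_prod_def)
    also have "\<dots> = (\<Sum>r\<in>{0..<n}. if i + r \<le> n then Var (i + r) * (?z ^ (n - 1 - r) * E n r) else 0)"
      using i n by (intro sum.cong refl) (simp add: H_nth C_def)
    also have "\<dots> = (\<Sum>r\<in>{r. r < n \<and> i + r \<le> n}. Var (i + r) * (?z ^ (n - 1 - r) * E n r))"
      by (rule sum.mono_neutral_cong_right) auto
    also have "\<dots> = (\<Sum>j\<in>{j. j \<le> n - i \<and> n - i - j < n}. ?z ^ i * (hcoef n j * E n (n - i - j)))"
    proof (rule sum.reindex_bij_witness[of _ "\<lambda>j. n - i - j" "\<lambda>r. n - i - r"])
      fix r assume r: "r \<in> {r. r < n \<and> i + r \<le> n}"
      then show "n - i - (n - i - r) = r" "n - i - r \<in> {j. j \<le> n - i \<and> n - i - j < n}"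
        by auto
      have "n - (n - i - r) = i + r" using r by auto
      then have "Var (i + r) * ?z ^ (n - 1 - r) = ?z ^ i * hcoef n (n - i - r)"
        using shift[of "n - i - r" "n - i" r] r i by auto
      then show "?z ^ i * (hcoef n (n - i - r) * E n (n - i - (n - i - r))) = Var (i + r) * (?z ^ (n - 1 - r) * E n r)"
        using r by (simp flip: mult.assoc)
    qed (use i in auto)
    also have "\<dots> = (if i = 0 then - E n n else 0)"
    proof (cases "i = 0")
      case True
      have "{j. j \<le> n \<and> n - j < n} = {1..n}" using n by auto
      then show ?thesis using True n by (simp add: E_rec[of n n])
    next
      case False
      then have "{j. j \<le> n - i \<and> n - i - j < n} = {..n - i}" using n by auto
      then have "(\<Sum>j\<in>{j. j \<le> n - i \<and> n - i - j < n}. ?z ^ i * (hcoef n j * E n (n - i - j)))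
          = ?z ^ i * (\<Sum>j\<le>n - i. hcoef n j * E n (n - i - j))"
        by (simp add: sum_distrib_left)
      then show ?thesis using False i by (simp add: E_conv del: diff_diff_left)
    qed
    finally show ?thesis .
  qed
  define M where "M = mat_delete (H * C) 0 0"
  have M: "M \<in> carrier_mat (n - 1) (n - 1)"
    using H C by (auto simp: M_def mat_delete_def)
  have M_nth: "M $$ (i, j) = (if i + j + 2 \<le> n then Var (i + j + 2) else 0)" if "i < n - 1" "j < n - 1" for i j
  proof -
    have "M $$ (i, j) = (H * C) $$ (Suc i, Suc j)"
      using that H C by (simp add: M_def mat_delete_def)
    also have "\<dots> = (\<Sum>r\<in>{0..<n}. H $$ (Suc i, r) * C $$ (r, Suc j))"
      using that H C by (simp add: scalar_prod_def)
    also have "\<dots> = (\<Sum>r\<in>{0..<n}. if r = Suc j then H $$ (Suc i, r) else 0)"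
      using that by (intro sum.cong refl) (simp add: C_def)
    finally show ?thesis using that by (simp add: H_nth)
  qed
  obtain c where c: "c = 1 \<or> c = - 1" "Determinant.det M = c * ?z ^ (n - 1)"
  proof (rule det_anti_triangular[OF M, of ?z])
    fix i j assume "i < n - 1" "j < n - 1" "i + j \<ge> n - 1"
    then show "M $$ (i, j) = 0" by (subst M_nth) auto
  next
    fix i j assume "i < n - 1" "j < n - 1" "i + j = n - 1 - 1"
    moreover from this have "i + j + 2 = n" by simp
    ultimately show "M $$ (i, j) = ?z" by (subst M_nth) auto
  qed
  have "Determinant.det (H * C) = (\<Sum>i<n. (H * C) $$ (i, 0) * cofactor (H * C) i 0)"
    using H C n by (intro laplace_expansion_column) auto
  also have "\<dots> = (\<Sum>i<n. if i = 0 then - E n n * cofactor (H * C) 0 0 else 0)"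
    by (intro sum.cong refl) (simp add: HC0)
  also have "\<dots> = - E n n * Determinant.det M"
    using n by (simp add: cofactor_def M_def)
  finally have "Determinant.det H * ?z ^ (n - 1) = - E n n * (c * ?z ^ (n - 1))"
    using det_mult[OF H C] detC c by simp
  then have "Determinant.det H * ?z ^ (n - 1) = (- c * E n n) * ?z ^ (n - 1)"
    by (simp only: mult_ac mult_minus_left mult_minus_right)
  then have "Determinant.det H = - c * E n n"
    by (subst (asm) mult_right_cancel) simp_all
  then show ?thesis
    using c(1) that[of "- c"] by (auto simp: sub_hankel_det_def H_def)
qed

lemma partial_deriv_sub_hankel_det:
  assumes n: "n \<ge> 1"
  obtains c :: "'k::field mpoly" where "c = 1 \<or> c = - 1"
    "\<And>i. i < n \<Longrightarrow> partial_deriv i (sub_hankel_det n) = c * (Var n ^ (n - 1 - i) * G n i)"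
proof -
  obtain c :: "'k mpoly" where c: "c = 1 \<or> c = - 1" "sub_hankel_det n = c * E n n"
    using sub_hankel_det_eq[OF n] by blast
  have "partial_deriv i (sub_hankel_det n) = - c * (Var n ^ (n - 1 - i) * G n i)" if i: "i < n" for i
  proof -
    have "partial_deriv i (E n n :: 'k mpoly) = - (Var n ^ (n - 1 - i) * G n i)"
      using partial_deriv_E[of "n - i" n n, where 'a = 'k] i by (simp add: diff_commute)
    then show ?thesis
      using c by (auto simp: partial_deriv_uminus)
  qed
  then show ?thesis
    using c(1) that[of "- c"] by auto
qed

section \<open>The forms and the inverse map\<close>

lemma proportional_imp_same_map:
  fixes hs ids :: "'k::field mpoly list"
  assumes len: "length hs = length ids" and u: "u \<noteq> 0"
    and eq: "\<And>i. i < length hs \<Longrightarrow> u * hs ! i = v * ids ! i"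
  shows "same_map hs ids"
  unfolding same_map_def
proof (intro conjI allI impI len)
  fix i j assume ij: "i < length hs" "j < length hs"
  have "u * (hs ! i * ids ! j) = u * (hs ! j * ids ! i)"
  proof -
    have "u * (hs ! i * ids ! j) = (v * ids ! i) * ids ! j"
      by (simp only: eq[OF ij(1), symmetric] mult.assoc)
    also have "\<dots> = (v * ids ! j) * ids ! i"
      by (simp only: mult_ac)
    also have "\<dots> = u * (hs ! j * ids ! i)"
      by (simp only: eq[OF ij(2), symmetric] mult.assoc)
    finally show ?thesis .
  qed
  then show "hs ! i * ids ! j = hs ! j * ids ! i"
    using u by simp
qed

text \<open>
  The sign \<open>c\<close> is the one relating the determinant to \<open>E\<^sub>n\<close>.  The condition on the characteristic
  makes \<open>1, \<dots>, n - 1\<close> invertible, and \<open>2\<close> is among them.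
\<close>

locale sub_hankel_map =
  fixes n q :: nat and c :: "'k::field mpoly"
  assumes n3: "n \<ge> 3" and q1: "q \<ge> 1" and char: "CHAR('k) = 0 \<or> CHAR('k) \<ge> n"
    and c: "c = 1 \<or> c = - 1"
begin

(* Indices such as n - 1 are to stay in this form instead of becoming n - Suc 0. *)
declare One_nat_def [simp del]

lemma of_nat_neq_0: "1 \<le> i \<Longrightarrow> i < n \<Longrightarrow> (of_nat i :: 'k) \<noteq> 0"
proof
  assume i: "1 \<le> i" "i < n" and "(of_nat i :: 'k) = 0"
  then have "CHAR('k) dvd i" by (simp only: of_nat_eq_0_iff_char_dvd)
  then show False using char i dvd_imp_le[of "CHAR('k)" i] by auto
qed

lemma of_nat_mpoly_neq_0: "1 \<le> i \<Longrightarrow> i < n \<Longrightarrow> (of_nat i :: 'k mpoly) \<noteq> 0"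
  using of_nat_neq_0[of i] by (simp flip: Const_of_nat)

lemma two_neq_0: "(2 :: 'k) \<noteq> 0"
  using of_nat_neq_0[of 2] n3 by simp

lemma two_mpoly_neq_0: "(2 :: 'k mpoly) \<noteq> 0"
  using of_nat_mpoly_neq_0[of 2] n3 by simp

lemma c_mult_self: "c * c = 1" and c_neq_0: "c \<noteq> 0"
  using c by auto

lemma c_polys: "c \<in> polys V"
  using c by (auto intro: polys_uminus)

lemma c_homogeneous: "homogeneous 0 c"
  using c by (auto intro: homogeneous_uminus)

lemma subst_c: "subst s c = c"
  using c by (auto simp: subst.hom_uminus)

lemma minus_one_power_Const: "(- 1 :: 'k mpoly) ^ i = Const ((- 1) ^ i)"
  by (induction i) (auto simp: Const_mult Const_uminus)

lemma of_nat_n: "(of_nat n :: 'k mpoly) = of_nat (n - 1) + 1"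
  using n3 by (metis Suc_diff_1 less_le_trans of_nat_Suc add.commute zero_less_numeral)

definition form :: "nat \<Rightarrow> 'k mpoly" where
  "form i = (if i < n - 1 then c * (Var n ^ (n - 2 - i + q) * G n i)
    else c * (Var n ^ (q - 1) * G n (n - 1) + Var (n - 1) ^ q * G n (n - 2)))"

lemma form_last: "form (n - 1) = c * (Var n ^ (q - 1) * G n (n - 1) + Var (n - 1) ^ q * G n (n - 2))"
  by (simp add: form_def)

lemma form_0: "form 0 = c * Var n ^ (n - 2 + q)"
  using n3 by (simp add: form_def)

lemma form_0_neq_0: "form 0 \<noteq> 0"
  by (simp add: form_0 c_neq_0)

lemma G_polys: "i < n \<Longrightarrow> (G n i :: 'k mpoly) \<in> polys {1..n}"
  by (rule polys_monoD[OF G_in_polys]) auto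

lemma form_polys: "i < n \<Longrightarrow> form i \<in> polys {1..n}"
  using n3 unfolding form_def by (auto intro!: polys_mult polys_add polys_power c_polys G_polys)

lemma form_homogeneous: "homogeneous (n - 2 + q) (form i)"
proof -
  have pow: "homogeneous e (Var v ^ e :: 'k mpoly)" for v e
    using homogeneous_power[OF homogeneous_Var, of e v] by simp
  show ?thesis
    unfolding form_def using n3 q1
    by (auto intro!: homogeneous_mult'[OF c_homogeneous] homogeneous_add homogeneous_mult'[OF pow G_homogeneous])
qed

text \<open>
  Here and below the variables are the coordinates of the target, \<open>w\<^sub>k\<close> for \<open>f\<^bsub>k-1\<^esub>\<close>.  On the image,
  \<open>B\<^sub>k = w\<^sub>1\<^bsup>k-1\<^esup> w\<^bsub>k+1\<^esub>\<close> is \<open>G\<^sub>k\<close> up to a scaling by a \<open>k\<close>-th power (\<open>fwd_B\<close>).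
\<close>

definition B :: "nat \<Rightarrow> 'k mpoly" where
  "B k = (if k = 0 then 1 else Var 1 ^ (k - 1) * Var (k + 1))"

text \<open>
  \<open>P\<^sub>i\<close> plays the role of \<open>a\<^sub>i\<close>: it is obtained from \<open>\<Sum>\<^sub>j (i + j) a\<^sub>j G\<^bsub>i-j\<^esub> = 0\<close> by solving for the
  term with \<open>j = i\<close>.
\<close>

fun P :: "nat \<Rightarrow> 'k mpoly" where
  "P i = (if i = 0 then 1 else
     - (Const (inverse (of_nat (2 * i))) * (\<Sum>j<i. of_nat (i + j) * (P j * B (i - j)))))"

declare P.simps [simp del]

lemma P_0 [simp]: "P 0 = 1" by (simp add: P.simps)
lemma B_0 [simp]: "B 0 = 1" by (simp add: B_def)

text \<open>
  The counterpart of \<open>B\<close> for the index \<open>n - 1\<close>.  The last form is not a multiple of \<open>G\<^bsub>n-1\<^esub>\<close>, so the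
  summand \<open>y\<^sup>q G\<^bsub>n-2\<^esub>\<close> has to be removed, with \<open>P\<^sub>1\<close> for \<open>y = a\<^sub>1\<close>.  This costs a factor \<open>w\<^sub>1\<^sup>q\<close>, which
  reappears in \<open>P_last\<close> to make the sum homogeneous.
\<close>

definition B_last :: "'k mpoly" where
  "B_last = Var 1 ^ (n - 2 + q) * Var n - Var 1 ^ (n - 2) * P 1 ^ q * Var (n - 1)"

definition P_last :: "'k mpoly" where
  "P_last = - (Const (inverse (of_nat (2 * (n - 1)))) * (of_nat (n - 1) * B_last
      + Var 1 ^ q * (\<Sum>j\<in>{1..<n - 1}. of_nat (n - 1 + j) * (P j * B (n - 1 - j)))))"

text \<open>
  \<open>a\<^sub>i = x\<^bsub>n-i\<^esub> z\<^bsup>i-1\<^esup>\<close> determines \<open>x\<^bsub>n-i\<^esub>\<close>; the powers of \<open>w\<^sub>1\<close> bring all coordinates to the same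
  degree \<open>n - 1 + q\<close>.
\<close>

definition inv_form :: "nat \<Rightarrow> 'k mpoly" where
  "inv_form k = (if k = 1 then P_last else Var 1 ^ (n - 1 + q - (n - k)) * P (n - k))"

lemma cancel_inverse_of_nat: "1 \<le> i \<Longrightarrow> i < n \<Longrightarrow>
    of_nat (2 * i) * (Const (inverse (of_nat (2 * i))) * p) = (p :: 'k mpoly)"
  using of_nat_neq_0[of i] two_neq_0
  by (simp add: mult.assoc[symmetric] flip: Const_of_nat Const_mult del: of_nat_mult)
    (simp add: field_simps)

lemma P_relation:
  assumes i: "1 \<le> i" "i < n"
  shows "of_nat (2 * i) * P i = - (\<Sum>j<i. of_nat (i + j) * (P j * B (i - j)))"
proof -
  have "i \<noteq> 0" using i by simp
  then show ?thesis
    by (subst P.simps) (simp only: mult_minus_right cancel_inverse_of_nat[OF i] if_False)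
qed

lemma P_last_relation:
  "of_nat (2 * (n - 1)) * P_last = - (of_nat (n - 1) * B_last
      + Var 1 ^ q * (\<Sum>j\<in>{1..<n - 1}. of_nat (n - 1 + j) * (P j * B (n - 1 - j))))"
  unfolding P_last_def using n3 by (simp only: mult_minus_right cancel_inverse_of_nat)

lemma B_homogeneous: "homogeneous k (B k)"
  using homogeneous_mult[OF homogeneous_power[OF homogeneous_Var, of "k - 1" 1] homogeneous_Var[of "k + 1"]]
  by (auto simp: B_def)

lemma P_homogeneous: "homogeneous i (P i)"
proof (induction i rule: less_induct)
  case (less i)
  then show ?case
    by (subst P.simps)
      (auto intro!: homogeneous_uminus homogeneous_Const_mult homogeneous_sum homogeneous_of_nat_mult
        homogeneous_mult'[OF _ B_homogeneous] simp del: of_nat_add)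
qed

lemma B_polys: "k < n \<Longrightarrow> B k \<in> polys {1..n}"
  by (auto simp: B_def intro!: polys_mult polys_power)

lemma of_nat_polys [simp]: "(of_nat m :: 'k mpoly) \<in> polys V"
  by (metis Const_of_nat polys_Const)

lemma P_polys: "i < n \<Longrightarrow> P i \<in> polys {1..n}"
proof (induction i rule: less_induct)
  case (less i)
  then show ?case
    by (subst P.simps) (auto intro!: polys_uminus polys_mult polys_sum B_polys simp del: of_nat_add)
qed

lemma Var_power_homogeneous: "homogeneous e (Var v ^ e :: 'k mpoly)"
  using homogeneous_power[OF homogeneous_Var, of e v] by simp

lemma B_last_homogeneous: "homogeneous (n - 1 + q) B_last"
proof -
  have "homogeneous (q * 1) (P 1 ^ q)"
    by (intro homogeneous_power P_homogeneous)
  then have "homogeneous (n - 2 + q) (Var 1 ^ (n - 2) * P 1 ^ q)"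
    by (intro homogeneous_mult'[OF Var_power_homogeneous]) auto
  then show ?thesis
    unfolding B_last_def using n3
    by (intro homogeneous_diff homogeneous_mult'[OF Var_power_homogeneous homogeneous_Var]
        homogeneous_mult'[OF _ homogeneous_Var]) auto
qed

lemma B_last_polys: "B_last \<in> polys {1..n}"
  unfolding B_last_def using n3 by (auto intro!: polys_diff polys_mult polys_power P_polys)

lemma P_last_homogeneous: "homogeneous (n - 1 + q) P_last"
proof -
  have "homogeneous (n - 1) (of_nat (n - 1 + j) * (P j * B (n - 1 - j)))" if "j \<in> {1..<n - 1}" for j
    using that by (intro homogeneous_of_nat_mult homogeneous_mult'[OF P_homogeneous B_homogeneous]) auto
  then have "homogeneous (n - 1) (\<Sum>j\<in>{1..<n - 1}. of_nat (n - 1 + j) * (P j * B (n - 1 - j)))"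
    by (rule homogeneous_sum)
  then show ?thesis
    unfolding P_last_def
    by (intro homogeneous_uminus homogeneous_Const_mult homogeneous_add homogeneous_of_nat_mult
        B_last_homogeneous homogeneous_mult'[OF Var_power_homogeneous]) auto
qed

lemma inv_form_homogeneous: "k \<le> n \<Longrightarrow> 1 \<le> k \<Longrightarrow> homogeneous (n - 1 + q) (inv_form k)"
  unfolding inv_form_def using n3
  using P_last_homogeneous
  by (auto intro!: homogeneous_mult'[OF Var_power_homogeneous P_homogeneous])

lemma inv_form_polys: "k \<le> n \<Longrightarrow> 1 \<le> k \<Longrightarrow> inv_form k \<in> polys {1..n}"
  unfolding inv_form_def P_last_def using n3
  by (auto intro!: polys_uminus polys_mult polys_sum polys_add polys_power P_polys B_polys B_last_polys simp del: of_nat_add)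

lemma inv_form_n: "inv_form n = Var 1 ^ (n - 1 + q)"
  using n3 by (simp add: inv_form_def)

subsection \<open>The inverse after the map\<close>

text \<open>
  Substitution of the forms into a polynomial on the target.  Each lemma on it says that some
  polynomial pulls back to the quantity that it stands for, up to powers of \<open>z\<close> and \<open>f\<^sub>0\<close>.
\<close>

definition fwd :: "'k mpoly \<Rightarrow> 'k mpoly" where
  "fwd = subst (\<lambda>j. form (j - 1))"

definition bwd :: "'k mpoly \<Rightarrow> 'k mpoly" where
  "bwd = subst inv_form"

sublocale fwd: comm_ring_hom fwd unfolding fwd_def by unfold_locales
sublocale bwd: comm_ring_hom bwd unfolding bwd_def by unfold_locales

lemma fwd_Var: "fwd (Var j) = form (j - 1)" by (simp add: fwd_def)
lemma bwd_Var: "bwd (Var j) = inv_form j" by (simp add: bwd_def)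

lemma fwd_B:
  assumes k: "k \<le> n - 2"
  shows "Var n ^ k * fwd (B k) = form 0 ^ k * G n k"
proof (cases "k = 0")
  case False
  have form_k: "Var n ^ k * form k = form 0 * G n k"
  proof -
    have "k + (n - 2 - k + q) = n - 2 + q" using k by simp
    then have pw: "Var n ^ k * Var n ^ (n - 2 - k + q) = (Var n ^ (n - 2 + q) :: 'k mpoly)"
      by (metis power_add)
    have fk: "form k = c * (Var n ^ (n - 2 - k + q) * G n k)"
      using k n3 unfolding form_def by (subst if_P) auto
    have "Var n ^ k * form k = c * (Var n ^ k * Var n ^ (n - 2 - k + q)) * G n k"
      unfolding fk by (simp only: mult_ac)
    then show ?thesis
      unfolding pw form_0 .
  qed
  have "Var n ^ k * fwd (B k) = form 0 ^ (k - 1) * (Var n ^ k * form k)"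
    using False by (simp add: B_def fwd.hom_mult fwd.hom_power fwd_Var mult_ac)
  also have "\<dots> = form 0 ^ (k - 1) * form 0 * G n k"
    by (simp add: form_k mult.assoc)
  also have "form 0 ^ (k - 1) * form 0 = form 0 ^ k"
    using False by (metis One_nat_def Suc_pred gr0I power_Suc2)
  finally show ?thesis .
qed simp

lemma G_relation_upper:
  assumes "i \<ge> 1"
  shows "(\<Sum>j<i. of_nat (i + j) * (hcoef n j * G n (i - j))) = - (of_nat (2 * i) * (hcoef n i :: 'k mpoly))"
proof -
  have "(\<Sum>j\<le>i. of_nat (i + j) * (hcoef n j * G n (i - j)))
    = (\<Sum>j<i. of_nat (i + j) * (hcoef n j * G n (i - j))) + of_nat (2 * i) * (hcoef n i :: 'k mpoly)"
    by (simp add: lessThan_Suc_atMost[symmetric] mult_2 del: of_nat_add of_nat_mult)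
  then show ?thesis
    using G_relation[where i = i and n = n and 'a = 'k] by (simp only: eq_neg_iff_add_eq_0)
qed

lemma fwd_P:
  assumes "i \<le> n - 2"
  shows "Var n ^ i * fwd (P i) = form 0 ^ i * hcoef n i"
  using assms
proof (induction i rule: less_induct)
  case (less i)
  show ?case
  proof (cases "i = 0")
    case False
    then have i: "1 \<le> i" "i < n" using less.prems n3 by auto
    have "of_nat (2 * i) * (Var n ^ i * fwd (P i)) = Var n ^ i * fwd (of_nat (2 * i) * P i)"
      by (simp only: fwd.hom_mult fwd.hom_of_nat mult_ac)
    also have "\<dots> = - (\<Sum>j<i. Var n ^ i * (of_nat (i + j) * (fwd (P j) * fwd (B (i - j)))))"
      by (simp only: P_relation[OF i] fwd.hom_mult fwd.hom_of_nat fwd.hom_uminus fwd.hom_sum sum_distrib_left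
          mult_minus_right)
    also have "\<dots> = - (\<Sum>j<i. form 0 ^ i * (of_nat (i + j) * (hcoef n j * G n (i - j))))"
    proof (intro arg_cong[of _ _ uminus] sum.cong refl)
      fix j assume "j \<in> {..<i}"
      then have j: "j < i" by simp
      have split: "x ^ i = x ^ j * x ^ (i - j)" for x :: "'k mpoly"
        using j by (simp flip: power_add)
      have "Var n ^ i * (of_nat (i + j) * (fwd (P j) * fwd (B (i - j))))
          = of_nat (i + j) * ((Var n ^ j * fwd (P j)) * (Var n ^ (i - j) * fwd (B (i - j))))"
        unfolding split by (simp only: mult_ac)
      also have "\<dots> = of_nat (i + j) * ((form 0 ^ j * hcoef n j) * (form 0 ^ (i - j) * G n (i - j)))"
        using less.IH[of j] fwd_B[of "i - j"] j less.prems by simp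
      also have "\<dots> = form 0 ^ i * (of_nat (i + j) * (hcoef n j * G n (i - j)))"
        unfolding split by (simp only: mult_ac)
      finally show "Var n ^ i * (of_nat (i + j) * (fwd (P j) * fwd (B (i - j))))
          = form 0 ^ i * (of_nat (i + j) * (hcoef n j * G n (i - j)))" .
    qed
    also have "\<dots> = form 0 ^ i * (of_nat (2 * i) * hcoef n i)"
      using i by (simp only: G_relation_upper sum_distrib_left[symmetric] mult_minus_right minus_minus)
    also have "\<dots> = of_nat (2 * i) * (form 0 ^ i * hcoef n i)"
      by (rule mult.left_commute)
    finally show ?thesis
      using of_nat_mpoly_neq_0[OF i] two_mpoly_neq_0 by simp
  qed simp
qed

lemma hcoef_1: "hcoef n 1 = Var (n - 1)"
  using n3 by (simp add: hcoef_def)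

lemma form_0_alt: "c * (Var n ^ (n - 1) * Var n ^ (q - 1)) = form 0"
proof -
  have "n - 1 + (q - 1) = n - 2 + q" using n3 q1 by simp
  then show ?thesis by (simp only: form_0 power_add[symmetric])
qed

text \<open>
  The two summands with \<open>y\<^sup>q G\<^bsub>n-2\<^esub>\<close>, from \<open>f\<^bsub>n-1\<^esub>\<close> and from the correction in \<open>B_last\<close>, cancel because
  \<open>P\<^sub>1\<close> pulls back to \<open>y f\<^sub>0/z\<close>.
\<close>

lemma fwd_B_last: "Var n ^ (n - 1) * fwd B_last = form 0 ^ (n - 1 + q) * G n (n - 1)"
proof -
  have P1: "Var n * fwd (P 1) = form 0 * Var (n - 1)"
    using fwd_P[of 1] n3 by (simp only: hcoef_1 power_one_right)
  have form2: "form (n - 2) = c * (Var n ^ q * G n (n - 2))"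
    using n3 q1 unfolding form_def by (subst if_P) auto
  have idx: "Suc (n - 2) = n - 1" "n - 1 - 1 = n - 2" using n3 by auto
  have "fwd B_last = form 0 ^ (n - 2 + q) * form (n - 1) - form 0 ^ (n - 2) * fwd (P 1) ^ q * form (n - 2)"
    unfolding B_last_def by (simp only: fwd.hom_minus fwd.hom_mult fwd.hom_power fwd_Var diff_self_eq_0 idx)
  then have "Var n ^ (n - 1) * fwd B_last =
      form 0 ^ (n - 2 + q) * ((c * (Var n ^ (n - 1) * Var n ^ (q - 1))) * G n (n - 1))
      + Var n ^ (n - 1) * form 0 ^ (n - 2 + q) * (c * (Var (n - 1) ^ q * G n (n - 2)))
      - Var n ^ (n - 1) * form 0 ^ (n - 2) * ((Var n * fwd (P 1)) ^ q * (c * G n (n - 2)))"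
    by (simp only: form_last form2 power_mult_distrib) (simp only: algebra_simps)
  also have "\<dots> = form 0 ^ (n - 2 + q) * (form 0 * G n (n - 1))"
    by (simp only: form_0_alt P1 power_mult_distrib power_add) (simp only: algebra_simps)
  also have "\<dots> = form 0 ^ (n - 1 + q) * G n (n - 1)"
  proof -
    have "n - 1 + q = Suc (n - 2 + q)" using n3 by simp
    then show ?thesis by (simp only: power_Suc2 mult.assoc)
  qed
  finally show ?thesis .
qed

lemma G_relation_last:
  "of_nat (n - 1) * G n (n - 1)
    + (\<Sum>j\<in>{1..<n - 1}. of_nat (n - 1 + j) * (hcoef n j * G n (n - 1 - j)))
    = - (of_nat (2 * (n - 1)) * (hcoef n (n - 1) :: 'k mpoly))"
proof -
  have "{..<n - 1} = insert 0 {1..<n - 1}" using n3 by auto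
  then show ?thesis
    using G_relation_upper[of "n - 1"] n3 by simp
qed

lemma fwd_P_last: "Var n ^ (n - 1) * fwd P_last = form 0 ^ (n - 1 + q) * hcoef n (n - 1)"
proof -
  have i: "1 \<le> n - 1" "n - 1 < n" using n3 by auto
  have mid: "Var n ^ (n - 1) * (form 0 ^ q * (\<Sum>j\<in>{1..<n - 1}. of_nat (n - 1 + j) * (fwd (P j) * fwd (B (n - 1 - j)))))
      = form 0 ^ (n - 1 + q) * (\<Sum>j\<in>{1..<n - 1}. of_nat (n - 1 + j) * (hcoef n j * G n (n - 1 - j)))"
    unfolding sum_distrib_left
  proof (intro sum.cong refl)
    fix j assume "j \<in> {1..<n - 1}"
    then have j: "1 \<le> j" "j < n - 1" by auto
    have split: "x ^ (n - 1) = x ^ j * x ^ (n - 1 - j)" for x :: "'k mpoly"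
      using j by (simp flip: power_add)
    have "Var n ^ (n - 1) * (form 0 ^ q * (of_nat (n - 1 + j) * (fwd (P j) * fwd (B (n - 1 - j)))))
      = form 0 ^ q * (of_nat (n - 1 + j) * ((Var n ^ j * fwd (P j)) * (Var n ^ (n - 1 - j) * fwd (B (n - 1 - j)))))"
      unfolding split by (simp only: mult_ac)
    also have "\<dots> = form 0 ^ q * (of_nat (n - 1 + j) * ((form 0 ^ j * hcoef n j) * (form 0 ^ (n - 1 - j) * G n (n - 1 - j))))"
    proof -
      have "j \<le> n - 2" "n - 1 - j \<le> n - 2" using j by auto
      then show ?thesis by (simp only: fwd_P fwd_B)
    qed
    also have "\<dots> = form 0 ^ (n - 1 + q) * (of_nat (n - 1 + j) * (hcoef n j * G n (n - 1 - j)))"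
      unfolding power_add split by (simp only: mult_ac)
    finally show "Var n ^ (n - 1) * (form 0 ^ q * (of_nat (n - 1 + j) * (fwd (P j) * fwd (B (n - 1 - j)))))
      = form 0 ^ (n - 1 + q) * (of_nat (n - 1 + j) * (hcoef n j * G n (n - 1 - j)))" .
  qed
  have one: "fwd (Var 1) = form 0" by (simp add: fwd_Var)
  have "of_nat (2 * (n - 1)) * (Var n ^ (n - 1) * fwd P_last)
      = Var n ^ (n - 1) * fwd (of_nat (2 * (n - 1)) * P_last)"
    by (simp only: fwd.hom_mult fwd.hom_of_nat mult_ac)
  also have "\<dots> = - (of_nat (n - 1) * (Var n ^ (n - 1) * fwd B_last)
     + Var n ^ (n - 1) * (form 0 ^ q * (\<Sum>j\<in>{1..<n - 1}. of_nat (n - 1 + j) * (fwd (P j) * fwd (B (n - 1 - j))))))"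
    by (simp only: P_last_relation fwd.hom_uminus fwd.hom_add fwd.hom_mult fwd.hom_of_nat fwd.hom_sum
        fwd.hom_power one distrib_left mult_minus_right mult.left_commute)
  also have "\<dots> = - (form 0 ^ (n - 1 + q) * (of_nat (n - 1) * G n (n - 1)
    + (\<Sum>j\<in>{1..<n - 1}. of_nat (n - 1 + j) * (hcoef n j * G n (n - 1 - j)))))"
    unfolding mid fwd_B_last distrib_left by (simp only: mult.left_commute[of "of_nat (n - 1)"])
  also have "\<dots> = form 0 ^ (n - 1 + q) * (of_nat (2 * (n - 1)) * hcoef n (n - 1))"
    by (simp only: G_relation_last mult_minus_right minus_minus)
  also have "\<dots> = of_nat (2 * (n - 1)) * (form 0 ^ (n - 1 + q) * hcoef n (n - 1))"
    by (rule mult.left_commute)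
  finally show ?thesis
    using of_nat_mpoly_neq_0[OF i] two_mpoly_neq_0 by simp
qed

lemma fwd_inv_form:
  assumes k: "1 \<le> k" "k \<le> n"
  shows "Var n * fwd (inv_form k) = form 0 ^ (n - 1 + q) * Var k"
proof (cases "k = n")
  case True
  then show ?thesis using n3 by (simp add: inv_form_n fwd.hom_power fwd_Var)
next
  case False
  define i where "i = n - k"
  have i: "1 \<le> i" "i \<le> n - 1" "k = n - i" using k False by (auto simp: i_def)
  have hc: "hcoef n i = Var k * Var n ^ (i - 1)"
    using i by (simp add: hcoef_def)
  have zi: "Var n ^ i = Var n ^ (i - 1) * (Var n :: 'k mpoly)"
    using i by (metis One_nat_def Suc_pred' less_eq_Suc_le power_Suc2)
  have "Var n ^ i * fwd (inv_form k) = form 0 ^ (n - 1 + q) * hcoef n i"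
  proof (cases "k = 1")
    case True
    then show ?thesis using fwd_P_last i_def by (simp add: inv_form_def)
  next
    case False
    then have i2: "i \<le> n - 2" using i by auto
    have "n - 1 + q = n - 1 + q - i + i" using i by simp
    then have pw: "form 0 ^ (n - 1 + q) = form 0 ^ (n - 1 + q - i) * form 0 ^ i"
      by (metis power_add)
    have "Var n ^ i * fwd (inv_form k) = form 0 ^ (n - 1 + q - i) * (Var n ^ i * fwd (P i))"
      using False by (simp add: inv_form_def fwd.hom_mult fwd.hom_power fwd_Var mult_ac flip: i_def)
    then show ?thesis
      unfolding pw by (simp only: fwd_P[OF i2] mult.assoc)
  qed
  then have "Var n ^ (i - 1) * (Var n * fwd (inv_form k)) = Var n ^ (i - 1) * (form 0 ^ (n - 1 + q) * Var k)"
    by (simp only: hc zi mult_ac)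
  then show ?thesis
    by simp
qed

subsection \<open>The map after the inverse\<close>

abbreviation "Z \<equiv> Var 1 ^ (n - 1 + q) :: 'k mpoly"

text \<open>
  Conversely, substituting the inverse turns \<open>a\<^sub>j\<close> into \<open>P\<^sub>j\<close> and \<open>G\<^sub>j\<close> into \<open>B\<^sub>j\<close>, up to scaling by
  \<open>j\<close>-th powers.
\<close>

lemma bwd_hcoef:
  assumes j: "j \<le> n - 2"
  shows "Var 1 ^ j * bwd (hcoef n j) = Z ^ j * P j"
proof (cases "j = 0")
  case False
  have "n - j \<noteq> 1" "n - (n - j) = j" using j n3 by auto
  then have "bwd (hcoef n j) = Var 1 ^ (n - 1 + q - j) * P j * Z ^ (j - 1)"
    using False j by (simp add: hcoef_def bwd.hom_mult bwd.hom_power bwd_Var inv_form_n)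
      (simp add: inv_form_def)
  then have "Var 1 ^ j * bwd (hcoef n j) = (Var 1 ^ j * Var 1 ^ (n - 1 + q - j)) * Z ^ (j - 1) * P j"
    by (simp only: mult_ac)
  also have "Var 1 ^ j * Var 1 ^ (n - 1 + q - j) = Z"
    using j by (simp flip: power_add)
  also have "Z * Z ^ (j - 1) = Z ^ j"
    using False by (metis Suc_pred' gr0I power_Suc)
  finally show ?thesis .
qed simp

lemma P_relation_lower:
  assumes "1 \<le> i" "i < n"
  shows "(\<Sum>j=1..i. of_nat (i + j) * (P j * B (i - j))) = - (of_nat i * B i)"
proof -
  have "(\<Sum>j\<le>i. of_nat (i + j) * (P j * B (i - j)))
     = (\<Sum>j<i. of_nat (i + j) * (P j * B (i - j))) + of_nat (2 * i) * P i"
    by (simp add: lessThan_Suc_atMost[symmetric] mult_2 del: of_nat_add of_nat_mult)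
  also have "\<dots> = 0"
    by (simp only: P_relation[OF assms] add.right_inverse)
  finally have "(\<Sum>j\<le>i. of_nat (i + j) * (P j * B (i - j))) = 0" .
  moreover have "(\<Sum>j\<le>i. of_nat (i + j) * (P j * B (i - j)))
     = of_nat i * B i + (\<Sum>j=1..i. of_nat (i + j) * (P j * B (i - j)))"
    by (simp add: sum.atLeast_Suc_atMost One_nat_def flip: atLeast0AtMost)
  ultimately show ?thesis
    by (simp only: eq_neg_iff_add_eq_0 add.commute)
qed

lemma bwd_G:
  assumes "i \<le> n - 2"
  shows "Var 1 ^ i * bwd (G n i) = Z ^ i * B i"
  using assms
proof (induction i rule: less_induct)
  case (less i)
  show ?case
  proof (cases "i = 0")
    case False
    then have i: "1 \<le> i" "i < n" using less.prems n3 by auto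
    have "of_nat i * (Var 1 ^ i * bwd (G n i)) = Var 1 ^ i * bwd (of_nat i * G n i)"
      by (simp only: bwd.hom_mult bwd.hom_of_nat mult_ac)
    also have "\<dots> = - (\<Sum>j=1..i. Var 1 ^ i * (of_nat (i + j) * (bwd (hcoef n j) * bwd (G n (i - j)))))"
      by (simp only: G_rec bwd.hom_mult bwd.hom_of_nat bwd.hom_uminus bwd.hom_sum sum_distrib_left mult_minus_right)
    also have "\<dots> = - (\<Sum>j=1..i. Z ^ i * (of_nat (i + j) * (P j * B (i - j))))"
    proof (intro arg_cong[of _ _ uminus] sum.cong refl)
      fix j assume "j \<in> {1..i}"
      then have j: "1 \<le> j" "j \<le> i" by auto
      have split: "x ^ i = x ^ j * x ^ (i - j)" for x :: "'k mpoly"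
        using j by (simp flip: power_add)
      have "Var 1 ^ i * (of_nat (i + j) * (bwd (hcoef n j) * bwd (G n (i - j))))
          = of_nat (i + j) * ((Var 1 ^ j * bwd (hcoef n j)) * (Var 1 ^ (i - j) * bwd (G n (i - j))))"
        unfolding split[of "Var 1"] by (simp only: mult_ac)
      also have "\<dots> = of_nat (i + j) * ((Z ^ j * P j) * (Z ^ (i - j) * B (i - j)))"
        using less.IH[of "i - j"] bwd_hcoef[of j] j less.prems by simp
      also have "\<dots> = Z ^ i * (of_nat (i + j) * (P j * B (i - j)))"
        unfolding split[of Z] by (simp only: mult_ac)
      finally show "Var 1 ^ i * (of_nat (i + j) * (bwd (hcoef n j) * bwd (G n (i - j))))
          = Z ^ i * (of_nat (i + j) * (P j * B (i - j)))" .
    qed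
    also have "\<dots> = Z ^ i * (of_nat i * B i)"
      by (simp only: P_relation_lower[OF i] sum_distrib_left[symmetric] mult_minus_right minus_minus)
    also have "\<dots> = of_nat i * (Z ^ i * B i)"
      by (rule mult.left_commute)
    finally show ?thesis
      using of_nat_mpoly_neq_0[OF i] by simp
  qed simp
qed

lemma bwd_G_last: "bwd (G n (n - 1)) = Z ^ (n - 2) * B_last"
proof -
  have i: "1 \<le> n - 1" "n - 1 < n" using n3 by auto
  have mid: "Var 1 ^ (n - 1 + q) * (\<Sum>j\<in>{1..<n - 1}. of_nat (n - 1 + j) * (bwd (hcoef n j) * bwd (G n (n - 1 - j))))
      = Z ^ (n - 1) * (Var 1 ^ q * (\<Sum>j\<in>{1..<n - 1}. of_nat (n - 1 + j) * (P j * B (n - 1 - j))))"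
    unfolding sum_distrib_left
  proof (intro sum.cong refl)
    fix j assume "j \<in> {1..<n - 1}"
    then have j: "1 \<le> j" "j < n - 1" by auto
    have split: "x ^ (n - 1) = x ^ j * x ^ (n - 1 - j)" for x :: "'k mpoly"
      using j by (simp flip: power_add)
    have "Var 1 ^ (n - 1 + q) * (of_nat (n - 1 + j) * (bwd (hcoef n j) * bwd (G n (n - 1 - j))))
      = Var 1 ^ q * (of_nat (n - 1 + j) * ((Var 1 ^ j * bwd (hcoef n j)) * (Var 1 ^ (n - 1 - j) * bwd (G n (n - 1 - j)))))"
      unfolding power_add split[of "Var 1"] by (simp only: mult_ac)
    also have "\<dots> = Var 1 ^ q * (of_nat (n - 1 + j) * ((Z ^ j * P j) * (Z ^ (n - 1 - j) * B (n - 1 - j))))"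
    proof -
      have "j \<le> n - 2" "n - 1 - j \<le> n - 2" using j by auto
      then show ?thesis by (simp only: bwd_hcoef bwd_G)
    qed
    also have "\<dots> = Z ^ (n - 1) * (Var 1 ^ q * (of_nat (n - 1 + j) * (P j * B (n - 1 - j))))"
      unfolding split[of Z] by (simp only: mult_ac)
    finally show "Var 1 ^ (n - 1 + q) * (of_nat (n - 1 + j) * (bwd (hcoef n j) * bwd (G n (n - 1 - j))))
      = Z ^ (n - 1) * (Var 1 ^ q * (of_nat (n - 1 + j) * (P j * B (n - 1 - j))))" .
  qed
  have idx: "n - (n - 1) = 1" "n - 1 - 1 = n - 2" using n3 by auto
  have Zs: "Z * Z ^ (n - 2) = Z ^ (n - 1)"
    using n3 by (metis Suc_diff_le diff_Suc_Suc numeral_2_eq_2 numeral_3_eq_3 power_Suc Suc_leD One_nat_def)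
  have hl: "bwd (hcoef n (n - 1)) = P_last * Z ^ (n - 2)"
    using n3 idx by (simp only: hcoef_def if_False bwd.hom_mult bwd.hom_power bwd_Var inv_form_n)
      (simp add: inv_form_def idx bwd.hom_mult bwd.hom_power bwd_Var)
  have "Z * (of_nat (n - 1) * bwd (G n (n - 1))
      + (\<Sum>j\<in>{1..<n - 1}. of_nat (n - 1 + j) * (bwd (hcoef n j) * bwd (G n (n - 1 - j)))))
      = Z * - (of_nat (2 * (n - 1)) * bwd (hcoef n (n - 1)))"
    using arg_cong[OF G_relation_last, of bwd]
    by (simp only: bwd.hom_mult bwd.hom_add bwd.hom_of_nat bwd.hom_uminus bwd.hom_sum)
  then have "of_nat (n - 1) * (Z * bwd (G n (n - 1)))
      + Z ^ (n - 1) * (Var 1 ^ q * (\<Sum>j\<in>{1..<n - 1}. of_nat (n - 1 + j) * (P j * B (n - 1 - j))))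
      = - (Z ^ (n - 1) * (of_nat (2 * (n - 1)) * P_last))"
    by (simp only: distrib_left mid hl Zs[symmetric] mult_minus_right mult_ac)
  also have "\<dots> = Z ^ (n - 1) * (of_nat (n - 1) * B_last)
     + Z ^ (n - 1) * (Var 1 ^ q * (\<Sum>j\<in>{1..<n - 1}. of_nat (n - 1 + j) * (P j * B (n - 1 - j))))"
    by (simp only: P_last_relation mult_minus_right minus_minus distrib_left)
  finally have "of_nat (n - 1) * (Z * bwd (G n (n - 1))) = of_nat (n - 1) * (Z * (Z ^ (n - 2) * B_last))"
    by (simp only: add_right_cancel Zs[symmetric] mult_ac)
  then show ?thesis
    using of_nat_mpoly_neq_0[OF i] by (simp del: of_nat_diff)
qed

lemma bwd_form:
  assumes "i < n"
  shows "Var 1 * bwd (form i) = c * Z ^ (n - 2 + q) * Var (i + 1)"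
proof -
  have pow_B: "Var 1 ^ i * (Var 1 * bwd (G n i)) = Var 1 ^ i * (Z ^ i * Var (i + 1))" if "i \<le> n - 2" for i
  proof -
    have "Var 1 ^ i * (Var 1 * bwd (G n i)) = Z ^ i * (Var 1 * B i)"
      using bwd_G[OF that] by (simp only: mult.left_commute)
    also have "Var 1 * B i = Var 1 ^ i * Var (i + 1)"
      by (cases i) (simp_all add: B_def)
    finally show ?thesis
      by (simp only: mult.left_commute)
  qed
  have lowG: "Var 1 * bwd (G n i) = Z ^ i * Var (i + 1)" if "i \<le> n - 2" for i
    using pow_B[OF that] by simp
  have bz: "bwd (Var n) = Z" by (simp only: bwd_Var inv_form_n)
  have bc: "bwd c = c" by (simp add: bwd_def subst_c)
  show ?thesis
  proof (cases "i < n - 1")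
    case True
    then have i: "i \<le> n - 2" by simp
    have idx: "n - 2 + q = n - 2 - i + q + i" using i by simp
    have "Var 1 * bwd (form i) = c * Z ^ (n - 2 - i + q) * (Var 1 * bwd (G n i))"
      using True by (simp add: form_def bwd.hom_mult bwd.hom_power bz bc mult_ac)
    also have "\<dots> = c * (Z ^ (n - 2 - i + q) * Z ^ i) * Var (i + 1)"
      by (simp only: lowG[OF i] mult_ac)
    finally show ?thesis
      by (simp only: power_add[symmetric] idx[symmetric])
  next
    case False
    then have i: "i = n - 1" using assms by simp
    have idx: "n - 1 \<noteq> 1" "n - (n - 1) = 1" "n - 2 + 1 = n - 1" "n - 1 + 1 = n" using n3 by auto
    have bwd_y: "bwd (Var (n - 1)) = Var 1 ^ (n - 1 + q - 1) * P 1"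
      by (simp only: bwd_Var inv_form_def idx if_False)
    have Zq: "(Var 1 ^ (n - 1 + q - 1)) ^ q = Z ^ (q - 1) * (Var 1 :: 'k mpoly) ^ (n - 1)"
    proof -
      have "(n - 1 + q - 1) * q = (n - 1 + q) * (q - 1) + (n - 1)"
        using n3 q1 by (cases q; cases n) (auto simp: algebra_simps)
      then show ?thesis by (simp only: power_mult[symmetric] power_add[symmetric])
    qed
    have ZBl: "Var 1 * B_last = Z * Var n - Var 1 ^ (n - 1) * P 1 ^ q * Var (n - 1)"
    proof -
      have e: "Var 1 * Var 1 ^ (n - 2 + q) = Z" "Var 1 * Var 1 ^ (n - 2) = (Var 1 ^ (n - 1) :: 'k mpoly)"
        using n3 by (simp_all flip: power_Suc add: Suc_diff_Suc numeral_2_eq_2 One_nat_def)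
      have "Var 1 * B_last = (Var 1 * Var 1 ^ (n - 2 + q)) * Var n
          - (Var 1 * Var 1 ^ (n - 2)) * P 1 ^ q * Var (n - 1)"
        unfolding B_last_def by (simp only: right_diff_distrib mult.assoc)
      then show ?thesis
        unfolding e .
    qed
    have ring: "c * (a * (b * (x * v - w * p * m)) + a * w * p * (b * m)) = c * b * (a * x) * v"
      for a b x v w p m :: "'k mpoly"
      by (simp add: algebra_simps)
    have "Var 1 * bwd (form i) = c * (Z ^ (q - 1) * (Z ^ (n - 2) * (Var 1 * B_last))
        + (Var 1 ^ (n - 1 + q - 1)) ^ q * P 1 ^ q * (Var 1 * bwd (G n (n - 2))))"
      unfolding i form_last bwd.hom_mult bwd.hom_add bwd.hom_power bz bc bwd_y bwd_G_last power_mult_distrib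
      by (simp only: algebra_simps)
    also have "\<dots> = c * Z ^ (n - 2) * (Z ^ (q - 1) * Z) * Var n"
      unfolding ZBl Zq lowG[OF order_refl] idx by (rule ring)
    also have "Z ^ (q - 1) * Z = Z ^ q"
      using q1 by (metis One_nat_def Suc_pred' less_eq_Suc_le power_Suc2)
    finally show ?thesis
      unfolding i idx power_add by (simp only: mult.assoc)
  qed
qed

subsection \<open>The Cremona map\<close>

definition forms :: "'k mpoly list" where "forms = map form [0..<n]"
definition inv_forms :: "'k mpoly list" where "inv_forms = map inv_form [1..<Suc n]"

declare One_nat_def [simp]

lemma length_forms [simp]: "length forms = n" and length_inv_forms [simp]: "length inv_forms = n"
  by (simp_all add: forms_def inv_forms_def)

lemma forms_nth: "i < n \<Longrightarrow> forms ! i = form i"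
  by (simp add: forms_def)

lemma inv_forms_nth: "i < n \<Longrightarrow> inv_forms ! i = inv_form (Suc i)"
  unfolding inv_forms_def by (subst nth_map) (simp_all del: upt_Suc)

lemma represents_map_I:
  assumes "length fs = n" "\<And>i. i < n \<Longrightarrow> fs ! i \<in> polys {1..n}" "\<And>i. i < n \<Longrightarrow> homogeneous d (fs ! i)"
    "i < n" "fs ! i \<noteq> 0"
  shows "represents_map n (fs :: 'k mpoly list)"
  unfolding represents_map_def carrier_poly_ring using assms
  by (auto simp: in_set_conv_nth intro!: exI[of _ d]) (metis nth_mem)

text \<open>
  Both composites are proportional to the identity, by \<open>fwd_inv_form\<close> and \<open>bwd_form\<close>.
\<close>

lemma cremona_map_forms: "cremona_map n forms"
proof -
  have fs: "represents_map n forms"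
    using n3 form_polys form_homogeneous form_0_neq_0
    by (intro represents_map_I[of forms "n - 2 + q" 0]) (auto simp: forms_nth)
  have gs: "represents_map n inv_forms"
    using n3 inv_form_polys inv_form_homogeneous inv_form_n
    by (intro represents_map_I[of inv_forms "n - 1 + q" "n - 1"]) (auto simp: inv_forms_nth)
  have fwd_eq: "compose_map inv_forms forms ! i = fwd (inv_form (Suc i))" if "i < n" for i
    unfolding compose_map_def fwd_def using that inv_form_polys[of "Suc i"]
    by (subst nth_map) (auto simp: inv_forms_nth forms_nth intro!: subst_cong[of _ "{1..n}"])
  have bwd_eq: "compose_map forms inv_forms ! i = bwd (form i)" if "i < n" for i
    unfolding compose_map_def bwd_def using that form_polys[of i]
    by (subst nth_map) (auto simp: inv_forms_nth forms_nth intro!: subst_cong[of _ "{1..n}"])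
  have len: "length (compose_map inv_forms forms) = n" "length (compose_map forms inv_forms) = n"
    by (simp_all add: compose_map_def)
  have id_nth: "identity_map n ! i = Var (Suc i)" if "i < n" for i
    unfolding identity_map_def using that by (subst nth_map) (simp_all del: upt_Suc)
  have len_id: "length (identity_map n :: 'k mpoly list) = n"
    by (simp add: identity_map_def)
  have fwd_rep: "represents_map n (compose_map inv_forms forms)"
  proof (rule represents_map_I[of _ "(n - 1 + q) * (n - 2 + q)" 0])
    fix i assume i: "i < n"
    show "compose_map inv_forms forms ! i \<in> polys {1..n}"
      unfolding fwd_eq[OF i] fwd_def using i
      by (intro subst_in_polys[OF inv_form_polys[of "Suc i"]] form_polys) auto
    show "homogeneous ((n - 1 + q) * (n - 2 + q)) (compose_map inv_forms forms ! i)"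
      unfolding fwd_eq[OF i] fwd_def using i
      by (intro homogeneous_subst[OF inv_form_homogeneous inv_form_polys[of "Suc i"]] form_homogeneous) auto
  next
    show "compose_map inv_forms forms ! 0 \<noteq> 0"
      using fwd_inv_form[of 1] n3 form_0_neq_0 by (auto simp: fwd_eq)
  qed (use n3 len in auto)
  have bwd_rep: "represents_map n (compose_map forms inv_forms)"
  proof (rule represents_map_I[of _ "(n - 2 + q) * (n - 1 + q)" 0])
    fix i assume i: "i < n"
    show "compose_map forms inv_forms ! i \<in> polys {1..n}"
      unfolding bwd_eq[OF i] bwd_def using i
      by (intro subst_in_polys[OF form_polys[OF i]] inv_form_polys) auto
    show "homogeneous ((n - 2 + q) * (n - 1 + q)) (compose_map forms inv_forms ! i)"
      unfolding bwd_eq[OF i] bwd_def using i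
      by (intro homogeneous_subst[OF form_homogeneous form_polys[OF i]] inv_form_homogeneous) auto
  next
    show "compose_map forms inv_forms ! 0 \<noteq> 0"
      using bwd_form[of 0] n3 c_neq_0 by (auto simp: bwd_eq)
  qed (use n3 len in auto)
  have "same_map (compose_map inv_forms forms) (identity_map n)"
    using fwd_inv_form
    by (intro proportional_imp_same_map[of _ _ "Var n" "form 0 ^ (n - 1 + q)"])
      (auto simp: len len_id fwd_eq id_nth)
  moreover have "same_map (compose_map forms inv_forms) (identity_map n)"
    using bwd_form
    by (intro proportional_imp_same_map[of _ _ "Var 1" "c * Z ^ (n - 2 + q)"])
      (auto simp: len len_id bwd_eq id_nth)
  ultimately show ?thesis
    unfolding cremona_map_def using fs gs fwd_rep bwd_rep by blast
qed

end

section \<open>The base ideal as a module\<close>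

lemma keys_mult_Var_powerE:
  assumes "m \<in> keys (p * Var v ^ e)"
  obtains m' where "m' \<in> keys p" "m = m' + sgl v e"
proof -
  obtain a b where "a \<in> keys p" "b \<in> keys (Var v ^ e :: 'a mpoly)" "m = a + b"
    using keys_mult[of p "Var v ^ e"] assms by blast
  moreover have "b = sgl v e"
    using \<open>b \<in> keys (Var v ^ e)\<close> by (simp add: Var_power)
  ultimately show ?thesis using that by blast
qed

lemma ex_division_by_Var_power:
  assumes "a \<in> polys V"
  shows "\<exists>a1\<in>polys V. \<exists>a0\<in>polys V. a = Var v ^ h * a1 + a0 \<and> (\<forall>m\<in>keys a0. lkp m v < h)"
  using assms
proof (induction h arbitrary: a)
  case 0
  then show ?case by (auto intro!: bexI[of _ a] bexI[of _ 0])
next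
  case (Suc h)
  obtain b where b: "a = drop_var v a + Var v * b" "b \<in> polys V"
  proof -
    obtain b where "a - Var v * b = drop_var v a" "b \<in> polys V"
      using drop_var_remainder[OF Suc.prems, of v] by blast
    then show ?thesis by (intro that[of b]) (auto simp: diff_eq_eq)
  qed
  obtain b1 b0 where b01: "b1 \<in> polys V" "b0 \<in> polys V" "b = Var v ^ h * b1 + b0" "\<forall>m\<in>keys b0. lkp m v < h"
    using Suc.IH[OF b(2)] by blast
  have dV: "drop_var v a \<in> polys (V - {v})" using Suc.prems by (rule drop_var_in_polys)
  show ?case
  proof (cases "v \<in> V")
    case True
    have "a = Var v ^ Suc h * b1 + (drop_var v a + b0 * Var v ^ 1)"
      by (subst b(1), subst b01(3)) (simp add: algebra_simps)
    moreover have "lkp m v < Suc h" if m: "m \<in> keys (drop_var v a + b0 * Var v ^ 1)" for m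
    proof -
      from m Poly_Mapping.keys_add[of "drop_var v a" "b0 * Var v ^ 1"]
      consider "m \<in> keys (drop_var v a)" | "m \<in> keys (b0 * Var v ^ 1)" by blast
      then show ?thesis
      proof cases
        case 1
        then have "v \<notin> keys m" using dV by (auto simp: polys_iff)
        then show ?thesis by (simp add: in_keys_iff)
      next
        case 2
        then show ?thesis using b01(4)
          by (elim keys_mult_Var_powerE) (auto simp: lookup_add)
      qed
    qed
    moreover have "drop_var v a + b0 * Var v ^ 1 \<in> polys V"
      using True b01 polys_monoD[OF dV] by (intro polys_add polys_mult polys_power) auto
    ultimately show ?thesis using b01(1) by blast
  next
    case False
    have "lkp m v < Suc h" if "m \<in> keys a" for m
    proof -
      have "v \<notin> keys m" using False Suc.prems that by (auto simp: polys_iff)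
      then show ?thesis by (simp add: in_keys_iff)
    qed
    then show ?thesis using Suc.prems by (intro bexI[of _ 0] bexI[of _ a]) auto
  qed
qed

lemma prime_power_mem:
  assumes Q: "primeideal Q (poly_ring V)" and p: "p \<in> polys V" "p ^ e \<in> Q"
  shows "p \<in> Q"
  using p(2)
proof (induction e)
  case 0
  then show ?case using Q by (simp add: primeideal_poly_ring_iff)
next
  case (Suc e)
  then show ?case using Q p(1) by (auto simp: primeideal_poly_ring_iff)
qed

lemma ideal_Const_mult_cancel:
  assumes I: "ideal I (poly_ring V)" and u: "u \<noteq> 0" "Const u * p \<in> I"
  shows "p \<in> I"
proof -
  have "Const (inverse u) * (Const u * p) = Const (inverse u * u) * p"
    by (simp add: Const_mult mult.assoc)
  also have "\<dots> = p" using u(1) by simp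
  finally show ?thesis using ideal_mult_closed[OF I polys_Const u(2)] by metis
qed

context sub_hankel_map
begin

(* Indices such as n - 1 are to stay in this form instead of becoming n - Suc 0. *)
declare One_nat_def [simp del]

abbreviation "U \<equiv> {1..n}"
abbreviation "S \<equiv> {1..n - 2}"
text \<open>
  The ring \<open>k[x\<^sub>1, \<dots>, x\<^bsub>n-2\<^esub>, x\<^sub>n] = S[z]\<close>, over which polynomials are expanded in \<open>y\<close>.
\<close>

abbreviation "AV \<equiv> insert n S"
abbreviation "y \<equiv> Var (n - 1) :: 'k mpoly"
abbreviation "z \<equiv> Var n :: 'k mpoly"
definition "N = n - 2 + q"
abbreviation "I \<equiv> ideal_gen U forms"

lemma U_eq: "U = insert (n - 1) AV" and y_notin: "n - 1 \<notin> AV" and z_notin: "n \<notin> S"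
  using n3 by auto

lemma S_AV: "p \<in> polys S \<Longrightarrow> p \<in> polys AV" and AV_U: "p \<in> polys AV \<Longrightarrow> p \<in> polys U"
  using polys_mono[of S AV] polys_mono[of AV U] n3 by auto

lemma forms_polys: "set forms \<subseteq> polys U"
  using form_polys by (auto simp: forms_def)

lemma I_ideal: "ideal I (poly_ring U)"
  using ideal_ideal_gen[OF forms_polys] .

lemma form_I: "i < n \<Longrightarrow> form i \<in> I"
  by (rule ideal_gen_self[OF _ forms_polys]) (auto simp: forms_def)

lemma form_low: "i \<le> n - 2 \<Longrightarrow> form i = c * (z ^ (n - 2 - i + q) * G n i)"
  using n3 unfolding form_def by (subst if_P) auto

lemma N_gt: "n - 2 < N" using q1 by (simp add: N_def)

lemma c_Const: obtains c' where "c = Const c'" "c' \<noteq> 0"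
  using c that[of 1] that[of "- 1"] by (auto simp: Const_uminus)

text \<open>
  A basis of \<open>I\<close> over \<open>S[z]\<close> with one element of each degree \<open>e\<close> in \<open>y\<close>.  The forms \<open>f\<^sub>0, \<dots>, f\<^bsub>n-2\<^esub>\<close>
  have degrees \<open>0, \<dots>, n - 2\<close> in \<open>y\<close>, and the last one has degree \<open>N = n - 2 + q\<close>; the gap is filled by
  multiples of \<open>f\<^bsub>n-2\<^esub>\<close>, and multiples of the last form follow.
\<close>

definition basis :: "nat \<Rightarrow> 'k mpoly" where
  "basis e = (if e \<le> n - 2 then form e else if e < N then y ^ (e - (n - 2)) * form (n - 2)
     else y ^ (e - N) * form (n - 1))"

text \<open>
  The exponent of \<open>z\<close> in the leading coefficient of \<open>basis e\<close>.
\<close>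

definition zexp :: "nat \<Rightarrow> nat" where
  "zexp e = (if e \<le> n - 2 then n - 2 - e + q else if e < N then q else 0)"

lemma to_poly_form_low:
  assumes e: "e \<le> n - 2"
  shows "degree (to_poly (n - 1) (form e)) \<le> e"
    "coeff (to_poly (n - 1) (form e)) e = c * (of_nat (e + 1) * (- 1) ^ e) * z ^ (n - 2 - e + q)"
proof -
  have cz: "c * z ^ (n - 2 - e + q) \<in> polys AV" by (intro polys_mult polys_power c_polys) simp
  have "form e = (c * z ^ (n - 2 - e + q)) * G n e"
    using form_low[OF e] by (simp only: mult.assoc)
  then have eq: "to_poly (n - 1) (form e) = smult (c * z ^ (n - 2 - e + q)) (to_poly (n - 1) (G n e))"
    using to_poly_const[OF cz y_notin] by (simp add: to_poly.hom_mult)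
  have G: "degree (to_poly (n - 1) (G n e :: 'k mpoly)) \<le> e"
     "coeff (to_poly (n - 1) (G n e :: 'k mpoly)) e = of_nat (e + 1) * (- 1) ^ e"
  proof -
    have "n \<ge> 2" "e \<le> n" using n3 e by auto
    then show "degree (to_poly (n - 1) (G n e :: 'k mpoly)) \<le> e"
      "coeff (to_poly (n - 1) (G n e :: 'k mpoly)) e = of_nat (e + 1) * (- 1) ^ e"
      by (simp_all only: G_degree)
  qed
  show "degree (to_poly (n - 1) (form e)) \<le> e"
    unfolding eq using G(1) degree_smult_le order_trans by blast
  show "coeff (to_poly (n - 1) (form e)) e = c * (of_nat (e + 1) * (- 1) ^ e) * z ^ (n - 2 - e + q)"
    unfolding eq by (simp only: coeff_smult G(2) mult_ac)
qed

text \<open>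
  The leading coefficient is \<open>\<plusminus>(n - 1)\<close>, from \<open>y\<^sup>q G\<^bsub>n-2\<^esub>\<close>, unless \<open>q = 1\<close>.  In that case the summand
  \<open>G\<^bsub>n-1\<^esub>\<close> has the same degree and changes it to \<open>\<plusminus>((n - 1) - n)\<close>, again a unit.
\<close>

lemma to_poly_form_last:
  "degree (to_poly (n - 1) (form (n - 1))) \<le> N"
  "\<exists>u. u \<noteq> 0 \<and> coeff (to_poly (n - 1) (form (n - 1))) N = Const u"
proof -
  have zq: "z ^ (q - 1) \<in> polys AV" by (intro polys_power) simp
  let ?G = "\<lambda>i. to_poly (n - 1) (G n i :: 'k mpoly)"
  have G: "degree (?G i) \<le> i" "coeff (?G i) i = of_nat (i + 1) * (- 1) ^ i" if "i \<le> n" for i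
    using G_degree[of n i] n3 that by auto
  have eq: "to_poly (n - 1) (form (n - 1))
      = smult c (smult (z ^ (q - 1)) (?G (n - 1)) + monom 1 q * ?G (n - 2))"
    unfolding form_last using to_poly_const[OF zq y_notin] to_poly_const[OF c_polys y_notin]
    by (simp add: to_poly.hom_mult to_poly.hom_add to_poly.hom_power monom_altdef)
  have d1: "degree (smult (z ^ (q - 1)) (?G (n - 1))) \<le> N"
    using G(1)[of "n - 1"] degree_smult_le[of "z ^ (q - 1)" "?G (n - 1)"] q1 n3 by (simp add: N_def)
  have d2: "degree (monom 1 q * ?G (n - 2)) \<le> N"
    using G(1)[of "n - 2"] degree_mult_le[of "monom 1 q" "?G (n - 2)"] degree_monom_le[of "1 :: 'k mpoly" q]
    unfolding N_def by linarith
  show "degree (to_poly (n - 1) (form (n - 1))) \<le> N"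
    unfolding eq using degree_add_le[OF d1 d2] degree_smult_le order_trans by blast
  have c2: "coeff (monom 1 q * ?G (n - 2)) N = of_nat (n - 1) * (- 1) ^ (n - 2)"
    using G(2)[of "n - 2"] n3 unfolding coeff_monom_mult N_def by (simp add: Suc_diff_Suc numeral_2_eq_2)
  obtain c' where c': "c = Const c'" "c' \<noteq> 0" by (rule c_Const)
  show "\<exists>u. u \<noteq> 0 \<and> coeff (to_poly (n - 1) (form (n - 1))) N = Const u"
  proof (cases "q = 1")
    case True
    have N: "N = n - 1" unfolding N_def using True n3 by simp
    have pw: "(- 1 :: 'k mpoly) ^ (n - 1) = - ((- 1) ^ (n - 2))"
    proof -
      have "n - 1 = Suc (n - 2)" using n3 by simp
      then show ?thesis by simp
    qed
    have "coeff (to_poly (n - 1) (form (n - 1))) N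
      = c * (of_nat n * (- 1) ^ (n - 1) + of_nat (n - 1) * (- 1) ^ (n - 2))"
    proof -
      have "z ^ (q - 1) = 1" using True by simp
      moreover have "coeff (?G (n - 1)) N = of_nat n * (- 1) ^ (n - 1)"
        using G(2)[of "n - 1"] n3 unfolding N by simp
      ultimately show ?thesis unfolding eq coeff_smult coeff_add c2 by (simp only: mult_1_left)
    qed
    also have "\<dots> = - (c * (- 1) ^ (n - 2))"
    proof -
      show ?thesis unfolding pw of_nat_n by (simp add: algebra_simps)
    qed
    also have "\<dots> = Const (- (c' * (- 1) ^ (n - 2)))"
      by (simp add: c' minus_one_power_Const Const_mult Const_uminus)
    finally show ?thesis using c'(2) by (intro exI conjI) auto
  next
    case False
    then have "coeff (?G (n - 1)) N = 0"
      using G(1)[of "n - 1"] q1 n3 by (intro coeff_eq_0) (auto simp: N_def)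
    then have "coeff (to_poly (n - 1) (form (n - 1))) N = c * (of_nat (n - 1) * (- 1) ^ (n - 2))"
      unfolding eq coeff_smult coeff_add c2 by simp
    also have "\<dots> = Const (c' * (of_nat (n - 1) * (- 1) ^ (n - 2)))"
      by (simp only: c' minus_one_power_Const Const_mult Const_of_nat)
    finally show ?thesis
      using c'(2) of_nat_neq_0[of "n - 1"] n3 by (intro exI conjI) auto
  qed
qed

lemma to_poly_Var_power_mult: "to_poly (n - 1) (y ^ k * p) = monom 1 k * to_poly (n - 1) p"
  by (simp add: to_poly.hom_mult to_poly.hom_power monom_altdef)

lemma basis_degree: "degree (to_poly (n - 1) (basis e)) \<le> e"
proof -
  have *: "degree (monom 1 k * p) \<le> k + d" if "degree p \<le> d" for k d and p :: "'k mpoly poly"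
    using degree_mult_le[of "monom 1 k" p] degree_monom_le[of "1 :: 'k mpoly" k] that by linarith
  show ?thesis
    using to_poly_form_low(1)[of e] *[OF to_poly_form_low(1)[of "n - 2"], of "e - (n - 2)"]
      *[OF to_poly_form_last(1), of "e - N"]
    by (auto simp: basis_def to_poly_Var_power_mult)
qed

lemma basis_coeff: "\<exists>u. u \<noteq> 0 \<and> coeff (to_poly (n - 1) (basis e)) e = Const u * z ^ zexp e"
proof -
  obtain c' where c': "c = Const c'" "c' \<noteq> 0" by (rule c_Const)
  have low: "\<exists>u. u \<noteq> 0 \<and> coeff (to_poly (n - 1) (form i)) i = Const u * z ^ (n - 2 - i + q)" if "i \<le> n - 2" for i
  proof (intro exI conjI)
    show "coeff (to_poly (n - 1) (form i)) i = Const (c' * (of_nat (i + 1) * (- 1) ^ i)) * z ^ (n - 2 - i + q)"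
      unfolding to_poly_form_low(2)[OF that] by (simp only: c' minus_one_power_Const Const_mult Const_of_nat)
    show "c' * (of_nat (i + 1) * (- 1) ^ i) \<noteq> 0"
      using c'(2) of_nat_neq_0[of "i + 1"] that n3 by simp
  qed
  consider "e \<le> n - 2" | "e > n - 2" "e < N" | "e > n - 2" "e \<ge> N" by linarith
  then show ?thesis
  proof cases
    case 1
    then show ?thesis using low[OF 1] by (simp add: basis_def zexp_def)
  next
    case 2
    then show ?thesis using low[of "n - 2"]
      by (auto simp: basis_def zexp_def to_poly_Var_power_mult coeff_monom_mult)
  next
    case 3
    then show ?thesis using to_poly_form_last(2)
      by (auto simp: basis_def zexp_def to_poly_Var_power_mult coeff_monom_mult)
  qed
qed

lemma basis_I: "basis e \<in> I"
  using n3 form_I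
  by (auto simp: basis_def intro!: ideal_mult_closed[OF I_ideal] polys_power)

subsection \<open>Syzygies\<close>

text \<open>
  The linear coefficients of the syzygies: the relation for \<open>G\<close> becomes linear after dividing \<open>a\<^sub>j\<close> by
  \<open>z\<^bsup>j-1\<^esup>\<close>, which for \<open>j = 0\<close> means multiplying by \<open>z\<close>.
\<close>

definition bcoef :: "nat \<Rightarrow> 'k mpoly" where "bcoef j = (if j = 0 then z else Var (n - j))"

lemma z_hcoef: "j \<le> n \<Longrightarrow> z * hcoef n j = bcoef j * z ^ j"
  by (cases j) (auto simp: hcoef_def bcoef_def)

lemma form_syzygy:
  assumes i: "i \<le> n - 2"
  shows "(\<Sum>j\<le>i. of_nat (i + j) * (bcoef j * form (i - j))) = 0"
proof -
  have "(\<Sum>j\<le>i. of_nat (i + j) * (bcoef j * form (i - j)))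
     = (\<Sum>j\<le>i. (c * z ^ (n - 2 - i + q) * z) * (of_nat (i + j) * (hcoef n j * G n (i - j))))"
  proof (intro sum.cong refl)
    fix j assume "j \<in> {..i}"
    then have j: "j \<le> i" "j \<le> n" using i by auto
    have idx: "n - 2 - (i - j) + q = j + (n - 2 - i + q)" "i - j \<le> n - 2" using i j by simp_all
    have "form (i - j) = c * (z ^ j * z ^ (n - 2 - i + q) * G n (i - j))"
      unfolding form_low[OF idx(2)] idx(1) power_add ..
    then have "bcoef j * form (i - j) = c * z ^ (n - 2 - i + q) * ((bcoef j * z ^ j) * G n (i - j))"
      by (simp only: mult_ac)
    then show "of_nat (i + j) * (bcoef j * form (i - j))
       = (c * z ^ (n - 2 - i + q) * z) * (of_nat (i + j) * (hcoef n j * G n (i - j)))"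
      unfolding z_hcoef[OF j(2), symmetric] by (simp only: mult_ac)
  qed
  also have "\<dots> = 0"
    unfolding sum_distrib_left[symmetric] G_relation by simp
  finally show ?thesis .
qed

text \<open>
  For \<open>i = n - 1\<close> the term with \<open>j = 0\<close> contains \<open>z\<^sup>q G\<^bsub>n-1\<^esub>\<close>, which is not a multiple of the last form.
\<close>

lemma form_syzygy_last:
  "of_nat (n - 1) * (z * (c * z ^ (q - 1) * G n (n - 1)))
    + (\<Sum>j=1..n - 1. of_nat (n - 1 + j) * (bcoef j * form (n - 1 - j))) = 0"
proof -
  have zq: "z * z ^ (q - 1) = z ^ q" using q1 by (metis Suc_diff_le diff_Suc_1 One_nat_def power_Suc)
  have "(\<Sum>j=1..n - 1. of_nat (n - 1 + j) * (bcoef j * form (n - 1 - j)))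
    = (\<Sum>j=1..n - 1. (c * z ^ q) * (of_nat (n - 1 + j) * (hcoef n j * G n (n - 1 - j))))"
  proof (intro sum.cong refl)
    fix j assume "j \<in> {1..n - 1}"
    then have j: "1 \<le> j" "j \<le> n - 1" by auto
    have idx: "n - 2 - (n - 1 - j) + q = (j - 1) + q" "n - 1 - j \<le> n - 2" using j n3 by simp_all
    have "form (n - 1 - j) = c * (z ^ (j - 1) * z ^ q * G n (n - 1 - j))"
      unfolding form_low[OF idx(2)] idx(1) power_add ..
    moreover have "hcoef n j = bcoef j * z ^ (j - 1)" using j by (simp add: hcoef_def bcoef_def)
    ultimately show "of_nat (n - 1 + j) * (bcoef j * form (n - 1 - j))
      = (c * z ^ q) * (of_nat (n - 1 + j) * (hcoef n j * G n (n - 1 - j)))"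
      by (simp only: mult_ac)
  qed
  also have "\<dots> = (c * z ^ q) * - (of_nat (n - 1) * G n (n - 1))"
    unfolding sum_distrib_left[symmetric] G_rec[of "n - 1" n] by simp
  finally show ?thesis
    unfolding zq[symmetric] by (simp add: algebra_simps)
qed

subsection \<open>The span of the basis is the base ideal\<close>

definition basis_span :: "'k mpoly set" where
  "basis_span = {\<Sum>e<K. a e * basis e |a K. \<forall>e. a e \<in> polys AV}"

lemma span_add: assumes "p \<in> basis_span" "p' \<in> basis_span" shows "p + p' \<in> basis_span"
proof -
  obtain a K b L where ab: "p = (\<Sum>e<K. a e * basis e)" "\<forall>e. a e \<in> polys AV"
    "p' = (\<Sum>e<L. b e * basis e)" "\<forall>e. b e \<in> polys AV"
    using assms unfolding basis_span_def by blast
  have pad: "(\<Sum>e<K. f e * basis e) = (\<Sum>e<max K L. (if e < K then f e else 0) * basis e)" for f K L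
    by (intro sum.mono_neutral_cong_left) auto
  have "p + p' = (\<Sum>e<max K L. ((if e < K then a e else 0) + (if e < L then b e else 0)) * basis e)"
    unfolding ab(1,3) pad[where K = K and L = L] pad[where K = L and L = K]
    by (simp only: max.commute[of L K] sum.distrib[symmetric] distrib_right)
  then show ?thesis
    unfolding basis_span_def mem_Collect_eq using ab
    by (intro exI[of _ "\<lambda>e. (if e < K then a e else 0) + (if e < L then b e else 0)"] exI[of _ "max K L"])
      (auto intro!: polys_add)
qed

lemma span_mult: assumes "a \<in> polys AV" "p \<in> basis_span" shows "a * p \<in> basis_span"
proof -
  obtain b K where b: "p = (\<Sum>e<K. b e * basis e)" "\<forall>e. b e \<in> polys AV"
    using assms unfolding basis_span_def by blast
  then show ?thesis
    unfolding basis_span_def mem_Collect_eq using assms(1)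
    by (intro exI[of _ "\<lambda>e. a * b e"] exI[of _ K]) (auto simp: sum_distrib_left mult.assoc)
qed

lemma span_basis: "basis e \<in> basis_span"
proof -
  have "(\<Sum>i<Suc e. (if i = e then 1 else 0) * basis i) = (\<Sum>i<Suc e. if i = e then basis e else 0)"
    by (intro sum.cong) auto
  then have "basis e = (\<Sum>i<Suc e. (if i = e then 1 else 0) * basis i)" by simp
  then show ?thesis
    unfolding basis_span_def mem_Collect_eq
    by (intro exI[of _ "\<lambda>i. if i = e then 1 else 0"] exI[of _ "Suc e"]) auto
qed

lemma span_0: "0 \<in> basis_span" using span_mult[OF polys_0 span_basis] by simp

lemma span_uminus: "p \<in> basis_span \<Longrightarrow> - p \<in> basis_span"
  using span_mult[OF polys_uminus[OF polys_1], of p] by simp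

lemma span_diff: "p \<in> basis_span \<Longrightarrow> p' \<in> basis_span \<Longrightarrow> p - p' \<in> basis_span"
  using span_add[of p "- p'"] span_uminus[of p'] by simp

lemma span_sum: "(\<And>x. x \<in> X \<Longrightarrow> f x \<in> basis_span) \<Longrightarrow> sum f X \<in> basis_span"
  by (induction X rule: infinite_finite_induct) (auto intro: span_0 span_add)

lemma span_form: "i < n \<Longrightarrow> form i \<in> basis_span"
proof (cases "i \<le> n - 2")
  case True
  then show ?thesis using span_basis[of i] by (simp add: basis_def)
next
  case False
  assume "i < n"
  then have "i = n - 1" using False by simp
  then show ?thesis using span_basis[of N] N_gt by (simp add: basis_def)
qed

lemma span_cancel_of_nat:
  assumes "1 \<le> r" "r < n" "of_nat r * p \<in> basis_span" shows "p \<in> basis_span"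
proof -
  have "Const (inverse (of_nat r)) * (of_nat r * p) = Const (inverse (of_nat r) * of_nat r) * p"
    by (simp only: Const_mult Const_of_nat mult.assoc)
  also have "\<dots> = p" using of_nat_neq_0[OF assms(1,2)] by simp
  finally show ?thesis using span_mult[OF polys_Const assms(3)] by metis
qed

lemma bcoef_polys: "j \<noteq> 1 \<Longrightarrow> j \<le> n - 1 \<Longrightarrow> bcoef j \<in> polys AV"
  using n3 by (auto simp: bcoef_def)

lemma bcoef_1: "bcoef 1 = y" by (simp add: bcoef_def)

text \<open>
  The syzygy for \<open>i = e + 1\<close> contains \<open>y f\<^sub>e\<close> with the unit coefficient \<open>e + 2\<close>; its other terms have
  coefficients in \<open>S[z]\<close>.
\<close>

lemma span_y_form:
  assumes e: "e < n - 2"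
  shows "y * form e \<in> basis_span"
proof -
  let ?t = "\<lambda>j. of_nat (Suc e + j) * (bcoef j * form (Suc e - j))"
  have "(\<Sum>j\<le>Suc e. ?t j) = ?t 1 + (\<Sum>j\<in>{..Suc e} - {1}. ?t j)"
    by (intro sum.remove) auto
  then have "?t 1 = - (\<Sum>j\<in>{..Suc e} - {1}. ?t j)"
  proof -
    have "Suc e \<le> n - 2" using e by simp
    then show ?thesis
      using form_syzygy[of "Suc e"] \<open>(\<Sum>j\<le>Suc e. ?t j) = _\<close> by (simp only: eq_neg_iff_add_eq_0)
  qed
  also have "\<dots> \<in> basis_span"
    by (intro span_uminus span_sum span_mult of_nat_polys bcoef_polys span_form) (use e n3 in auto)
  finally have "of_nat (Suc e + 1) * (y * form e) \<in> basis_span" by (simp only: bcoef_1 diff_Suc_1)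
  then show ?thesis by (rule span_cancel_of_nat[rotated 2]) (use e in simp_all)
qed

text \<open>
  The last syzygy allows to replace \<open>z\<^sup>q G\<^bsub>n-1\<^esub>\<close> in \<open>z\<^sup>q f\<^bsub>n-1\<^esub> - y\<^sup>q f\<^bsub>n-2\<^esub>\<close> by earlier forms and \<open>y f\<^bsub>n-2\<^esub>\<close>.
  For \<open>q > 1\<close> the latter is in the basis; for \<open>q = 1\<close> it is the element in question, and its coefficients
  on the two sides differ by \<open>1\<close>.
\<close>

lemma span_y_power_form: "y ^ q * form (n - 2) \<in> basis_span"
proof -
  let ?f = "c * z ^ (q - 1) * G n (n - 1)"
  let ?T = "\<Sum>j=2..n - 1. of_nat (n - 1 + j) * (bcoef j * form (n - 1 - j))"
  have T: "?T \<in> basis_span"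
    by (intro span_sum span_mult of_nat_polys bcoef_polys span_form) (use n3 in auto)
  have zq: "z ^ q = z ^ (q - 1) * z" using q1 by (metis Suc_diff_le diff_Suc_1 One_nat_def power_Suc2)
  have "form (n - 2) = c * (z ^ q * G n (n - 2))" using n3 unfolding form_def by (subst if_P) auto
  then have eq: "y ^ q * form (n - 2) = z ^ q * form (n - 1) - z ^ (q - 1) * (z * ?f)"
    unfolding form_last zq by (simp add: algebra_simps)
  have "{1..n - 1} = insert 1 {2..n - 1}" using n3 by auto
  then have "(\<Sum>j=1..n - 1. of_nat (n - 1 + j) * (bcoef j * form (n - 1 - j)))
    = of_nat (n - 1 + 1) * (bcoef 1 * form (n - 1 - 1)) + ?T"
    by simp
  moreover have "n - 1 + 1 = n" "n - 1 - 1 = n - 2" using n3 by auto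
  ultimately have syz: "of_nat (n - 1) * (z * ?f) = - (of_nat n * (y * form (n - 2)) + ?T)"
    using form_syzygy_last by (simp only: eq_neg_iff_add_eq_0 bcoef_1)
  have "of_nat (n - 1) * (y ^ q * form (n - 2))
     = of_nat (n - 1) * (z ^ q * form (n - 1)) - z ^ (q - 1) * (of_nat (n - 1) * (z * ?f))"
    unfolding eq by (simp only: right_diff_distrib mult.left_commute)
  also have "\<dots> = of_nat (n - 1) * (z ^ q * form (n - 1)) + z ^ (q - 1) * (of_nat n * (y * form (n - 2)) + ?T)"
    by (simp only: syz mult_minus_right diff_minus_eq_add)
  finally have main: "of_nat (n - 1) * (y ^ q * form (n - 2))
     = of_nat (n - 1) * (z ^ q * form (n - 1)) + z ^ (q - 1) * (of_nat n * (y * form (n - 2)) + ?T)" .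
  have W1: "of_nat (n - 1) * (z ^ q * form (n - 1)) \<in> basis_span"
    using n3 by (intro span_mult of_nat_polys polys_power span_form) auto
  have zW: "z ^ (q - 1) \<in> polys AV" by (intro polys_power) simp
  show ?thesis
  proof (cases "q = 1")
    case True
    have q_simps: "y ^ q = y" "z ^ (q - 1) = 1" using True by simp_all
    have ring: "- f = A + T" if "m * f = A + 1 * ((m + 1) * f + T)" for m f A T :: "'k mpoly"
    proof -
      have "- f = m * f - (m + 1) * f" by (simp add: algebra_simps)
      also have "\<dots> = A + T" unfolding that by simp
      finally show ?thesis .
    qed
    have "- (y * form (n - 2)) = of_nat (n - 1) * (z ^ q * form (n - 1)) + ?T"
      using main unfolding of_nat_n q_simps by (rule ring)
    also have "\<dots> \<in> basis_span" by (intro span_add W1 T)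
    finally have "- (- (y * form (n - 2))) \<in> basis_span" by (rule span_uminus)
    then show ?thesis unfolding q_simps by simp
  next
    case False
    have "basis (n - 1) = y * form (n - 2)"
    proof -
      have "\<not> n - 1 \<le> n - 2" "n - 1 < N" "n - 1 - (n - 2) = 1" using False q1 n3 by (auto simp: N_def)
      then show ?thesis by (simp add: basis_def)
    qed
    then have "y * form (n - 2) \<in> basis_span" using span_basis[of "n - 1"] by simp
    then have "of_nat (n - 1) * (y ^ q * form (n - 2)) \<in> basis_span"
      unfolding main by (intro span_add W1 span_mult[OF zW] span_mult[OF of_nat_polys, OF \<open>y * form (n - 2) \<in> basis_span\<close>] T)
    then show ?thesis by (rule span_cancel_of_nat[rotated 2]) (use n3 in simp_all)
  qed
qed

lemma span_y_basis: "y * basis e \<in> basis_span"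
proof -
  consider "e < n - 2" | "n - 2 \<le> e" "Suc e < N" | "n - 2 \<le> e" "Suc e = N" | "N \<le> e"
    by linarith
  then show ?thesis
  proof cases
    case 1
    then show ?thesis using span_y_form by (simp add: basis_def)
  next
    case 2
    have "y * basis e = basis (Suc e)"
      using 2 by (cases "e = n - 2") (auto simp: basis_def Suc_diff_le mult.assoc)
    then show ?thesis using span_basis by simp
  next
    case 3
    have "y * basis e = y ^ q * form (n - 2)"
    proof (cases "e = n - 2")
      case True
      then have "q = 1" using 3 by (simp add: N_def)
      then have "y ^ q = y" by simp
      moreover have "basis e = form (n - 2)" using True by (simp add: basis_def)
      ultimately show ?thesis by (simp only:)
    next
      case False
      then have q: "Suc (e - (n - 2)) = q" using 3 by (simp add: N_def)
      have "basis e = y ^ (e - (n - 2)) * form (n - 2)" using 3 False by (simp add: basis_def)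
      then have "y * basis e = y ^ Suc (e - (n - 2)) * form (n - 2)" by (simp only: power_Suc mult.assoc)
      then show ?thesis unfolding q .
    qed
    then show ?thesis using span_y_power_form by simp
  next
    case 4
    have "y * basis e = basis (Suc e)"
      using 4 N_gt by (auto simp: basis_def Suc_diff_le mult.assoc)
    then show ?thesis using span_basis by simp
  qed
qed

lemma span_y: "p \<in> basis_span \<Longrightarrow> y * p \<in> basis_span"
proof -
  assume "p \<in> basis_span"
  then obtain a K where a: "p = (\<Sum>e<K. a e * basis e)" "\<forall>e. a e \<in> polys AV"
    unfolding basis_span_def by blast
  have eq: "y * p = (\<Sum>e<K. a e * (y * basis e))"
    unfolding a(1) sum_distrib_left by (intro sum.cong refl mult.left_commute)
  show ?thesis unfolding eq by (intro span_sum span_mult span_y_basis) (use a(2) in simp)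
qed

lemma span_mult_U: assumes "a \<in> polys U" "p \<in> basis_span" shows "a * p \<in> basis_span"
proof -
  have pow: "y ^ e * p \<in> basis_span" for e
  proof (induction e)
    case (Suc e)
    then show ?case using span_y[of "y ^ e * p"] by (simp only: power_Suc mult.assoc)
  qed (use assms(2) in simp)
  have "(\<Sum>e\<le>degree (to_poly (n - 1) a). coeff (to_poly (n - 1) a) e * y ^ e) * p
      = (\<Sum>e\<le>degree (to_poly (n - 1) a). coeff (to_poly (n - 1) a) e * (y ^ e * p))"
    by (simp only: sum_distrib_right mult.assoc)
  then have eq: "a * p = (\<Sum>e\<le>degree (to_poly (n - 1) a). coeff (to_poly (n - 1) a) e * (y ^ e * p))"
    unfolding expand_in_var[of a "n - 1", symmetric] .
  have "coeff (to_poly (n - 1) a) e \<in> polys AV" for e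
    using assms(1) y_notin unfolding U_eq by (rule coeff_in_polys_insert)
  then show ?thesis unfolding eq by (intro span_sum span_mult pow)
qed

lemma span_eq_base_ideal: "basis_span = I"
proof
  show "basis_span \<subseteq> I"
  proof
    fix p assume "p \<in> basis_span"
    then obtain a K where a: "p = (\<Sum>e<K. a e * basis e)" "\<forall>e. a e \<in> polys AV"
      unfolding basis_span_def by blast
    show "p \<in> I"
      unfolding a(1)
      by (intro ideal_sum_closed[OF I_ideal] ideal_mult_closed[OF I_ideal] AV_U basis_I) (use a(2) in simp)
  qed
  show "I \<subseteq> basis_span"
    unfolding ideal_gen_def by (auto simp: forms_nth intro!: span_sum span_mult_U span_form)
qed

subsection \<open>Normal forms\<close>

text \<open>
  The free \<open>S\<close>-module with basis \<open>y\<^sup>e z\<^sup>i\<close>, \<open>i < h(e)\<close>, where \<open>h\<close> is \<open>zexp\<close>.  By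
  \<open>ex_normal_form\<close> and \<open>span_Int_normal_trivial\<close> it is a complement of \<open>I\<close>.
\<close>

definition normal :: "'k mpoly set" where
  "normal = {p \<in> polys U. \<forall>m\<in>keys p. lkp m n < zexp (lkp m (n - 1))}"

lemma normal_add: "p \<in> normal \<Longrightarrow> p' \<in> normal \<Longrightarrow> p + p' \<in> normal"
  using Poly_Mapping.keys_add[of p p'] unfolding normal_def by (auto intro: polys_add)

lemma normal_uminus: "p \<in> normal \<Longrightarrow> - p \<in> normal"
  unfolding normal_def by (auto intro: polys_uminus)

lemma normal_0: "0 \<in> normal" by (simp add: normal_def)

lemma normal_mult:
  assumes a: "a \<in> polys S" and p: "p \<in> normal" shows "a * p \<in> normal"
  unfolding normal_def mem_Collect_eq
proof (intro conjI ballI)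
  show "a * p \<in> polys U" using AV_U[OF S_AV[OF a]] p by (auto simp: normal_def)
  fix m assume "m \<in> keys (a * p)"
  then obtain k l where kl: "k \<in> keys a" "l \<in> keys p" "m = k + l" using keys_mult[of a p] by blast
  have "keys k \<subseteq> S" using a kl(1) by (simp add: polys_iff)
  moreover have "n \<notin> S" "n - 1 \<notin> S" using n3 by (simp_all, linarith)
  ultimately have "n \<notin> keys k" "n - 1 \<notin> keys k" by blast+
  then have "lkp k n = 0" "lkp k (n - 1) = 0" by (simp_all add: in_keys_iff)
  then show "lkp m n < zexp (lkp m (n - 1))" using p kl by (simp add: normal_def lookup_add)
qed

lemma normal_sum: "(\<And>x. x \<in> X \<Longrightarrow> f x \<in> normal) \<Longrightarrow> sum f X \<in> normal"
  by (induction X rule: infinite_finite_induct) (auto intro: normal_0 normal_add)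

text \<open>
  Division by the basis elements, from the highest power of \<open>y\<close> down.
\<close>

lemma ex_normal_form:
  assumes "p \<in> polys U"
  shows "\<exists>r\<in>normal. p - r \<in> basis_span"
proof -
  have "\<exists>r\<in>normal. p - r \<in> basis_span" if "p \<in> polys U" "\<forall>e\<ge>d. coeff (to_poly (n - 1) p) e = 0" for d p
    using that
  proof (induction d arbitrary: p)
    case 0
    then have "to_poly (n - 1) p = 0" by (intro poly_eqI) auto
    then have "p = 0" by simp
    then show ?case using normal_0 span_0 by (intro bexI[of _ 0]) auto
  next
    case (Suc d)
    define a where "a = coeff (to_poly (n - 1) p) d"
    have a: "a \<in> polys AV"
      unfolding a_def using Suc.prems(1) y_notin unfolding U_eq by (rule coeff_in_polys_insert)
    obtain a1 a0 where a01: "a1 \<in> polys AV" "a0 \<in> polys AV" "a = z ^ zexp d * a1 + a0"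
      "\<forall>m\<in>keys a0. lkp m n < zexp d"
      using ex_division_by_Var_power[OF a, of n "zexp d"] by blast
    obtain u where u: "u \<noteq> 0" "coeff (to_poly (n - 1) (basis d)) d = Const u * z ^ zexp d"
      using basis_coeff by blast
    define w where "w = (Const (inverse u) * a1) * basis d"
    have w: "w \<in> basis_span" unfolding w_def using a01 by (intro span_mult span_basis polys_mult) auto
    define r0 where "r0 = a0 * y ^ d"
    have r0: "r0 \<in> normal"
      unfolding normal_def mem_Collect_eq
    proof (intro conjI ballI)
      show "r0 \<in> polys U" unfolding r0_def using AV_U[OF a01(2)] n3 by (intro polys_mult polys_power) auto
      fix m assume "m \<in> keys r0"
      then obtain m' where m': "m' \<in> keys a0" "m = m' + sgl (n - 1) d"
        unfolding r0_def by (rule keys_mult_Var_powerE)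
      have "keys m' \<subseteq> AV" using a01(2) m'(1) by (simp add: polys_iff)
      then have "n - 1 \<notin> keys m'" using y_notin by blast
      then have "lkp m' (n - 1) = 0" by (simp add: in_keys_iff)
      moreover have "n - 1 \<noteq> n" using n3 by simp
      ultimately show "lkp m n < zexp (lkp m (n - 1))"
        using a01(4) m' by (simp add: lookup_add lookup_single when_def)
    qed
    define p' where "p' = p - w - r0"
    have ca: "Const (inverse u) * a1 \<in> polys AV" using a01 by auto
    have cw: "coeff (to_poly (n - 1) w) e = (Const (inverse u) * a1) * coeff (to_poly (n - 1) (basis d)) e" for e
      unfolding w_def by (rule coeff_const_mult[OF ca y_notin])
    have cr: "coeff (to_poly (n - 1) r0) e = (if e = d then a0 else 0)" for e
      unfolding r0_def using coeff_const_mult[OF a01(2) y_notin, of "y ^ d" e]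
      by (simp add: to_poly.hom_power monom_altdef[symmetric, of 1, simplified])
    have "coeff (to_poly (n - 1) p') e = 0" if "e \<ge> d" for e
    proof (cases "e = d")
      case True
      have "(Const (inverse u) * a1) * (Const u * z ^ zexp d) = (Const (inverse u) * Const u) * (z ^ zexp d * a1)"
        by (simp only: mult_ac)
      also have "Const (inverse u) * Const u = 1" using u(1) by (simp flip: Const_mult)
      finally have "(Const (inverse u) * a1) * (Const u * z ^ zexp d) = z ^ zexp d * a1" by simp
      then show ?thesis
        using a01(3) u(2) unfolding True p'_def by (simp add: to_poly.hom_minus cw cr flip: a_def)
    next
      case False
      then have e: "e > d" using that by simp
      then have "coeff (to_poly (n - 1) (basis d)) e = 0" using basis_degree[of d] by (intro coeff_eq_0) auto
      then show ?thesis using Suc.prems(2) e False unfolding p'_def by (simp add: to_poly.hom_minus cw cr)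
    qed
    moreover have "p' \<in> polys U"
      unfolding p'_def using Suc.prems(1) r0 w span_eq_base_ideal ideal_sub_polys[OF I_ideal]
      by (intro polys_diff) (auto simp: normal_def)
    ultimately obtain r where r: "r \<in> normal" "p' - r \<in> basis_span" using Suc.IH[of p'] by blast
    have eq: "p - (r + r0) = (p' - r) + w" by (simp add: p'_def)
    have "p - (r + r0) \<in> basis_span" unfolding eq by (rule span_add[OF r(2) w])
    then show ?case using normal_add[OF r(1) r0] by blast
  qed
  from this[of p "Suc (degree (to_poly (n - 1) p))"] assms show ?thesis
    by (auto simp: coeff_eq_0)
qed

text \<open>
  The leading coefficient in \<open>y\<close> of a nonzero combination of the basis is divisible by \<open>z\<^bsup>h(d)\<^esup>\<close>, where
  \<open>d\<close> is its degree.
\<close>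

lemma span_Int_normal_trivial:
  assumes "w \<in> basis_span" "w \<in> normal" shows "w = 0"
proof (rule ccontr)
  assume "w \<noteq> 0"
  obtain a K where a: "w = (\<Sum>e<K. a e * basis e)" "\<forall>e. a e \<in> polys AV"
    using assms(1) unfolding basis_span_def by blast
  define X where "X = {e. e < K \<and> a e \<noteq> 0}"
  have "X \<noteq> {}"
  proof
    assume "X = {}"
    then have "w = 0" unfolding a(1) by (intro sum.neutral) (auto simp: X_def)
    then show False using \<open>w \<noteq> 0\<close> by simp
  qed
  moreover have fin: "finite X" by (simp add: X_def)
  ultimately have Max: "Max X \<in> X" by (rule Max_in[rotated])
  define d where "d = Max X"
  have d: "d < K" "a d \<noteq> 0" using Max by (auto simp: d_def X_def)
  have above: "a e = 0" if "d < e" "e < K" for e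
  proof (rule ccontr)
    assume "a e \<noteq> 0"
    then have "e \<in> X" using that by (simp add: X_def)
    then have "e \<le> d" unfolding d_def by (rule Max_ge[OF fin])
    then show False using that by simp
  qed
  obtain u where u: "u \<noteq> 0" "coeff (to_poly (n - 1) (basis d)) d = Const u * z ^ zexp d"
    using basis_coeff by blast
  have "coeff (to_poly (n - 1) w) d = (\<Sum>e<K. a e * coeff (to_poly (n - 1) (basis e)) d)"
    unfolding a(1) to_poly.hom_sum coeff_sum
    by (intro sum.cong refl coeff_const_mult[OF _ y_notin]) (use a(2) in auto)
  also have "\<dots> = (\<Sum>e<K. if e = d then a d * (Const u * z ^ zexp d) else 0)"
  proof (intro sum.cong refl)
    fix e assume "e \<in> {..<K}"
    then show "a e * coeff (to_poly (n - 1) (basis e)) d = (if e = d then a d * (Const u * z ^ zexp d) else 0)"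
      using above[of e] u(2) basis_degree[of e] by (cases e d rule: linorder_cases) (auto simp: coeff_eq_0)
  qed
  also have "\<dots> = (a d * Const u) * z ^ zexp d" using d(1) by (simp add: mult.assoc)
  finally have cf: "coeff (to_poly (n - 1) w) d = (a d * Const u) * z ^ zexp d" .
  have "coeff (to_poly (n - 1) w) d \<noteq> 0" unfolding cf using d(2) u(1) by simp
  then obtain m where m: "m \<in> keys (coeff (to_poly (n - 1) w) d)" by (metis keys_eq_empty ex_in_conv)
  then obtain m' where "m' \<in> keys (a d * Const u)" "m = m' + sgl n (zexp d)"
    unfolding cf by (rule keys_mult_Var_powerE)
  then have mz: "lkp m n \<ge> zexp d" by (simp add: lookup_add)
  have "lkp m (n - 1) = 0" and key: "m + sgl (n - 1) d \<in> keys w"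
    using m by (auto simp: in_keys_iff lookup_coeff_to_poly split: if_splits)
  then have "lkp (m + sgl (n - 1) d) n < zexp (lkp (m + sgl (n - 1) d) (n - 1))"
    using assms(2) unfolding normal_def by blast
  moreover have "n - 1 \<noteq> n" using n3 by simp
  ultimately show False
    using mz \<open>lkp m (n - 1) = 0\<close> by (simp add: lookup_add lookup_single when_def)
qed

text \<open>
  Freeness of \<open>k[x\<^sub>1, \<dots>, x\<^sub>n]/I\<close> over \<open>S\<close> in action: a nonzerodivisor modulo an ideal \<open>J\<close> of \<open>S\<close>
  stays one modulo \<open>I + J\<close>.  Since multiplication by elements of \<open>S\<close> preserves normal forms, the
  relation \<open>a p \<in> I + J\<close> can be replaced by one between normal forms, in which \<open>I\<close> does not occur any
  more.
\<close>

lemma nzd_mod_base_ideal: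
  assumes bs: "set bs \<subseteq> polys S" and a: "a \<in> polys S"
    and nzd: "\<And>b. b \<in> polys S \<Longrightarrow> a * b \<in> ideal_gen S bs \<Longrightarrow> b \<in> ideal_gen S bs"
    and p: "p \<in> polys U" "a * p = w + j" "w \<in> I" "j \<in> ideal_gen U bs"
  shows "\<exists>w\<in>I. \<exists>j\<in>ideal_gen U bs. p = w + j"
proof -
  have aU: "a \<in> polys U" using AV_U[OF S_AV[OF a]] .
  have bsA: "set bs \<subseteq> polys AV" using bs S_AV by blast
  have bsU: "set bs \<subseteq> polys U" using bsA AV_U by blast
  obtain r where r: "r \<in> normal" "p - r \<in> basis_span" using ex_normal_form[OF p(1)] by blast
  obtain b where b: "j = (\<Sum>i<length bs. b i * bs ! i)" "\<forall>i<length bs. b i \<in> polys U"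
    using p(4) by (auto simp: ideal_gen_def)
  have "\<forall>i. \<exists>s. i < length bs \<longrightarrow> s \<in> normal \<and> b i - s \<in> basis_span"
    using ex_normal_form b(2) by blast
  then obtain s where s: "\<And>i. i < length bs \<Longrightarrow> s i \<in> normal" "\<And>i. i < length bs \<Longrightarrow> b i - s i \<in> basis_span"
    by metis
  define j0 where "j0 = (\<Sum>i<length bs. s i * bs ! i)"
  have bsi: "bs ! i \<in> polys S" if "i < length bs" for i using bs that by auto
  have j0_NF: "j0 \<in> normal"
    unfolding j0_def
  proof (rule normal_sum)
    fix i assume "i \<in> {..<length bs}"
    then have "bs ! i * s i \<in> normal" using s(1) bsi by (intro normal_mult) auto
    then show "s i * bs ! i \<in> normal" by (simp only: mult.commute)
  qed
  have j0_J: "j0 \<in> ideal_gen U bs"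
    unfolding j0_def ideal_gen_def using s(1) by (auto simp: normal_def)
  have "j - j0 = (\<Sum>i<length bs. bs ! i * (b i - s i))"
    by (simp add: b(1) j0_def sum_subtractf[symmetric] algebra_simps)
  then have jj: "j - j0 \<in> basis_span"
    using bsi s(2) S_AV by (auto intro!: span_sum span_mult)
  have "a * r - j0 = w + (j - j0) - a * (p - r)" using p(2) by (simp add: algebra_simps)
  also have "\<dots> \<in> basis_span"
    using p(3) unfolding span_eq_base_ideal[symmetric] by (intro span_diff[OF span_add[OF _ jj] span_mult[OF S_AV[OF a] r(2)]])
  finally have "a * r - j0 \<in> basis_span" .
  moreover have "a * r - j0 \<in> normal"
    using normal_add[OF normal_mult[OF a r(1)] normal_uminus[OF j0_NF]] by simp
  ultimately have ar: "a * r = j0" using span_Int_normal_trivial by fastforce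
  have "b \<in> ideal_gen AV bs" if "b \<in> polys AV" "a * b \<in> ideal_gen AV bs" for b
    using nzd_insert[OF z_notin bs a nzd that] .
  then have "r \<in> ideal_gen U bs"
    using nzd_insert[OF y_notin bsA S_AV[OF a], of r] r(1) j0_J ar unfolding U_eq by (auto simp: normal_def U_eq)
  then show ?thesis using r(2) unfolding span_eq_base_ideal by (intro bexI[of _ "p - r"] bexI[of _ r]) auto
qed

subsection \<open>Primes over the base ideal\<close>

definition kill :: "nat set \<Rightarrow> 'k mpoly \<Rightarrow> 'k mpoly" where
  "kill X = subst (\<lambda>i. if i \<in> X then 0 else Var i)"

lemma comm_ring_hom_kill: "comm_ring_hom (kill X)"
  unfolding kill_def by (rule subst.comm_ring_hom_axioms)

text \<open>
  The ideal generated by the variables with index in \<open>X\<close>, presented as the kernel of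
  setting them to \<open>0\<close>, which makes it prime at once.
\<close>

definition killed :: "nat set \<Rightarrow> 'k mpoly set" where
  "killed X = {p \<in> polys U. kill X p = 0}"

lemma prime_killed: "primeideal (killed X) (poly_ring U)"
  unfolding killed_def by (rule primeideal_kernel[OF comm_ring_hom_kill])

lemma kill_Var: "kill X (Var i) = (if i \<in> X then 0 else Var i)"
  by (simp add: kill_def)

lemma killed_mono: assumes "X \<subseteq> Y" shows "killed X \<subseteq> killed Y"
proof -
  have eq: "kill Y (kill X p) = kill Y p" for p
    using assms unfolding kill_def subst_subst
    by (intro subst_cong[of p UNIV]) (auto simp: polys_def)
  interpret Y: comm_ring_hom "kill Y" by (rule comm_ring_hom_kill)
  show ?thesis
  proof
    fix p assume p: "p \<in> killed X"
    then have "kill Y (kill X p) = 0" by (simp add: killed_def)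
    then show "p \<in> killed Y" using p by (simp add: killed_def eq)
  qed
qed

lemma killed_strict_mono:
  assumes "X \<subseteq> Y" "v \<in> Y - X" "v \<in> U" shows "killed X \<subset> killed Y"
proof -
  have "Var v \<in> killed Y - killed X" using assms by (auto simp: killed_def kill_Var)
  then show ?thesis using killed_mono[OF assms(1)] by blast
qed

text \<open>
  By \<open>drop_var_G\<close>, the residue modulo \<open>z\<close> is \<open>\<plusminus>(n - 1) y\<^bsup>n-2+q\<^esup>\<close>, and for \<open>q = 1\<close> there is the additional
  term \<open>\<minusplus>n y\<^bsup>n-1\<^esup>\<close>; the coefficient is a unit in both cases.
\<close>

lemma drop_var_form_last:
  "\<exists>u. u \<noteq> 0 \<and> drop_var n (form (n - 1)) = Const u * (y ^ q * (- y) ^ (n - 2))"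
proof -
  have n2: "n \<ge> 2" using n3 by simp
  obtain c' where c': "c = Const c'" "c' \<noteq> 0" by (rule c_Const)
  have n1: "n - 1 \<noteq> n" using n3 by simp
  have dc: "drop_var n c = c" using drop_var_ident[OF c_polys, where V = "{}" and v = n] by simp
  have "drop_var n (form (n - 1)) = c * ((if q = 1 then 1 else 0) * (of_nat (n - 1 + 1) * (- y) ^ (n - 1))
      + y ^ q * (of_nat (n - 2 + 1) * (- y) ^ (n - 2)))"
    unfolding form_last drop_var.hom_mult drop_var.hom_add drop_var.hom_power drop_var_Var drop_var_G[OF n2] dc
    using q1 n1 by (auto simp: power_0_left)
  also have "n - 1 + 1 = n" using n3 by simp
  also have "n - 2 + 1 = n - 1" using n3 by simp
  finally have eq: "drop_var n (form (n - 1)) = c * ((if q = 1 then 1 else 0) * (of_nat n * (- y) ^ (n - 1))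
      + y ^ q * (of_nat (n - 1) * (- y) ^ (n - 2)))" .
  show ?thesis
  proof (cases "q = 1")
    case True
    have "n - 1 = Suc (n - 2)" using n3 by simp
    then have pw: "(- y) ^ (n - 1) = - y * (- y) ^ (n - 2)" by (metis power_Suc)
    have ring: "c * (1 * ((a + 1) * (- y * P)) + y ^ 1 * (a * P)) = - c * (y ^ 1 * P)" for a P :: "'k mpoly"
      by (simp add: algebra_simps)
    have q_simps: "(if q = 1 then 1 else 0) = (1 :: 'k mpoly)" "y ^ q = y ^ 1" using True by simp_all
    have "drop_var n (form (n - 1)) = - c * (y ^ q * (- y) ^ (n - 2))"
      unfolding eq pw of_nat_n q_simps by (rule ring)
    then show ?thesis using c' by (intro exI[of _ "- c'"]) (simp add: Const_uminus)
  next
    case False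
    then have "drop_var n (form (n - 1)) = (c * of_nat (n - 1)) * (y ^ q * (- y) ^ (n - 2))"
      unfolding eq by (simp add: mult_ac)
    then show ?thesis using c' of_nat_neq_0[of "n - 1"] n3
      by (intro exI[of _ "c' * of_nat (n - 1)"]) (simp only: Const_mult Const_of_nat, simp)
  qed
qed

lemma yz_in_prime:
  assumes Q: "primeideal Q (poly_ring U)" and IQ: "I \<subseteq> Q"
  shows "y \<in> Q" "z \<in> Q"
proof -
  have QI: "ideal Q (poly_ring U)" using Q by (simp add: primeideal_poly_ring_iff)
  have yU: "y \<in> polys U" and zU: "z \<in> polys U" using n3 by auto
  have "form 0 \<in> Q" using form_I[of 0] n3 IQ by auto
  then have "c * form 0 \<in> Q" by (rule ideal_mult_closed[OF QI c_polys])
  moreover have "c * form 0 = z ^ (n - 2 + q)"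
    unfolding form_0 mult.assoc[symmetric] c_mult_self by simp
  ultimately have "z ^ (n - 2 + q) \<in> Q" by simp
  then show z: "z \<in> Q" by (rule prime_power_mem[OF Q zU])
  have n1: "n - 1 < n" using n3 by simp
  obtain r where r: "form (n - 1) - z * r = drop_var n (form (n - 1))" "r \<in> polys U"
    using drop_var_remainder[OF form_polys[OF n1], of n] by blast
  have "form (n - 1) \<in> Q" using form_I[OF n1] IQ by blast
  moreover have "r * z \<in> Q" by (rule ideal_mult_closed[OF QI r(2) z])
  ultimately have "form (n - 1) - r * z \<in> Q" by (rule ideal_diff_closed[OF QI])
  then have "drop_var n (form (n - 1)) \<in> Q" unfolding r(1)[symmetric] by (simp only: mult.commute)
  then obtain u where "u \<noteq> 0" "Const u * (y ^ q * (- y) ^ (n - 2)) \<in> Q"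
    using drop_var_form_last by auto
  then have "y ^ q * (- y) ^ (n - 2) \<in> Q" using ideal_Const_mult_cancel[OF QI] by blast
  moreover have "y ^ q \<in> polys U" "(- y) ^ (n - 2) \<in> polys U"
    using yU by (auto intro!: polys_power polys_uminus)
  ultimately have "y ^ q \<in> Q \<or> (- y) ^ (n - 2) \<in> Q"
    using Q unfolding primeideal_poly_ring_iff by blast
  then have "y \<in> Q \<or> - y \<in> Q"
    using prime_power_mem[OF Q yU] prime_power_mem[OF Q polys_uminus[OF yU]] by blast
  then show "y \<in> Q" using ideal_uminus_closed[OF QI, of "- y"] by auto
qed

lemma I_killed: "I \<subseteq> killed {n - 1, n}"
proof -
  let ?P = "killed {n - 1, n}"
  interpret k: comm_ring_hom "kill {n - 1, n}" by (rule comm_ring_hom_kill)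
  have form: "form i \<in> ?P" if i: "i < n" for i
  proof -
    have "kill {n - 1, n} (form i) = 0"
    proof (cases "i < n - 1")
      case True
      then have "i \<le> n - 2" by simp
      then show ?thesis using q1
        by (simp add: form_low k.hom_mult k.hom_power kill_Var power_0_left)
    next
      case False
      have n2: "n \<ge> 2" "n - 1 \<noteq> 0" using n3 by simp_all
      obtain r where r: "G n (n - 1) - z * r = drop_var n (G n (n - 1) :: 'k mpoly)"
        using drop_var_remainder[of "G n (n - 1) :: 'k mpoly" UNIV n] by (auto simp: polys_def)
      have "kill {n - 1, n} (G n (n - 1)) - 0 * kill {n - 1, n} r
         = of_nat (n - 1 + 1) * (- 0) ^ (n - 1)"
        using arg_cong[OF r, of "kill {n - 1, n}"] unfolding drop_var_G[OF n2(1)]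
        by (simp only: k.hom_minus k.hom_mult k.hom_power k.hom_uminus k.hom_of_nat kill_Var insertCI if_True insert_iff simp_thms)
      then have "kill {n - 1, n} (G n (n - 1)) = 0"
        using n2(2) by (simp add: power_0_left)
      then show ?thesis using False q1
        by (simp add: form_def k.hom_mult k.hom_add k.hom_power kill_Var zero_power)
    qed
    then show ?thesis using form_polys[OF i] by (simp add: killed_def)
  qed
  have "ideal ?P (poly_ring U)" using prime_killed by (simp add: primeideal_poly_ring_iff)
  then show ?thesis
    unfolding ideal_gen_def using form
    by (auto simp: forms_nth intro!: ideal_sum_closed[of ?P U] ideal_mult_closed[of ?P U])
qed

lemma killed_n_subset:
  assumes Q: "ideal Q (poly_ring U)" and z: "z \<in> Q" shows "killed {n} \<subseteq> Q"
proof
  fix p assume p: "p \<in> killed {n}"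
  have "p \<in> polys U" using p by (simp add: killed_def)
  from drop_var_remainder[OF this, of n] obtain r where r: "p - z * r = drop_var n p" "r \<in> polys U" by blast
  have "drop_var n p = kill {n} p"
    by (rule hom_eqI[OF drop_var.comm_ring_hom_axioms comm_ring_hom_kill, of p UNIV])
      (auto simp: polys_def drop_var_Var kill_Var, simp add: drop_var_def kill_def)
  then have "p = r * z" using p r by (simp add: killed_def mult.commute)
  then show "p \<in> Q" using ideal_mult_closed[OF Q r(2) z] by simp
qed

text \<open>
  A chain of primes over \<open>I\<close> can be prolonged at its beginning by \<open>0 \<subset> (z)\<close>, since \<open>(z)\<close> is properly
  contained in each prime that contains \<open>y\<close> and \<open>z\<close>.
\<close>

lemma chain_over_I_bound:
  assumes Q: "\<And>i. i \<le> r \<Longrightarrow> primeideal (Q i) (poly_ring U)"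
    and strict: "\<And>i. i < r \<Longrightarrow> Q i \<subset> Q (Suc i)" and I0: "I \<subseteq> Q 0"
  shows "r \<le> n - 2"
proof -
  define Q' where "Q' i = (if i = 0 then killed {} else if i = 1 then killed {n} else Q (i - 2))" for i :: nat
  have Q0: "ideal (Q 0) (poly_ring U)" using Q[of 0] by (simp add: primeideal_poly_ring_iff)
  have yz: "y \<in> Q 0" "z \<in> Q 0" using yz_in_prime[OF Q[of 0] I0] by auto
  have "y \<notin> killed {n}" using n3 by (auto simp: killed_def kill_Var)
  then have s1: "killed {n} \<subset> Q 0" using killed_n_subset[OF Q0 yz(2)] yz(1) by blast
  have "r + 2 \<le> card U"
  proof (rule prime_chain_length_le)
    fix i assume "i \<le> r + 2"
    then show "primeideal (Q' i) (poly_ring U)" using Q[of "i - 2"] by (simp add: Q'_def prime_killed)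
  next
    fix i assume i: "i < r + 2"
    consider "i = 0" | "i = 1" | "i \<ge> 2" by linarith
    then show "Q' i \<subset> Q' (Suc i)"
    proof cases
      case 1
      then show ?thesis using killed_strict_mono[of "{}" "{n}" n] n3 by (simp add: Q'_def)
    next
      case 2
      then show ?thesis using s1 by (simp add: Q'_def)
    next
      case 3
      then have "Suc i - 2 = Suc (i - 2)" by simp
      then have "Q' i = Q (i - 2)" "Q' (Suc i) = Q (Suc (i - 2))" using 3 by (simp_all add: Q'_def)
      moreover have "i - 2 < r" using i 3 by simp
      ultimately show ?thesis using strict[of "i - 2"] by simp
    qed
  qed simp
  then show ?thesis by simp
qed

text \<open>
  Upper bound: a chain of primes that ends at \<open>(y, z)\<close> can be continued by adding the other \<open>n - 2\<close>
  variables one at a time.  Lower bound: \<open>0 \<subset> (z)\<close> lies below each prime over \<open>I\<close>.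
\<close>

lemma ideal_height_I: "ideal_height (poly_ring U) I = 2"
proof (rule antisym)
  have "prime_height (poly_ring U) (killed {n - 1, n}) \<le> enat 2"
  proof (rule prime_height_le)
    fix Q r assume Q: "\<And>i. i \<le> r \<Longrightarrow> primeideal (Q i) (poly_ring U :: 'k mpoly ring)"
      and strict: "\<And>i. i < r \<Longrightarrow> Q i \<subset> Q (Suc i)" and last: "Q r = killed {n - 1, n}"
    define Q' where "Q' i = (if i \<le> r then Q i else killed ({n - 1, n} \<union> {1..i - r}))" for i
    have Q'_r: "Q' i = killed ({n - 1, n} \<union> {1..i - r})" if "i \<ge> r" for i
      using that last by (auto simp: Q'_def)
    have "r + (n - 2) \<le> card U"
    proof (rule prime_chain_length_le)
      fix i assume "i \<le> r + (n - 2)"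
      then show "primeideal (Q' i) (poly_ring U)" using Q by (simp add: Q'_def prime_killed)
    next
      fix i assume i: "i < r + (n - 2)"
      show "Q' i \<subset> Q' (Suc i)"
      proof (cases "i < r")
        case True
        then show ?thesis using strict by (simp add: Q'_def)
      next
        case False
        then have "i \<ge> r" by simp
        have "Suc i - r \<in> {n - 1, n} \<union> {1..Suc i - r} - ({n - 1, n} \<union> {1..i - r})"
          using i \<open>i \<ge> r\<close> n3 by auto
        moreover have "{n - 1, n} \<union> {1..i - r} \<subseteq> {n - 1, n} \<union> {1..Suc i - r}" by auto
        moreover have "Suc i - r \<in> U" using i \<open>i \<ge> r\<close> by auto
        ultimately show ?thesis
          unfolding Q'_r[OF \<open>i \<ge> r\<close>] Q'_r[OF le_SucI[OF \<open>i \<ge> r\<close>]] by (intro killed_strict_mono)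
      qed
    qed simp
    then show "r \<le> 2" using n3 by simp
  qed
  then have "prime_height (poly_ring U) (killed {n - 1, n}) \<le> 2" by (simp add: numeral_eq_enat)
  moreover have "ideal_height (poly_ring U) I \<le> prime_height (poly_ring U) (killed {n - 1, n})"
    unfolding ideal_height_def using prime_killed I_killed by (intro Inf_lower) auto
  ultimately show "ideal_height (poly_ring U) I \<le> 2" by (rule order_trans[rotated])
next
  show "2 \<le> ideal_height (poly_ring U) I"
    unfolding ideal_height_def
  proof (rule Inf_greatest, clarify)
    fix P assume P: "primeideal P (poly_ring U)" "I \<subseteq> P"
    define Q where "Q i = (if i = 0 then killed {} else if i = 1 then killed {n} else P)" for i :: nat
    have PI: "ideal P (poly_ring U)" using P by (simp add: primeideal_poly_ring_iff)
    have yz: "y \<in> P" "z \<in> P" using yz_in_prime[OF P] by auto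
    have "y \<notin> killed {n}" using n3 by (auto simp: killed_def kill_Var)
    then have s1: "killed {n} \<subset> P" using killed_n_subset[OF PI yz(2)] yz(1) by blast
    have "enat 2 \<le> prime_height (poly_ring U) P"
    proof (rule prime_height_ge[where Q = Q])
      fix i :: nat
      show "primeideal (Q i) (poly_ring U)" using P by (auto simp: Q_def prime_killed)
      assume "i < 2"
      then show "Q i \<subset> Q (Suc i)"
        using killed_strict_mono[of "{}" "{n}" n] n3 s1 by (cases i) (auto simp: Q_def)
    qed (simp add: Q_def)
    then show "2 \<le> prime_height (poly_ring U) P" by (simp add: numeral_eq_enat)
  qed
qed

end

section \<open>The quotient by the base ideal is Cohen--Macaulay\<close>

text \<open>
  Membership in an ideal of \<open>k[V]/I\<close> given by residue classes is membership of a representative in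
  the sum of two ideals of \<open>k[V]\<close>; this is how the results on \<open>I\<close> reach the quotient.
\<close>

lemma mem_Idl_Quot_iff:
  fixes I :: "'k::field mpoly set"
  assumes I: "ideal I (poly_ring V)" and bs: "set bs \<subseteq> polys V" and x: "x \<in> polys V"
  shows "I +>\<^bsub>poly_ring V\<^esub> x \<in> Idl\<^bsub>poly_ring V Quot I\<^esub> (set (map ((+>\<^bsub>poly_ring V\<^esub>) I) bs)) \<longleftrightarrow>
    (\<exists>w\<in>I. \<exists>j\<in>ideal_gen V bs. x = w + j)"
proof -
  let ?R = "poly_ring V :: 'k mpoly ring"
  let ?T = "?R Quot I"
  let ?h = "(+>\<^bsub>?R\<^esub>) I"
  interpret R: cring ?R by (rule cring_poly_ring)
  interpret I: ideal I ?R by (rule I)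
  interpret h: ring_hom_ring ?R ?T ?h by (rule I.rcos_ring_hom_ring)
  have sub: "set (map ?h bs) \<subseteq> carrier ?T" using bs h.hom_closed by auto
  have J: "ideal (ideal_gen V bs) ?R" by (rule ideal_ideal_gen[OF bs])
  have h_eq: "?h a = ?h b \<longleftrightarrow> a - b \<in> I" if "a \<in> polys V" "b \<in> polys V" for a b
  proof -
    have "a \<ominus>\<^bsub>?R\<^esub> b = a - b"
      using that a_inv_poly_ring[of b V] by (simp add: a_minus_def)
    then show ?thesis using R.quotient_eq_iff_same_a_r_cos[OF I, of a b] that by simp
  qed
  define K where "K = {w + j |w j. w \<in> I \<and> j \<in> ideal_gen V bs}"
  have K: "ideal K ?R"
  proof -
    have "K = I <+>\<^bsub>?R\<^esub> ideal_gen V bs" by (auto simp: K_def set_add_def')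
    then show ?thesis using R.add_ideals[OF I J] by simp
  qed
  show ?thesis
  proof
    assume L: "?h x \<in> Idl\<^bsub>?T\<^esub> (set (map ?h bs))"
    have "set (map ?h bs) \<subseteq> ?h ` K"
      using ideal_gen_self[OF _ bs] ideal_0[OF I] by (force simp: K_def)
    then have "Idl\<^bsub>?T\<^esub> (set (map ?h bs)) \<subseteq> ?h ` K"
      by (rule h.S.genideal_minimal[OF R.ring_ideal_imp_quot_ideal[OF I K]])
    then obtain k where k: "k \<in> K" "?h x = ?h k" using L by blast
    have "k \<in> polys V" using k ideal_sub_polys[OF K] by auto
    then have "x - k \<in> I" using k(2) h_eq[OF x] by simp
    moreover obtain w j where wj: "w \<in> I" "j \<in> ideal_gen V bs" "k = w + j" using k by (auto simp: K_def)
    ultimately have "(x - k) + w \<in> I" using ideal_add_closed[OF I] by blast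
    moreover have "x = ((x - k) + w) + j" using wj by simp
    ultimately show "\<exists>w\<in>I. \<exists>j\<in>ideal_gen V bs. x = w + j" using wj(2) by blast
  next
    assume "\<exists>w\<in>I. \<exists>j\<in>ideal_gen V bs. x = w + j"
    then obtain w j where wj: "w \<in> I" "j \<in> ideal_gen V bs" "x = w + j" by blast
    have jV: "j \<in> polys V" using wj ideal_sub_polys[OF J] by auto
    have "ideal {r \<in> carrier ?R. ?h r \<in> Idl\<^bsub>?T\<^esub> (set (map ?h bs))} ?R"
      by (rule h.ideal_vimage[OF h.S.genideal_ideal[OF sub]])
    moreover have "set bs \<subseteq> {r \<in> carrier ?R. ?h r \<in> Idl\<^bsub>?T\<^esub> (set (map ?h bs))}"
      using bs h.S.genideal_self[OF sub] by auto
    ultimately have "Idl\<^bsub>?R\<^esub> (set bs) \<subseteq> {r \<in> carrier ?R. ?h r \<in> Idl\<^bsub>?T\<^esub> (set (map ?h bs))}"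
      by (rule R.genideal_minimal)
    then have "?h j \<in> Idl\<^bsub>?T\<^esub> (set (map ?h bs))" using wj(2) by (auto simp: ideal_gen_eq_Idl[OF bs])
    moreover have "?h x = ?h j" using h_eq[OF x jV] wj by simp
    ultimately show "?h x \<in> Idl\<^bsub>?T\<^esub> (set (map ?h bs))" by simp
  qed
qed

context sub_hankel_map
begin

abbreviation "R \<equiv> poly_ring U :: 'k mpoly ring"
abbreviation "T \<equiv> R Quot I"
abbreviation "res \<equiv> (+>\<^bsub>R\<^esub>) I"

lemma cring_T: "cring T"
  using ideal.quotient_is_cring[OF I_ideal cring_poly_ring] .

lemma res_hom: "ring_hom_ring R T res"
  using ideal.rcos_ring_hom_ring[OF I_ideal] .

lemma T_carrier: "x \<in> carrier T \<Longrightarrow> \<exists>p\<in>polys U. x = res p"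
  by (auto simp: FactRing_def A_RCOSETS_def')

lemma vimage_prime:
  assumes "primeideal M T"
  shows "primeideal {p \<in> polys U. res p \<in> M} R" "I \<subseteq> {p \<in> polys U. res p \<in> M}"
proof -
  interpret R: cring R by (rule cring_poly_ring)
  interpret I: ideal I R by (rule I_ideal)
  interpret h: ring_hom_ring R T res by (rule res_hom)
  show "primeideal {p \<in> polys U. res p \<in> M} R"
    using h.primeideal_vimage[OF R.is_cring assms] by simp
  have "M \<noteq> {}" using primeideal.axioms(1)[OF assms] additive_subgroup.zero_closed ideal.axioms(1) by blast
  have "ideal M T" using primeideal.axioms(1)[OF assms] .
  then have "\<zero>\<^bsub>T\<^esub> \<in> M" by (meson additive_subgroup.zero_closed ideal.axioms(1))
  then have IM: "I \<in> M" by (simp add: FactRing_def)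
  show "I \<subseteq> {p \<in> polys U. res p \<in> M}"
  proof
    fix p assume p: "p \<in> I"
    then have "res p = I" by (rule I.a_rcos_const)
    then show "p \<in> {p \<in> polys U. res p \<in> M}" using IM p ideal_sub_polys[OF I_ideal] by auto
  qed
qed

lemma prime_height_T_le:
  assumes M: "primeideal M T" shows "prime_height T M \<le> enat (n - 2)"
proof (rule prime_height_le)
  fix Q r assume Q: "\<And>i. i \<le> r \<Longrightarrow> primeideal (Q i) T"
    and strict: "\<And>i. i < r \<Longrightarrow> Q i \<subset> Q (Suc i)" and "Q r = M"
  show "r \<le> n - 2"
  proof (rule chain_over_I_bound[where Q = "\<lambda>i. {p \<in> polys U. res p \<in> Q i}"])
    show "primeideal {p \<in> polys U. res p \<in> Q i} R" if "i \<le> r" for i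
      by (rule vimage_prime(1)[OF Q[OF that]])
    show "I \<subseteq> {p \<in> polys U. res p \<in> Q 0}" by (rule vimage_prime(2)[OF Q]) simp
    fix i assume i: "i < r"
    obtain x where x: "x \<in> Q (Suc i)" "x \<notin> Q i" using strict[OF i] by blast
    have "Q (Suc i) \<subseteq> carrier T"
      using Q[of "Suc i"] i by (meson Suc_leI additive_subgroup.a_subset ideal.axioms(1) primeideal.axioms(1))
    then obtain p where "p \<in> polys U" "x = res p" using T_carrier x(1) by blast
    then show "{p \<in> polys U. res p \<in> Q i} \<subset> {p \<in> polys U. res p \<in> Q (Suc i)}"
      using x strict[OF i] by blast
  qed
qed

text \<open>
  By \<open>yz_in_prime\<close>, \<open>y\<close> and \<open>z\<close> lie in the maximal ideal.  So the residue field is a quotient of \<open>S\<close>,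
  and an inverse modulo the maximal ideal can be chosen in \<open>S\<close> by setting \<open>y\<close> and \<open>z\<close> to \<open>0\<close>.
\<close>

lemma maximal_contract_S:
  assumes M: "maximalideal M T"
  shows "maximal_in S ({p \<in> polys U. res p \<in> M} \<inter> polys S)"
proof -
  interpret T: cring T by (rule cring_T)
  interpret M: maximalideal M T by (rule M)
  interpret h: ring_hom_ring R T res by (rule res_hom)
  have Mp: "primeideal M T" by (rule T.maximalideal_prime[OF M])
  define m where "m = {p \<in> polys U. res p \<in> M}"
  have m: "primeideal m R" "I \<subseteq> m" unfolding m_def using vimage_prime[OF Mp] by auto
  have mI: "ideal m R" using m(1) by (simp add: primeideal_poly_ring_iff)
  have yz: "y \<in> m" "z \<in> m" using yz_in_prime[OF m] by auto
  have SU: "p \<in> polys S \<Longrightarrow> p \<in> polys U" for p :: "'k mpoly" using AV_U S_AV by blast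
  have "\<exists>t\<in>polys S. t * s - 1 \<in> m \<inter> polys S" if s: "s \<in> polys S" "s \<notin> m" for s
  proof -
    have sU: "s \<in> polys U" using SU s by blast
    have sT: "res s \<in> carrier T" using sU h.hom_closed by simp
    have sM: "res s \<notin> M" using s sU by (simp add: m_def)
    let ?J = "M <+>\<^bsub>T\<^esub> PIdl\<^bsub>T\<^esub> (res s)"
    have J: "ideal ?J T" by (intro T.add_ideals M.is_ideal T.cgenideal_ideal sT)
    have P0: "\<zero>\<^bsub>T\<^esub> \<in> PIdl\<^bsub>T\<^esub> (res s)"
      using T.cgenideal_ideal[OF sT] by (meson additive_subgroup.zero_closed ideal.axioms(1))
    have M_sub: "M \<subseteq> ?J"
    proof
      fix x assume x: "x \<in> M"
      then have "x \<oplus>\<^bsub>T\<^esub> \<zero>\<^bsub>T\<^esub> \<in> ?J" using P0 unfolding set_add_def' by blast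
      then show "x \<in> ?J" using x M.Icarr by simp
    qed
    have "\<zero>\<^bsub>T\<^esub> \<oplus>\<^bsub>T\<^esub> res s \<in> ?J"
      using M.zero_closed T.cgenideal_self[OF sT] unfolding set_add_def' by blast
    then have "res s \<in> ?J" using sT by simp
    then have "?J \<noteq> M" using sM by blast
    moreover have "?J \<subseteq> carrier T" using J by (meson additive_subgroup.a_subset ideal.axioms(1))
    ultimately have "?J = carrier T" using M.I_maximal[OF J M_sub] by blast
    then have "\<one>\<^bsub>T\<^esub> \<in> ?J" by simp
    then obtain \<mu> \<tau> where mt: "\<mu> \<in> M" "\<tau> \<in> carrier T" "\<one>\<^bsub>T\<^esub> = \<mu> \<oplus>\<^bsub>T\<^esub> \<tau> \<otimes>\<^bsub>T\<^esub> res s"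
      unfolding set_add_def' cgenideal_def by blast
    obtain t where t: "t \<in> polys U" "\<tau> = res t" using T_carrier mt(2) by blast
    obtain u where u: "u \<in> polys U" "\<mu> = res u" using T_carrier M.Icarr[OF mt(1)] by blast
    have um: "u \<in> m" using u mt(1) by (simp add: m_def)
    have "res (u + t * s) = res 1"
      using mt(3) t u sU h.hom_add[of u "t * s"] h.hom_mult[of t s] h.hom_one polys_mult[OF t(1) sU] by simp
    then have eq: "(u + t * s) - 1 \<in> I"
    proof -
      have carr: "u + t * s \<in> carrier R" "(1 :: 'k mpoly) \<in> carrier R"
        using u(1) polys_mult[OF t(1) sU] by auto
      have "(u + t * s) \<ominus>\<^bsub>R\<^esub> 1 = (u + t * s) - 1"
        using a_inv_poly_ring[of "1 :: 'k mpoly" U] by (simp add: a_minus_def)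
      then show ?thesis
        using h.R.quotient_eq_iff_same_a_r_cos[OF I_ideal carr] \<open>res (u + t * s) = res 1\<close> by simp
    qed
    have "((u + t * s) - 1) - u \<in> m"
      by (rule ideal_diff_closed[OF mI subsetD[OF m(2) eq] um])
    then have ts: "t * s - 1 \<in> m" by (simp add: algebra_simps)
    define t1 where "t1 = drop_var (n - 1) t"
    define t0 where "t0 = drop_var n t1"
    have t1: "t1 \<in> polys (U - {n - 1})" unfolding t1_def by (rule drop_var_in_polys[OF t(1)])
    have t0: "t0 \<in> polys S"
      unfolding t0_def by (rule polys_monoD[OF drop_var_in_polys[OF t1]]) auto
    have t1U: "t1 \<in> polys U" by (rule polys_monoD[OF t1]) auto
    obtain r where r: "t - y * r = t1" "r \<in> polys U" using drop_var_remainder[OF t(1), of "n - 1"] unfolding t1_def by blast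
    obtain r' where r': "t1 - z * r' = t0" "r' \<in> polys U" using drop_var_remainder[OF t1U, of n] unfolding t0_def by blast
    have "r * y + r' * z \<in> m"
      by (rule ideal_add_closed[OF mI ideal_mult_closed[OF mI r(2) yz(1)] ideal_mult_closed[OF mI r'(2) yz(2)]])
    then have "s * (r * y + r' * z) \<in> m" by (rule ideal_mult_closed[OF mI sU])
    then have "(t * s - 1) - s * (r * y + r' * z) \<in> m" by (rule ideal_diff_closed[OF mI ts])
    moreover have "(t * s - 1) - s * (r * y + r' * z) = t0 * s - 1"
      unfolding r'(1)[symmetric] r(1)[symmetric] by (simp add: algebra_simps)
    ultimately have "t0 * s - 1 \<in> m" by simp
    moreover have "t0 * s - 1 \<in> polys S" by (rule polys_diff[OF polys_mult[OF t0 s(1)]]) simp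
    ultimately show ?thesis using t0 by blast
  qed
  moreover have "ideal (m \<inter> polys S) (poly_ring S)"
    unfolding ideal_poly_ring_iff
    using ideal_0[OF mI] ideal_add_closed[OF mI] ideal_mult_closed[OF mI SU] by auto
  moreover have "1 \<notin> m" using m(1) by (simp add: primeideal_poly_ring_iff)
  ultimately show ?thesis
    unfolding maximal_in_def m_def[symmetric] by auto
qed

text \<open>
  A regular sequence of length \<open>n - 2\<close> in the contraction to \<open>S\<close> stays regular on the quotient.
\<close>

lemma depth_T_ge:
  assumes M: "maximalideal M T" shows "enat (n - 2) \<le> depth T M"
proof -
  interpret T: cring T by (rule cring_T)
  interpret M: maximalideal M T by (rule M)
  interpret h: ring_hom_ring R T res by (rule res_hom)
  obtain as where as: "length as = n - 2" "set as \<subseteq> {p \<in> polys U. res p \<in> M} \<inter> polys S" "reg_seq S as"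
    using ex_reg_seq_maximal[OF _ maximal_contract_S[OF M]] by auto
  let ?bs = "map res as"
  have asU: "set as \<subseteq> polys U" and asS: "set as \<subseteq> polys S" using as(2) by auto
  have bsM: "set ?bs \<subseteq> M" using as(2) by auto
  have reg: "regular_sequence T ?bs"
    unfolding regular_sequence_def
  proof (intro conjI allI impI ballI)
    show "set ?bs \<subseteq> carrier T" using bsM M.Icarr by blast
    have "Idl\<^bsub>T\<^esub> (set ?bs) \<subseteq> M" by (rule T.genideal_minimal[OF M.is_ideal bsM])
    then show "Idl\<^bsub>T\<^esub> (set ?bs) \<noteq> carrier T"
      using M.I_notcarr M.a_subset by blast
  next
    fix i b assume i: "i < length ?bs" and b: "b \<in> carrier T"
      and mem: "?bs ! i \<otimes>\<^bsub>T\<^esub> b \<in> Idl\<^bsub>T\<^esub> (set (take i ?bs))"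
    obtain p where p: "p \<in> polys U" "b = res p" using T_carrier[OF b] by blast
    have ai: "as ! i \<in> polys S" using asS i by auto
    then have aiU: "as ! i \<in> polys U" using AV_U S_AV by blast
    have tkU: "set (take i as) \<subseteq> polys U" and tkS: "set (take i as) \<subseteq> polys S"
      using asU asS set_take_subset[of i as] by auto
    have "?bs ! i \<otimes>\<^bsub>T\<^esub> b = res (as ! i * p)"
      using i p aiU h.hom_mult[of "as ! i" p] by simp
    then have "res (as ! i * p) \<in> Idl\<^bsub>T\<^esub> (set (map res (take i as)))"
      using mem by (simp only: take_map)
    then obtain w j where wj: "w \<in> I" "j \<in> ideal_gen U (take i as)" "as ! i * p = w + j"
      using mem_Idl_Quot_iff[OF I_ideal tkU polys_mult[OF aiU p(1)]] by blast
    have "\<exists>w\<in>I. \<exists>j\<in>ideal_gen U (take i as). p = w + j"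
      using as(3) i by (intro nzd_mod_base_ideal[OF tkS ai _ p(1) wj(3,1,2)]) (auto simp: reg_seq_def)
    then show "b \<in> Idl\<^bsub>T\<^esub> (set (take i ?bs))"
      using mem_Idl_Quot_iff[OF I_ideal tkU p(1)] by (simp only: take_map p(2))
  qed
  have "enat (length ?bs) \<le> depth T M"
    unfolding depth_def using reg bsM by (intro Sup_upper) blast
  then show ?thesis using as(1) by simp
qed

lemma cohen_macaulay_T: "cohen_macaulay T"
  unfolding cohen_macaulay_def
proof (intro conjI allI impI)
  interpret R: cring R by (rule cring_poly_ring)
  interpret T: cring T by (rule cring_T)
  show "cring T" by (rule cring_T)
  show "noetherian_ring T"
    by (rule R.noetherian_ring_Quot[OF noetherian_poly_ring I_ideal]) simp
  fix M assume M: "maximalideal M T"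
  have Mp: "primeideal M T" by (rule T.maximalideal_prime[OF M])
  show "depth T M = prime_height T M"
    using T.depth_le_prime_height[OF Mp] prime_height_T_le[OF Mp] depth_T_ge[OF M] by (meson antisym order_trans)
qed

theorem codim2_cm_cremona_map_forms: "codim2_cm_cremona_map n forms"
proof -
  have "base_ideal n forms = I"
    unfolding base_ideal_def by (rule ideal_gen_eq_Idl[OF forms_polys])
  then show ?thesis
    unfolding codim2_cm_cremona_map_def
    using cremona_map_forms ideal_height_I cohen_macaulay_T by simp
qed

end

theorem theorem2p12:
  fixes n :: nat and F :: "'k::field mpoly"
  assumes "infinite (UNIV :: 'k set)"
    and "CHAR('k) = 0 \<or> CHAR('k) \<ge> n"
    and "n \<ge> 3"
    and "F = sub_hankel_det n"
  shows "(\<forall>i\<le>n - 2. Var n dvd partial_deriv i F) \<and>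
    (\<forall>q\<ge>1.
      let forms =
        map (\<lambda>i. exact_quot (partial_deriv i F) (Var n) * Var n ^ q) [0..<n - 1] @
        [partial_deriv (n - 1) F * Var n ^ (q - 1) +
         exact_quot (partial_deriv (n - 2) F) (Var n) * Var (n - 1) ^ q]
      in set forms \<subseteq> carrier (poly_ring {1..n}) \<and> codim2_cm_cremona_map n forms)"
proof -
  have n1: "n \<ge> 1" using assms(3) by simp
  \<comment> \<open>The sign \<open>c\<close> does not depend on \<open>i\<close>, so it is common to all the forms.\<close>
  obtain c :: "'k mpoly" where c: "c = 1 \<or> c = - 1"
    and D: "\<And>i. i < n \<Longrightarrow> partial_deriv i F = c * (Var n ^ (n - 1 - i) * G n i)"
    using partial_deriv_sub_hankel_det[OF n1] assms(4) by metis
  have D_low: "partial_deriv i F = Var n * (c * (Var n ^ (n - 2 - i) * G n i))" if i: "i \<le> n - 2" for i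
  proof -
    have "n - 1 - i = Suc (n - 2 - i)" "i < n" using i assms(3) by auto
    then show ?thesis by (simp add: D mult_ac)
  qed
  have quot: "exact_quot (partial_deriv i F) (Var n) = c * (Var n ^ (n - 2 - i) * G n i)" if "i \<le> n - 2" for i
    unfolding D_low[OF that] by (rule exact_quot_mult) simp
  have calc: "c * (a * g) * b = c * (a * b * g)" for a b g :: "'k mpoly" by (simp add: mult_ac)
  have last: "partial_deriv (n - 1) F = c * G n (n - 1)"
    using D[of "n - 1"] assms(3) by simp
  have main: "set forms \<subseteq> carrier (poly_ring {1..n}) \<and> codim2_cm_cremona_map n forms"
    if q: "q \<ge> 1" and forms: "forms = map (\<lambda>i. exact_quot (partial_deriv i F) (Var n) * Var n ^ q) [0..<n - 1] @
        [partial_deriv (n - 1) F * Var n ^ (q - 1) +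
         exact_quot (partial_deriv (n - 2) F) (Var n) * Var (n - 1) ^ q]" for q forms
  proof -
    interpret shm: sub_hankel_map n q c
      using assms(2,3) q c by unfold_locales auto
    have "forms = shm.forms"
    proof (rule nth_equalityI)
      show len: "length forms = length shm.forms" using assms(3) by (simp add: forms)
      fix i assume "i < length forms"
      then have i: "i < n" using len by simp
      show "forms ! i = shm.forms ! i"
      proof (cases "i < n - 1")
        case True
        then have "forms ! i = exact_quot (partial_deriv i F) (Var n) * Var n ^ q"
          by (simp add: forms nth_append)
        also have "\<dots> = c * (Var n ^ (n - 2 - i + q) * G n i)"
        proof -
          have "i \<le> n - 2" using True by simp
          then show ?thesis by (simp only: quot power_add calc)
        qed
        finally show ?thesis using True i by (simp add: shm.forms_nth shm.form_def)
      next
        case False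
        then have i: "i = n - 1" using i by simp
        have "forms ! i = partial_deriv (n - 1) F * Var n ^ (q - 1) +
         exact_quot (partial_deriv (n - 2) F) (Var n) * Var (n - 1) ^ q"
          by (simp add: forms nth_append i)
        also have "\<dots> = shm.form (n - 1)"
          unfolding last quot[OF order_refl] shm.form_last by (simp add: algebra_simps)
        finally show ?thesis using assms(3) i by (simp add: shm.forms_nth)
      qed
    qed
    then show ?thesis
      using shm.forms_polys shm.codim2_cm_cremona_map_forms by (simp add: carrier_poly_ring)
  qed
  show ?thesis
    unfolding Let_def
  proof (intro conjI allI impI)
    show "Var n dvd partial_deriv i F" if "i \<le> n - 2" for i
      unfolding D_low[OF that] by (rule dvd_triv_left)
  qed (use main in blast)+
qed

end
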